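(* Let $Y$ be a quasiconformal Jordan domain such that $\partial Y$ is a quasicircle and such that there exists $C_U > 0$ with $$\mathcal{H}^{2}_{\overline{Y}}(\overline{B}_{\overline{Y}}(y,r)) \leq C_U r^{2}\quad\text{for all } y \in \partial Y,\ 0 < r < \operatorname{diam} \partial Y.$$ Suppose that the following two conditions hold for some $r_0>0$, $C>0$ and $\lambda>1$: (a) For every $y\in\partial Y$, every $0<2r<R<r_0$ and every pair $a,b\in\overline{B}_{\overline{Y}}(y,R)\setminus B_{\overline{Y}}(y,r)$, there exists a path whose image is contained in $\overline{B}_{\overline{Y}}(y,\lambda R)\setminus B_{\overline{Y}}(y,\lambda^{-1}r)$ and contains $a$ and $b$. (b) For every $z\in Y$ and $r$ with $0<r<d(z,\partial Y)\leq r_0$, $\mathcal{H}^{2}_{\overline{Y}}(\overline{B}_{\overline{Y}}(z,r))\geq C^{-1}r^{2}$. Then the Assouad dimension of $\partial Y$ is strictly less than two. In particular, $\partial Y$ is planar, i.e. there exists a bi-Lipschitz embedding $h\colon\partial Y\to\mathbb{R}^2$.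
   Context: $\mathbb{D}$ is the open unit disk in $\mathbb{R}^{2}$, $\overline{\mathbb{D}}$ its closure, $\mathbb{S}^{1}$ its boundary circle (with the Euclidean metric). $\mathcal{H}^{2}_{Z}$ denotes the Hausdorff $2$-measure of a metric space $Z$, normalized so that $\mathcal{H}^2_{\mathbb{R}^2}$ is Lebesgue measure. $B_Z(y,r)$ and $\overline{B}_Z(y,r)$ are the open and closed balls; $d$ is the metric of $\overline{Y}$. Modulus: let $Z$ be a metric space with locally finite $\mathcal{H}^2_Z$ and $\Gamma$ a family of paths in $Z$. A Borel function $\rho \colon Z \to [0,\infty]$ is admissible for $\Gamma$ if $\int_{\gamma} \rho\, ds \geq 1$ for every rectifiable $\gamma \in \Gamma$. The modulus is $\operatorname{Mod}\Gamma = \inf \int_Z \rho^2 \, d\mathcal{H}^2_Z$, the infimum over all admissible $\rho$. A homeomorphism $\psi \colon Z \to W$ between metric spaces with locally finite Hausdorff $2$-measure is quasiconformal if there is $K\geq 1$ with $K^{-1}\operatorname{Mod}\Gamma \leq \operatorname{Mod}\psi\Gamma \leq K \operatorname{Mod}\Gamma$ for all path families $\Gamma$ in $Z$, where $\psi\Gamma = \{\psi\circ\gamma : \gamma\in\Gamma\}$. A metric surface is a metric space homeomorphic to a $2$-manifold and with locally finite Hausdorff $2$-measure. A metric surface $(Y,d_Y)$ is a metric Jordan domain if its metric completion $\overline{Y}$ is homeomorphic to $\overline{\mathbb{D}}$, the boundary $\partial Y = \overline{Y}\setminus Y$ is homeomorphic to $\mathbb{S}^1$, and $\mathcal{H}^2_{\overline{Y}}(\overline{Y})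 < \infty$. It is a quasiconformal Jordan domain if in addition there exists a quasiconformal homeomorphism $\mathbb{D}\to Y$. Quasisymmetry: a homeomorphism $g\colon (Z,d_Z)\to(W,d_W)$ is quasisymmetric if there is a homeomorphism $\eta\colon[0,\infty)\to[0,\infty)$ such that for every $z\in Z$ and $0<r_1,r_2<\operatorname{diam}Z$, $\sup_{w\in\overline{B}_Z(z,r_1)}d_W(g(z),g(w))\leq\eta(r_1/r_2)\inf_{w\in Z\setminus B_Z(z,r_2)}d_W(g(z),g(w))$. A quasicircle is a metric space that is a quasisymmetric image of $\mathbb{S}^1$. Assouad dimension: a set $S$ is $s$-separated if distinct points of $S$ are at distance at least $s$. A metric space $Z$ has Assouad dimension bounded from above by $Q>0$ if there is a constant $C'$ such that for every $0<\epsilon<1$, every $z\in Z$ and $0<r<\operatorname{diam}Z$, every $\epsilon r$-separated set $S\subset B_Z(z,r)$ has cardinality $\#S\leq C'\epsilon^{-Q}$. The Assouad dimension of $Z$ is the infimum of such $Q$. *)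

theory Defs
  imports "HOL-Analysis.Analysis"
begin

text \<open>Values in \<^typ>\<open>ennreal\<close>: unbounded sets have diameter \<open>\<infinity>\<close>, the empty set has diameter 0.\<close>

definition mdiam :: "'a metric \<Rightarrow> 'a set \<Rightarrow> ennreal" where
  "mdiam m A = (SUP x\<in>A. SUP y\<in>A. ennreal (mdist m x y))"

text \<open>Only meaningful for nonempty \<open>A\<close> (real-valued infimum).\<close>

definition mdist_set :: "'a metric \<Rightarrow> 'a \<Rightarrow> 'a set \<Rightarrow> real" where
  "mdist_set m x A = (INF a\<in>A. mdist m x a)"

definition metric_completion :: "'a metric \<Rightarrow> 'b metric \<Rightarrow> ('a \<Rightarrow> 'b) \<Rightarrow> bool" where
  "metric_completion Y Z \<iota> \<longleftrightarrow>
     mcomplete_of Z \<and>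
     \<iota> \<in> mspace Y \<rightarrow> mspace Z \<and>
     (\<forall>x\<in>mspace Y. \<forall>y\<in>mspace Y. mdist Z (\<iota> x) (\<iota> y) = mdist Y x y) \<and>
     mtopology_of Z closure_of (\<iota> ` mspace Y) = mspace Z"

lemma metric_completion_exists:
  fixes Y :: "'a metric"
  shows "\<exists>(Z :: ('a \<Rightarrow> real) metric) \<iota>. metric_completion Y Z \<iota>"
  using Metric_space.metric_completion[OF Metric_space_mspace_mdist[of Y]]
  unfolding metric_completion_def by metis

text \<open>The set \<open>\<partial>Y\<close> of points of the completion \<open>Z\<close> outside the copy of \<open>Y\<close>.\<close>

definition completion_boundary :: "'a metric \<Rightarrow> 'b metric \<Rightarrow> ('a \<Rightarrow> 'b) \<Rightarrow> 'b set" where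
  "completion_boundary Y Z \<iota> = mspace Z - \<iota> ` mspace Y"

text \<open>
  The factor \<open>\<pi>/4\<close> (the area of a disk of diameter 1) is the normalization for which
  the Hausdorff 2-measure of the Euclidean plane is Lebesgue measure.
\<close>

definition hausdorff2_pre :: "'a metric \<Rightarrow> real \<Rightarrow> 'a set \<Rightarrow> ennreal" where
  "hausdorff2_pre m \<delta> A =
     (INF U\<in>{U :: nat \<Rightarrow> 'a set. A \<subseteq> (\<Union>i. U i) \<and>
               (\<forall>i. U i \<subseteq> mspace m \<and> mdiam m (U i) \<le> ennreal \<delta>)}.
        \<Sum>i. ennreal (pi / 4) * (mdiam m (U i))\<^sup>2)"

definition hausdorff2 :: "'a metric \<Rightarrow> 'a set \<Rightarrow> ennreal" where
  "hausdorff2 m A = (SUP \<delta>\<in>{0<..}. hausdorff2_pre m \<delta> A)"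

definition hausdorff2_measure :: "'a metric \<Rightarrow> 'a measure" where
  "hausdorff2_measure m = measure_of (mspace m) {U. openin (mtopology_of m) U} (hausdorff2 m)"

definition locally_finite_hausdorff2 :: "'a metric \<Rightarrow> bool" where
  "locally_finite_hausdorff2 m \<longleftrightarrow>
     (\<forall>x\<in>mspace m. \<exists>r>0. hausdorff2 m (mball_of m x r) < \<infinity>)"

text \<open>
  Paths are \<^const>\<open>pathin\<close>, i.e. parametrized by \<open>[0,1]\<close>. Length and line integrals are
  invariant under affine changes of the parameter interval.
\<close>

definition path_length :: "'a metric \<Rightarrow> (real \<Rightarrow> 'a) \<Rightarrow> real \<Rightarrow> real \<Rightarrow> ennreal" where
  "path_length m \<gamma> a b =
     (SUP (n, t)\<in>{(n :: nat, t :: nat \<Rightarrow> real). mono_on {..n} t \<and> t ` {..n} \<subseteq> {a..b}}.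
        \<Sum>i<n. ennreal (mdist m (\<gamma> (t i)) (\<gamma> (t (Suc i)))))"

definition rectifiable_path :: "'a metric \<Rightarrow> (real \<Rightarrow> 'a) \<Rightarrow> bool" where
  "rectifiable_path m \<gamma> \<longleftrightarrow> pathin (mtopology_of m) \<gamma> \<and> path_length m \<gamma> 0 1 < \<infinity>"

text \<open>
  For a rectifiable path the length \<open>s(t)\<close> of \<open>\<gamma>\<close> on \<open>[0,t]\<close> is continuous, and \<open>\<gamma>\<close> is constant
  on the level sets of \<open>s\<close>; hence the choice of \<open>t\<close> is immaterial for \<open>0 \<le> u \<le> s(1)\<close>.
\<close>

definition arc_length_param :: "'a metric \<Rightarrow> (real \<Rightarrow> 'a) \<Rightarrow> real \<Rightarrow> 'a" where
  "arc_length_param m \<gamma> u = \<gamma> (SOME t. t \<in> {0..1} \<and> path_length m \<gamma> 0 t = ennreal u)"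

definition path_integral :: "'a metric \<Rightarrow> ('a \<Rightarrow> ennreal) \<Rightarrow> (real \<Rightarrow> 'a) \<Rightarrow> ennreal" where
  "path_integral m \<rho> \<gamma> =
     (\<integral>\<^sup>+u\<in>{0..enn2real (path_length m \<gamma> 0 1)}. \<rho> (arc_length_param m \<gamma> u) \<partial>lborel)"

text \<open>The \<open>\<sigma>\<close>-algebra of \<^const>\<open>hausdorff2_measure\<close> is the Borel one.\<close>

definition admissible :: "'a metric \<Rightarrow> (real \<Rightarrow> 'a) set \<Rightarrow> ('a \<Rightarrow> ennreal) \<Rightarrow> bool" where
  "admissible m \<Gamma> \<rho> \<longleftrightarrow>
     \<rho> \<in> borel_measurable (hausdorff2_measure m) \<and>
     (\<forall>\<gamma>\<in>\<Gamma>. rectifiable_path m \<gamma> \<longrightarrow> path_integral m \<rho> \<gamma> \<ge> 1)"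

definition modulus :: "'a metric \<Rightarrow> (real \<Rightarrow> 'a) set \<Rightarrow> ennreal" where
  "modulus m \<Gamma> = (INF \<rho>\<in>{\<rho>. admissible m \<Gamma> \<rho>}. \<integral>\<^sup>+x. (\<rho> x)\<^sup>2 \<partial>hausdorff2_measure m)"

definition quasiconformal_homeo :: "'a metric \<Rightarrow> 'b metric \<Rightarrow> ('a \<Rightarrow> 'b) \<Rightarrow> bool" where
  "quasiconformal_homeo Z W \<psi> \<longleftrightarrow>
     locally_finite_hausdorff2 Z \<and> locally_finite_hausdorff2 W \<and>
     homeomorphic_map (mtopology_of Z) (mtopology_of W) \<psi> \<and>
     (\<exists>K\<ge>1. \<forall>\<Gamma> \<subseteq> {\<gamma>. pathin (mtopology_of Z) \<gamma>}.
        ennreal (inverse K) * modulus Z \<Gamma> \<le> modulus W ((\<lambda>\<gamma>. \<psi> \<circ> \<gamma>) ` \<Gamma>) \<and>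
        modulus W ((\<lambda>\<gamma>. \<psi> \<circ> \<gamma>) ` \<Gamma>) \<le> ennreal K * modulus Z \<Gamma>)"

definition two_manifold :: "'a topology \<Rightarrow> bool" where
  "two_manifold X \<longleftrightarrow>
     Hausdorff_space X \<and> second_countable X \<and>
     (\<forall>x\<in>topspace X. \<exists>U. openin X U \<and> x \<in> U \<and>
        (\<exists>V :: (real^2) set. open V \<and> subtopology X U homeomorphic_space top_of_set V))"

definition metric_surface :: "'a metric \<Rightarrow> bool" where
  "metric_surface m \<longleftrightarrow> two_manifold (mtopology_of m) \<and> locally_finite_hausdorff2 m"

definition unit_disk :: "(real^2) metric" where
  "unit_disk = submetric euclidean_metric (ball 0 1)"

definition unit_circle :: "(real^2) metric" where
  "unit_circle = submetric euclidean_metric (sphere 0 1)"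

text \<open>In the next two definitions \<open>Z\<close> with \<open>\<iota>\<close> is the completion of \<open>Y\<close>.\<close>

definition metric_Jordan_domain :: "'a metric \<Rightarrow> 'b metric \<Rightarrow> ('a \<Rightarrow> 'b) \<Rightarrow> bool" where
  "metric_Jordan_domain Y Z \<iota> \<longleftrightarrow>
     metric_surface Y \<and>
     metric_completion Y Z \<iota> \<and>
     mtopology_of Z homeomorphic_space top_of_set (cball (0 :: real^2) 1) \<and>
     mtopology_of (submetric Z (completion_boundary Y Z \<iota>))
       homeomorphic_space mtopology_of unit_circle \<and>
     hausdorff2 Z (mspace Z) < \<infinity>"

definition quasiconformal_Jordan_domain :: "'a metric \<Rightarrow> 'b metric \<Rightarrow> ('a \<Rightarrow> 'b) \<Rightarrow> bool" where
  "quasiconformal_Jordan_domain Y Z \<iota> \<longleftrightarrow>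
     metric_Jordan_domain Y Z \<iota> \<and> (\<exists>\<psi>. quasiconformal_homeo unit_disk Y \<psi>)"

text \<open>
  Supremum and infimum are taken in \<^typ>\<open>ennreal\<close>, so that the infimum over the empty set
  (which occurs when \<open>B(z,r\<^sub>2)\<close> is the whole space) is \<open>\<infinity>\<close>.
\<close>

definition quasisymmetric_homeo :: "'a metric \<Rightarrow> 'b metric \<Rightarrow> ('a \<Rightarrow> 'b) \<Rightarrow> bool" where
  "quasisymmetric_homeo Z W g \<longleftrightarrow>
     homeomorphic_map (mtopology_of Z) (mtopology_of W) g \<and>
     (\<exists>\<eta> :: real \<Rightarrow> real. homeomorphic_map (top_of_set {0..}) (top_of_set {0..}) \<eta> \<and>
        (\<forall>z\<in>mspace Z. \<forall>r1 r2.
           0 < r1 \<and> ennreal r1 < mdiam Z (mspace Z) \<and>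
           0 < r2 \<and> ennreal r2 < mdiam Z (mspace Z) \<longrightarrow>
           (SUP w\<in>mcball_of Z z r1. ennreal (mdist W (g z) (g w)))
             \<le> ennreal (\<eta> (r1 / r2)) *
               (INF w\<in>mspace Z - mball_of Z z r2. ennreal (mdist W (g z) (g w)))))"

definition quasicircle :: "'a metric \<Rightarrow> bool" where
  "quasicircle m \<longleftrightarrow> (\<exists>g. quasisymmetric_homeo unit_circle m g)"

definition separated_set :: "'a metric \<Rightarrow> real \<Rightarrow> 'a set \<Rightarrow> bool" where
  "separated_set m s S \<longleftrightarrow> (\<forall>x\<in>S. \<forall>y\<in>S. x \<noteq> y \<longrightarrow> s \<le> mdist m x y)"

definition assouad_bounded :: "'a metric \<Rightarrow> real \<Rightarrow> bool" where
  "assouad_bounded m Q \<longleftrightarrow>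
     (\<exists>C'. \<forall>\<epsilon> z r. 0 < \<epsilon> \<and> \<epsilon> < 1 \<and> z \<in> mspace m \<and> 0 < r \<and> ennreal r < mdiam m (mspace m) \<longrightarrow>
        (\<forall>S \<subseteq> mball_of m z r. separated_set m (\<epsilon> * r) S \<longrightarrow>
           finite S \<and> real (card S) \<le> C' * \<epsilon> powr (- Q)))"

definition assouad_dim :: "'a metric \<Rightarrow> ennreal" where
  "assouad_dim m = (INF Q\<in>{Q. Q > 0 \<and> assouad_bounded m Q}. ennreal Q)"

definition bilipschitz_embedding :: "'a metric \<Rightarrow> 'b metric \<Rightarrow> ('a \<Rightarrow> 'b) \<Rightarrow> bool" where
  "bilipschitz_embedding Z W h \<longleftrightarrow>
     h \<in> mspace Z \<rightarrow> mspace W \<and>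
     (\<exists>L\<ge>1. \<forall>x\<in>mspace Z. \<forall>y\<in>mspace Z.
        mdist Z x y / L \<le> mdist W (h x) (h y) \<and> mdist W (h x) (h y) \<le> L * mdist Z x y)"

text \<open>
  \<^const>\<open>hausdorff2\<close> is a metric outer measure, so by Caratheodory's criterion it is countably
  additive on Borel sets. This guarantees that \<^const>\<open>measure_of\<close> in the definition of
  \<^const>\<open>hausdorff2_measure\<close> does not degenerate to the zero measure.
\<close>

lemma mdiam_mono: "A \<subseteq> B \<Longrightarrow> mdiam m A \<le> mdiam m B"
  unfolding mdiam_def by (intro SUP_mono) (blast intro: SUP_mono)

lemma mdist_le_mdiam: "x \<in> A \<Longrightarrow> y \<in> A \<Longrightarrow> ennreal (mdist m x y) \<le> mdiam m A"
  unfolding mdiam_def by (meson SUP_upper2 SUP_upper)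

lemma mdiam_empty [simp]: "mdiam m {} = 0"
  by (simp add: mdiam_def bot_ennreal)

lemma hausdorff2_pre_antimono:
  assumes "\<delta> \<le> \<epsilon>" shows "hausdorff2_pre m \<epsilon> A \<le> hausdorff2_pre m \<delta> A"
  unfolding hausdorff2_pre_def
  using order_trans[OF _ ennreal_leI[OF assms]] by (intro INF_superset_mono) auto

lemma hausdorff2_pre_mono: "A \<subseteq> B \<Longrightarrow> hausdorff2_pre m \<delta> A \<le> hausdorff2_pre m \<delta> B"
  unfolding hausdorff2_pre_def by (intro INF_superset_mono) auto

lemma hausdorff2_mono: "A \<subseteq> B \<Longrightarrow> hausdorff2 m A \<le> hausdorff2 m B"
  unfolding hausdorff2_def by (intro SUP_mono) (blast intro: hausdorff2_pre_mono)

lemma hausdorff2_pre_le: "0 < \<delta> \<Longrightarrow> hausdorff2_pre m \<delta> A \<le> hausdorff2 m A"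
  unfolding hausdorff2_def by (auto intro: SUP_upper)

lemma hausdorff2_pre_empty: "hausdorff2_pre m \<delta> {} = 0"
proof -
  have "hausdorff2_pre m \<delta> {} \<le> (\<Sum>i. ennreal (pi / 4) * (mdiam m ((\<lambda>i::nat. {}) i))\<^sup>2)"
    unfolding hausdorff2_pre_def by (rule INF_lower) auto
  then show ?thesis by simp
qed

lemma hausdorff2_empty: "hausdorff2 m {} = 0"
  by (simp add: hausdorff2_def hausdorff2_pre_empty)

lemma hausdorff2_pre_subadd:
  "hausdorff2_pre m \<delta> (\<Union>i. A i) \<le> (\<Sum>i. hausdorff2_pre m \<delta> (A i))"
proof (rule ennreal_le_epsilon)
  fix e :: real assume fin: "(\<Sum>i. hausdorff2_pre m \<delta> (A i)) < top" and e: "0 < e"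
  define c where "c U = ennreal (pi / 4) * (mdiam m U)\<^sup>2" for U
  have "\<exists>U. A i \<subseteq> (\<Union>j. U j) \<and> (\<forall>j. U j \<subseteq> mspace m \<and> mdiam m (U j) \<le> ennreal \<delta>) \<and>
          (\<Sum>j::nat. c (U j)) < hausdorff2_pre m \<delta> (A i) + e * (1/2)^Suc i" for i
  proof -
    have "hausdorff2_pre m \<delta> (A i) \<le> (\<Sum>i. hausdorff2_pre m \<delta> (A i))"
      using sum_le_suminf[of "\<lambda>i. hausdorff2_pre m \<delta> (A i)" "{i}"] by simp
    then have "hausdorff2_pre m \<delta> (A i) < hausdorff2_pre m \<delta> (A i) + e * (1/2)^Suc i"
      using fin e by (auto simp: less_top ennreal_add_left_cancel_less
          simp flip: ennreal_power dest: le_less_trans)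
    then show ?thesis
      unfolding hausdorff2_pre_def[of m \<delta> "A i"] INF_less_iff c_def[symmetric] by auto
  qed
  then obtain U where U: "\<And>i. A i \<subseteq> (\<Union>j::nat. U i j)"
      "\<And>i j. U i j \<subseteq> mspace m \<and> mdiam m (U i j) \<le> ennreal \<delta>"
      "\<And>i. (\<Sum>j. c (U i j)) < hausdorff2_pre m \<delta> (A i) + e * (1/2)^Suc i"
    by metis
  define V where "V n = case_prod U (prod_decode n)" for n
  have "hausdorff2_pre m \<delta> (\<Union>i. A i) \<le> (\<Sum>n. c (V n))"
    unfolding hausdorff2_pre_def c_def
  proof (rule INF_lower, intro CollectI conjI allI)
    show "(\<Union>i. A i) \<subseteq> (\<Union>n. V n)"
    proof
      fix x assume "x \<in> (\<Union>i. A i)"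
      then obtain i j where "x \<in> U i j" using U(1) by blast
      then have "x \<in> V (prod_encode (i,j))" by (simp add: V_def)
      then show "x \<in> (\<Union>n. V n)" by blast
    qed
    show "V n \<subseteq> mspace m" "mdiam m (V n) \<le> ennreal \<delta>" for n
      using U(2) by (auto simp: V_def split: prod.split)
  qed
  also have "(\<Sum>n. c (V n)) = (\<Sum>i. \<Sum>j. c (U i j))"
    using suminf_ennreal_2dimen[of "\<lambda>i. \<Sum>j. c (U i j)" "\<lambda>(i,j). c (U i j)"]
    by (simp add: V_def comp_def case_prod_unfold)
  also have "\<dots> \<le> (\<Sum>i. hausdorff2_pre m \<delta> (A i) + e * (1/2)^Suc i)"
    using U(3) by (intro suminf_le) (auto intro: less_imp_le)
  also have "\<dots> = (\<Sum>i. hausdorff2_pre m \<delta> (A i)) + (\<Sum>i. ennreal e * ennreal ((1/2)^Suc i))"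
    using e by (subst suminf_add[symmetric]) (auto simp flip: ennreal_mult ennreal_power)
  also have "(\<Sum>i. ennreal e * ennreal ((1/2)^Suc i)) = ennreal e"
    unfolding ennreal_suminf_cmult
    by (subst suminf_ennreal_eq[OF zero_le_power power_half_series]) auto
  finally show "hausdorff2_pre m \<delta> (\<Union>i. A i) \<le> (\<Sum>i. hausdorff2_pre m \<delta> (A i)) + ennreal e" .
qed

lemma hausdorff2_subadd: "hausdorff2 m (\<Union>i. A i) \<le> (\<Sum>i. hausdorff2 m (A i))"
  unfolding hausdorff2_def[of m "\<Union>i. A i"]
proof (rule SUP_least)
  fix \<delta> :: real assume "\<delta> \<in> {0<..}"
  then show "hausdorff2_pre m \<delta> (\<Union>i. A i) \<le> (\<Sum>i. hausdorff2 m (A i))"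
    using hausdorff2_pre_subadd[of m \<delta> A]
    by (elim order_trans) (auto intro!: suminf_le hausdorff2_pre_le)
qed

lemma hausdorff2_subadd2: "hausdorff2 m (A \<union> B) \<le> hausdorff2 m A + hausdorff2 m B"
proof -
  have "hausdorff2 m (A \<union> B) = hausdorff2 m (\<Union>i. binaryset A B i)"
    by (simp add: UN_binaryset_eq)
  also have "\<dots> \<le> (\<Sum>i. hausdorff2 m (binaryset A B i))"
    by (rule hausdorff2_subadd)
  also have "\<dots> = hausdorff2 m A + hausdorff2 m B"
    by (rule suminf_binaryset_eq) (simp add: hausdorff2_empty)
  finally show ?thesis .
qed

lemma hausdorff2_pre_separated:
  assumes "\<And>x y. x \<in> A \<Longrightarrow> y \<in> B \<Longrightarrow> \<delta> < mdist m x y" and \<delta>: "0 < \<delta>"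
  shows "hausdorff2_pre m \<delta> A + hausdorff2_pre m \<delta> B \<le> hausdorff2_pre m \<delta> (A \<union> B)"
  unfolding hausdorff2_pre_def[of m \<delta> "A \<union> B"]
proof (rule INF_greatest, elim CollectE conjE)
  fix U :: "nat \<Rightarrow> 'a set"
  assume cov: "A \<union> B \<subseteq> (\<Union>i. U i)"
    and U: "\<forall>i. U i \<subseteq> mspace m \<and> mdiam m (U i) \<le> ennreal \<delta>"
  define c where "c U = ennreal (pi / 4) * (mdiam m U)\<^sup>2" for U
  define V where "V S i = (if U i \<inter> S = {} then {} else U i)" for S i
  have pre: "hausdorff2_pre m \<delta> S \<le> (\<Sum>i. c (V S i))" if "S \<subseteq> A \<union> B" for S
    unfolding hausdorff2_pre_def c_def
  proof (rule INF_lower, intro CollectI conjI allI)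
    show "S \<subseteq> (\<Union>i. V S i)"
    proof
      fix x assume "x \<in> S"
      moreover then obtain i where "x \<in> U i" using cov \<open>S \<subseteq> A \<union> B\<close> by blast
      ultimately have "x \<in> V S i" by (auto simp: V_def)
      then show "x \<in> (\<Union>i. V S i)" by blast
    qed
    show "V S i \<subseteq> mspace m" "mdiam m (V S i) \<le> ennreal \<delta>" for i
      using U by (auto simp: V_def)
  qed
  have "c (V A i) + c (V B i) \<le> c (U i)" for i
  proof -
    have False if x: "x \<in> U i \<inter> A" and y: "y \<in> U i \<inter> B" for x y
    proof -
      have "ennreal (mdist m x y) \<le> ennreal \<delta>"
        using mdist_le_mdiam[of x "U i" y m] x y U by (meson IntD1 order_trans)
      then show False
        using assms(1)[of x y] x y \<delta> by (auto simp: ennreal_le_iff)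
    qed
    then show ?thesis by (auto simp: V_def c_def)
  qed
  then have "(\<Sum>i. c (V A i) + c (V B i)) \<le> (\<Sum>i. c (U i))"
    by (intro suminf_le) auto
  then have "(\<Sum>i. c (V A i)) + (\<Sum>i. c (V B i)) \<le> (\<Sum>i. c (U i))"
    by (subst suminf_add) auto
  then show "hausdorff2_pre m \<delta> A + hausdorff2_pre m \<delta> B
      \<le> (\<Sum>i. ennreal (pi / 4) * (mdiam m (U i))\<^sup>2)"
    using add_mono[OF pre[of A] pre[of B]] by (auto simp: c_def intro: order_trans)
qed

lemma hausdorff2_separated:
  assumes sep: "\<And>x y. x \<in> A \<Longrightarrow> y \<in> B \<Longrightarrow> \<epsilon> \<le> mdist m x y" and \<epsilon>: "0 < \<epsilon>"
  shows "hausdorff2 m A + hausdorff2 m B \<le> hausdorff2 m (A \<union> B)"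
proof -
  have *: "hausdorff2_pre m \<delta> A + hausdorff2_pre m \<delta>' B \<le> hausdorff2 m (A \<union> B)"
    if "0 < \<delta>" "0 < \<delta>'" for \<delta> \<delta>'
  proof -
    define \<delta>0 where "\<delta>0 = min (\<epsilon> / 2) (min \<delta> \<delta>')"
    have "hausdorff2_pre m \<delta> A + hausdorff2_pre m \<delta>' B
        \<le> hausdorff2_pre m \<delta>0 A + hausdorff2_pre m \<delta>0 B"
      by (intro add_mono hausdorff2_pre_antimono) (auto simp: \<delta>0_def)
    also have "\<dots> \<le> hausdorff2_pre m \<delta>0 (A \<union> B)"
    proof (rule hausdorff2_pre_separated)
      show "\<delta>0 < mdist m x y" if "x \<in> A" "y \<in> B" for x y
        using sep[OF that] \<epsilon> by (auto simp: \<delta>0_def min_def)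
      show "0 < \<delta>0" using that \<epsilon> by (simp add: \<delta>0_def)
    qed
    also have "\<dots> \<le> hausdorff2 m (A \<union> B)"
      using that \<epsilon> by (intro hausdorff2_pre_le) (simp add: \<delta>0_def)
    finally show ?thesis .
  qed
  have ne: "{0<..} \<noteq> ({} :: real set)" by (auto intro: gt_ex)
  have "hausdorff2_pre m \<delta> A + hausdorff2 m B \<le> hausdorff2 m (A \<union> B)" if "0 < \<delta>" for \<delta>
    unfolding hausdorff2_def[of m B]
    by (subst ennreal_SUP_add_right[OF ne]) (auto intro!: SUP_least *[OF that])
  then show ?thesis
    unfolding hausdorff2_def[of m A]
    by (subst ennreal_SUP_add_left[OF ne, symmetric]) (auto intro!: SUP_least)
qed

lemma hausdorff2_separated_sum:
  fixes D :: "nat \<Rightarrow> 'a set"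
  assumes "\<And>i j. i < j \<Longrightarrow> \<exists>\<epsilon>>0. \<forall>x\<in>D i. \<forall>y\<in>D j. \<epsilon> \<le> mdist m x y"
  shows "(\<Sum>i<n. hausdorff2 m (D i)) \<le> hausdorff2 m (\<Union>i<n. D i)"
proof (induction n)
  case (Suc n)
  have "\<forall>i\<in>{..<n}. \<exists>\<epsilon>>0. \<forall>x\<in>D i. \<forall>y\<in>D n. \<epsilon> \<le> mdist m x y"
    using assms by blast
  then obtain e where e: "\<And>i. i < n \<Longrightarrow> 0 < e i"
      "\<And>i x y. i < n \<Longrightarrow> x \<in> D i \<Longrightarrow> y \<in> D n \<Longrightarrow> e i \<le> mdist m x y"
    unfolding bchoice_iff by auto
  define \<epsilon> where "\<epsilon> = Min (insert 1 (e ` {..<n}))"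
  have "hausdorff2 m (\<Union>i<n. D i) + hausdorff2 m (D n) \<le> hausdorff2 m ((\<Union>i<n. D i) \<union> D n)"
  proof (rule hausdorff2_separated)
    show "0 < \<epsilon>" using e(1) by (auto simp: \<epsilon>_def)
    fix x y assume "x \<in> (\<Union>i<n. D i)" and y: "y \<in> D n"
    then obtain i where i: "i < n" "x \<in> D i" by auto
    then have "\<epsilon> \<le> e i" unfolding \<epsilon>_def by (intro Min_le) auto
    then show "\<epsilon> \<le> mdist m x y" using e(2)[OF i y] by simp
  qed
  moreover have "(\<Union>i<Suc n. D i) = (\<Union>i<n. D i) \<union> D n"
    by (auto simp: lessThan_Suc)
  ultimately show ?case
    using add_right_mono[OF Suc, of "hausdorff2 m (D n)"]
    by (simp only: sum.lessThan_Suc)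
qed simp

lemma hausdorff2_open_lambda_system:
  assumes "openin (mtopology_of m) V"
  shows "V \<in> lambda_system (mspace m) (Pow (mspace m)) (hausdorff2 m)"
proof -
  let ?H = "hausdorff2 m"
  have VM: "V \<subseteq> mspace m" using openin_subset[OF assms] by simp
  have "?H (V \<inter> X) + ?H ((mspace m - V) \<inter> X) = ?H X" if X: "X \<subseteq> mspace m" for X
  proof (rule antisym)
    show "?H X \<le> ?H (V \<inter> X) + ?H ((mspace m - V) \<inter> X)"
      using hausdorff2_subadd2[of m "V \<inter> X" "(mspace m - V) \<inter> X"] X
      by (simp add: Int_Un_distrib2[symmetric] Un_absorb1[OF VM] Int_absorb1)
    show "?H (V \<inter> X) + ?H ((mspace m - V) \<inter> X) \<le> ?H X"
    proof (cases "?H X = \<infinity>")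
      case False
      define E where "E k = {x \<in> V \<inter> X. \<forall>y\<in>mspace m - V. 1 / Suc k \<le> mdist m x y}" for k
      define D where "D k = E (Suc k) - E k" for k
      have E_mono: "E j \<subseteq> E k" if "j \<le> k" for j k
      proof -
        have "1 / real (Suc k) \<le> 1 / real (Suc j)" using that by (simp add: field_simps)
        then show ?thesis by (auto simp: E_def intro: order_trans)
      qed
      have ex_E: "\<exists>k. x \<in> E k" if x: "x \<in> V \<inter> X" for x
      proof -
        obtain r where r: "0 < r" "mball_of m x r \<subseteq> V"
          using assms x unfolding mtopology_of_def mball_of_def
          by (metis IntD1 Metric_space.openin_mtopology Metric_space_mspace_mdist)
        obtain k where k: "inverse (real (Suc k)) < r" using r(1) reals_Archimedean by blast
        have "1 / Suc k \<le> mdist m x y" if y: "y \<in> mspace m - V" for y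
        proof -
          have "r \<le> mdist m x y" using r(2) x y VM by (force simp: not_less[symmetric])
          then show ?thesis using k by (simp add: inverse_eq_divide)
        qed
        then show ?thesis using x by (auto simp: E_def)
      qed
      have sepD: "\<exists>\<epsilon>>0. \<forall>x\<in>D i. \<forall>y\<in>D j. \<epsilon> \<le> mdist m x y" if ij: "Suc i < j" for i j
      proof -
        define \<epsilon> where "\<epsilon> = 1 / real (i + 2) - 1 / real (Suc j)"
        have "\<epsilon> \<le> mdist m x y" if x: "x \<in> D i" and y: "y \<in> D j" for x y
        proof -
          have xX: "x \<in> mspace m" and yX: "y \<in> V \<inter> X"
            using x y VM by (auto simp: D_def E_def)
          obtain z where z: "z \<in> mspace m - V" "mdist m y z < 1 / Suc j"
            using y by (auto simp: D_def E_def not_le)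
          have "1 / real (i + 2) \<le> mdist m x z" using x z(1) by (auto simp: D_def E_def)
          also have "\<dots> \<le> mdist m x y + mdist m y z"
            using xX yX z VM by (intro mdist_triangle) auto
          finally show ?thesis using z(2) by (simp add: \<epsilon>_def)
        qed
        moreover have "0 < \<epsilon>"
          using ij by (auto simp: \<epsilon>_def intro!: divide_strict_left_mono)
        ultimately show ?thesis by blast
      qed
      have DX: "D k \<subseteq> X" for k by (auto simp: D_def E_def)
      have sum_le: "(\<Sum>i. ?H (D (2 * i + p))) \<le> ?H X" for p
      proof (rule suminf_le_const)
        show "(\<Sum>i<n. ?H (D (2 * i + p))) \<le> ?H X" for n
        proof -
          have "(\<Sum>i<n. ?H (D (2 * i + p))) \<le> ?H (\<Union>i<n. D (2 * i + p))"
            by (rule hausdorff2_separated_sum) (auto intro!: sepD)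
          also have "\<dots> \<le> ?H X" using DX by (intro hausdorff2_mono) auto
          finally show ?thesis .
        qed
      qed simp
      define T where "T p k = (\<Sum>i. ?H (D (2 * (i + k) + p)))" for p k
      have T0: "(\<lambda>k. T p k) \<longlonglongrightarrow> 0" for p
      proof -
        define b where "b i = enn2real (?H (D (2 * i + p)))" for i
        have fin: "(\<Sum>i. ?H (D (2 * i + p))) \<noteq> top"
          using sum_le[of p] False by (auto simp: top_unique)
        have "?H (D (2 * i + p)) < top" for i
          using hausdorff2_mono[OF DX, of m "2 * i + p"] False
          by (auto simp: less_top[symmetric] top_unique)
        then have b: "?H (D (2 * i + p)) = ennreal (b i)" for i
          by (simp add: b_def)
        have b0: "0 \<le> b i" for i by (simp add: b_def)
        have summ: "summable b"
          using fin b0 by (intro summable_suminf_not_top) (auto simp: b)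
        have "T p k = ennreal (\<Sum>i. b (i + k))" for k
          unfolding T_def b
          by (rule suminf_ennreal2) (use summ b0 in \<open>auto simp: summable_ignore_initial_segment\<close>)
        moreover have "(\<lambda>k. suminf b - (\<Sum>i<k. b i)) \<longlonglongrightarrow> suminf b - suminf b"
          by (intro tendsto_diff tendsto_const summable_LIMSEQ summ)
        ultimately show ?thesis
          using tendsto_ennrealI[of "\<lambda>k. \<Sum>i. b (i + k)" 0]
          by (simp add: suminf_minus_initial_segment[OF summ])
      qed
      have key: "?H (V \<inter> X) \<le> ?H (E (2 * k)) + (T 0 k + T 1 k)" for k
      proof -
        have "V \<inter> X \<subseteq> E (2 * k) \<union> ((\<Union>i. D (2 * (i + k))) \<union> (\<Union>i. D (2 * (i + k) + 1)))"
        proof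
          fix x assume "x \<in> V \<inter> X"
          then obtain l where l: "x \<in> E l" using ex_E by blast
          define q where "q = (LEAST l. x \<in> E l)"
          have q: "x \<in> E q" using l unfolding q_def by (rule LeastI)
          show "x \<in> E (2 * k) \<union> ((\<Union>i. D (2 * (i + k))) \<union> (\<Union>i. D (2 * (i + k) + 1)))"
          proof (cases "q \<le> 2 * k")
            case True then show ?thesis using E_mono q by blast
          next
            case False
            then obtain n where n: "q = Suc n" "2 * k \<le> n" by (cases q) auto
            have "x \<in> D n"
              using q n not_less_Least[of n "\<lambda>l. x \<in> E l"] by (auto simp: D_def q_def)
            moreover have "n = 2 * ((n div 2 - k) + k) \<or> n = 2 * ((n div 2 - k) + k) + 1"
              using n(2) by presburger
            ultimately have "x \<in> D (2 * ((n div 2 - k) + k)) \<or> x \<in> D (2 * ((n div 2 - k) + k) + 1)"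
              by metis
            then show ?thesis by blast
          qed
        qed
        then have "?H (V \<inter> X) \<le> ?H (E (2 * k) \<union> ((\<Union>i. D (2 * (i + k))) \<union> (\<Union>i. D (2 * (i + k) + 1))))"
          by (rule hausdorff2_mono)
        also have "\<dots> \<le> ?H (E (2 * k)) + (?H (\<Union>i. D (2 * (i + k))) + ?H (\<Union>i. D (2 * (i + k) + 1)))"
          by (intro order_trans[OF hausdorff2_subadd2] add_left_mono hausdorff2_subadd2)
        also have "\<dots> \<le> ?H (E (2 * k)) + (T 0 k + T 1 k)"
          using hausdorff2_subadd[of m "\<lambda>i. D (2 * (i + k))"]
            hausdorff2_subadd[of m "\<lambda>i. D (2 * (i + k) + 1)"]
          by (intro add_left_mono add_mono) (auto simp: T_def)
        finally show ?thesis .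
      qed
      have "?H (V \<inter> X) + ?H ((mspace m - V) \<inter> X) \<le> ?H X + (T 0 k + T 1 k)" for k
      proof -
        have "?H (E (2 * k)) + ?H ((mspace m - V) \<inter> X) \<le> ?H (E (2 * k) \<union> ((mspace m - V) \<inter> X))"
          by (rule hausdorff2_separated[of _ _ "1 / Suc (2 * k)"]) (auto simp: E_def)
        also have "\<dots> \<le> ?H X" by (rule hausdorff2_mono) (auto simp: E_def)
        finally have "?H (E (2 * k)) + ?H ((mspace m - V) \<inter> X) \<le> ?H X" .
        then have "?H (E (2 * k)) + ?H ((mspace m - V) \<inter> X) + (T 0 k + T 1 k) \<le> ?H X + (T 0 k + T 1 k)"
          by (rule add_right_mono)
        moreover have "?H (V \<inter> X) + ?H ((mspace m - V) \<inter> X)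
            \<le> ?H (E (2 * k)) + ?H ((mspace m - V) \<inter> X) + (T 0 k + T 1 k)"
          using add_right_mono[OF key[of k], of "?H ((mspace m - V) \<inter> X)"]
          by (simp only: ac_simps)
        ultimately show ?thesis by (rule order_trans[rotated])
      qed
      moreover have "(\<lambda>k. ?H X + (T 0 k + T 1 k)) \<longlonglongrightarrow> ?H X + (0 + 0)"
        by (intro tendsto_add tendsto_const T0)
      ultimately show ?thesis
        by (intro LIMSEQ_le_const[where X = "\<lambda>k. ?H X + (T 0 k + T 1 k)"]) auto
    qed simp
  qed
  then show ?thesis using VM by (auto simp: lambda_system_def)
qed

lemma measure_space_hausdorff2:
  "measure_space (mspace m) (sigma_sets (mspace m) {U. openin (mtopology_of m) U}) (hausdorff2 m)"
proof -
  interpret P: sigma_algebra "mspace m" "Pow (mspace m)" by (rule sigma_algebra_Pow)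
  let ?L = "lambda_system (mspace m) (Pow (mspace m)) (hausdorff2 m)"
  have "outer_measure_space (Pow (mspace m)) (hausdorff2 m)"
    unfolding outer_measure_space_def
    using hausdorff2_subadd
    by (auto simp: positive_def hausdorff2_empty increasing_def hausdorff2_mono
        countably_subadditive_def)
  then have L: "measure_space (mspace m) ?L (hausdorff2 m)"
    by (rule P.caratheodory_lemma)
  then interpret L: sigma_algebra "mspace m" ?L by (simp add: measure_space_def)
  have sub: "sigma_sets (mspace m) {U. openin (mtopology_of m) U} \<subseteq> ?L"
    by (rule L.sigma_sets_subset) (auto intro: hausdorff2_open_lambda_system)
  show ?thesis
    unfolding measure_space_def
  proof (intro conjI)
    show "sigma_algebra (mspace m) (sigma_sets (mspace m) {U. openin (mtopology_of m) U})"
      by (rule sigma_algebra_sigma_sets) (use openin_subset in fastforce)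
    show "positive (sigma_sets (mspace m) {U. openin (mtopology_of m) U}) (hausdorff2 m)"
      by (simp add: positive_def hausdorff2_empty)
    show "countably_additive (sigma_sets (mspace m) {U. openin (mtopology_of m) U}) (hausdorff2 m)"
      using L sub unfolding measure_space_def countably_additive_def by blast
  qed
qed

lemma open_subset_Pow: "{U. openin (mtopology_of m) U} \<subseteq> Pow (mspace m)"
  using openin_subset by fastforce

lemma space_hausdorff2_measure [simp]: "space (hausdorff2_measure m) = mspace m"
  unfolding hausdorff2_measure_def by (rule space_measure_of[OF open_subset_Pow])

lemma sets_hausdorff2_measure:
  "sets (hausdorff2_measure m) = sigma_sets (mspace m) {U. openin (mtopology_of m) U}"
  unfolding hausdorff2_measure_def by (rule sets_measure_of[OF open_subset_Pow])

lemma emeasure_hausdorff2_measure: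
  assumes "A \<in> sets (hausdorff2_measure m)"
  shows "emeasure (hausdorff2_measure m) A = hausdorff2 m A"
  using assms measure_space_hausdorff2[of m]
  by (intro emeasure_measure_of[OF hausdorff2_measure_def open_subset_Pow])
    (auto simp: measure_space_def sets_hausdorff2_measure)

end

theory Submission
  imports Defs
begin

text \<open>
  The bound on the dimension is a porosity argument; planarity is then obtained by building a
  planar snowflake that is bi-Lipschitz equivalent to \<open>\<partial>Y\<close>.

  \<^emph>\<open>Dimension.\<close> A quasisymmetric image of the circle has bounded turning: the image of an arc of at
  most half the circle has diameter at most a constant times the distance of its end points
  (\<open>quasicircle_loop\<close>). Let \<open>y \<in> \<partial>Y\<close>. The point \<open>y\<close> and the opposite point of the loop cut \<open>\<partial>Y\<close>
  into two arcs, and by bounded turning these can be close to each other only near \<open>y\<close> and near the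
  opposite point. A path as in condition (a), which joins the two arcs within an annulus around
  \<open>y\<close>, contains a point \<open>z\<close> at equal distance from both arcs, and this distance must therefore be
  comparable to \<open>d(y,z)\<close> (\<open>annulus_paths_imp_holes\<close>). By condition (b), a ball around \<open>z\<close> that
  stays away from \<open>\<partial>Y\<close> has area comparable to \<open>d(y,z)\<^sup>2\<close>: close to every boundary point there are,
  at every small scale, holes of definite area.

  Let \<open>S \<subseteq> \<partial>Y\<close> be \<open>\<epsilon>r\<close>-separated and contained in \<open>B(y,r)\<close>. At each of about \<open>log(1/\<epsilon>)\<close> scales
  between \<open>\<epsilon>r\<close> and \<open>r\<close>, the holes next to points of \<open>S\<close> have total area at least a constant times
  \<open>card S \<cdot> (\<epsilon>r)\<^sup>2\<close>. Holes of different scales are disjoint and all of them lie in \<open>B(y,3r)\<close>, so the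
  upper area bound gives \<open>card S \<le> C \<epsilon>\<^sup>-\<^sup>2 / log(1/\<epsilon>)\<close> (\<open>card_separated_scales\<close>). For some fixed
  \<open>\<epsilon>\<close> the right-hand side is less than \<open>\<epsilon>\<^sup>-\<^sup>2\<close>, hence equal to \<open>\<epsilon>\<^sup>-\<^sup>Q\<close> with \<open>Q < 2\<close>; since these numbers are
  submultiplicative in \<open>\<epsilon>\<close>, the exponent \<open>Q\<close> serves for all \<open>\<epsilon>\<close> (\<open>card_separated_bound\<close>).

  \<^emph>\<open>Planarity.\<close> Fix an integer \<open>m\<close>. For every level \<open>k\<close> the loop is divided into arcs of diameter
  comparable to \<open>m\<^sup>-\<^sup>k\<close>, and to each arc an edge of length \<open>m\<^sup>-\<^sup>k\<close> of the square lattice of that mesh is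
  assigned, so that the edges form a simple closed polygon. To pass to the next level, an arc is
  cut into \<open>N\<close> arcs, and its edge is replaced by a path of \<open>N\<close> edges of the finer lattice with the
  same end points. A greedy subdivision yields \<open>N \<ge> m\<close>, as is necessary; the bound on the
  dimension yields \<open>N \<le> c m\<^sup>Q\<close>. A path that runs straight ahead except for a comb of long teeth
  uses up to a constant times \<open>m\<^sup>2\<close> edges within a fixed thin diamond over the old edge, so for
  large \<open>m\<close> there is room for it (\<open>comb_subdivision\<close>, \<open>diamond_comb\<close>). The diamonds of one level
  meet only in common vertices, which keeps the polygons simple, and lattice edges without a common
  vertex have diamonds at distance at least half the mesh (\<open>diamond_meet\<close>, \<open>diamond_far\<close>). A point of
  the loop is sent to the intersection of the nested diamonds of its arcs. If \<open>k\<close> is the first level at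
  which two points lie in arcs that do not touch, then their distance is comparable to \<open>m\<^sup>-\<^sup>k\<close> both in
  \<open>\<partial>Y\<close>, by bounded turning, and in the plane (\<open>planar_embedding\<close>).
\<close>

section \<open>Quasicircles as loops of bounded turning\<close>

text \<open>
  The loop is parametrized by all of \<open>\<real>\<close> with period 1, so that every arc, including those
  across the base point, is the image of an interval.
\<close>

locale bounded_turning_loop =
  fixes Z :: "'b metric" and \<gamma> :: "real \<Rightarrow> 'b" and B :: real
  assumes in_space: "\<gamma> u \<in> mspace Z"
    and periodic: "\<gamma> (u + 1) = \<gamma> u"
    and continuous: "continuous_map euclideanreal (mtopology_of Z) \<gamma>"
    and injective: "inj_on \<gamma> {0..<1}"
    and B_ge_1: "1 \<le> B"
    and turning: "\<lbrakk>x \<le> u; u \<le> v; v \<le> y; y \<le> x + 1/2\<rbrakk>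
      \<Longrightarrow> mdist Z (\<gamma> u) (\<gamma> v) \<le> B * mdist Z (\<gamma> x) (\<gamma> y)"

definition circle_point :: "real \<Rightarrow> real^2" where
  "circle_point u = vector [cos (2 * pi * u), sin (2 * pi * u)]"

lemma norm_vector_2: "norm (vector [x, y] :: real^2) = sqrt (x\<^sup>2 + y\<^sup>2)"
  by (simp add: norm_vec_def L2_set_def sum_2 UNIV_2)

lemma dist_circle_point: "dist (circle_point u) (circle_point v) = 2 * \<bar>sin (pi * (v - u))\<bar>"
proof -
  have "circle_point u - circle_point v =
      vector [cos (2 * pi * u) - cos (2 * pi * v), sin (2 * pi * u) - sin (2 * pi * v)]"
    by (simp add: circle_point_def vec_eq_iff forall_2)
  then have "(dist (circle_point u) (circle_point v))\<^sup>2 =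
      (cos (2 * pi * u) - cos (2 * pi * v))\<^sup>2 + (sin (2 * pi * u) - sin (2 * pi * v))\<^sup>2"
    by (simp add: dist_norm norm_vector_2)
  also have "\<dots> = (sin (2 * pi * u) ^2 + cos (2 * pi * u)^2) + (sin (2 * pi * v)^2 + cos (2 * pi * v)^2)
      - 2 * (cos (2 * pi * u) * cos (2 * pi * v) + sin (2 * pi * u) * sin (2 * pi * v))"
    by (simp add: power2_eq_square algebra_simps)
  also have "\<dots> = 2 - 2 * cos (2 * (pi * (v - u)))"
    using cos_diff[of "2 * pi * v" "2 * pi * u"] by (simp add: algebra_simps)
  also have "\<dots> = (2 * \<bar>sin (pi * (v - u))\<bar>)\<^sup>2"
    by (simp add: cos_double_sin power_mult_distrib)
  finally show ?thesis
    by (rule power2_eq_imp_eq) auto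
qed

lemma circle_point_mono:
  assumes "x \<le> u" "u \<le> v" "v \<le> x + 1/2"
  shows "dist (circle_point x) (circle_point u) \<le> dist (circle_point x) (circle_point v)"
proof -
  have "pi * (u - x) \<le> pi * (v - x)" "pi * (v - x) \<le> pi * (1/2)"
    using assms by (intro mult_left_mono; simp)+
  then have "sin (pi * (u - x)) \<le> sin (pi * (v - x))"
    using assms by (intro sin_monotone_2pi_le) (auto simp: intro: order_trans[of _ 0])
  moreover have "0 \<le> sin (pi * (u - x))"
    using assms \<open>pi * (u - x) \<le> pi * (v - x)\<close> \<open>pi * (v - x) \<le> pi * (1/2)\<close>
    by (intro sin_ge_zero) (auto intro: order_trans)
  ultimately show ?thesis
    by (simp add: dist_circle_point)
qed

lemma circle_point_dist_less_2:
  assumes "x \<le> u" "u < x + 1/2"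
  shows "dist (circle_point x) (circle_point u) < 2"
proof -
  have "pi * (u - x) < pi * (1/2)" using assms by (intro mult_strict_left_mono) auto
  then have "sin (pi * (u - x)) < sin (pi/2)"
    using assms by (intro sin_monotone_2pi) (auto intro: order_trans[of _ 0] less_le_trans)
  moreover have "0 \<le> sin (pi * (u - x))"
    using assms \<open>pi * (u - x) < pi * (1/2)\<close>
    by (intro sin_ge_zero) (auto intro: order_trans)
  ultimately show ?thesis
    by (simp add: dist_circle_point)
qed

lemma circle_point_bij: "bij_betw circle_point {0..<1} (sphere 0 1)"
  unfolding bij_betw_def
proof
  show "inj_on circle_point {0..<1}"
  proof (rule inj_onI)
    fix u v :: real assume uv: "u \<in> {0..<1}" "v \<in> {0..<1}" "circle_point u = circle_point v"
    then have "sin (pi * (u - v)) = 0" using dist_circle_point[of v u] by simp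
    then obtain i :: int where "pi * (u - v) = of_int i * pi" unfolding sin_zero_iff_int2 by blast
    then have "u - v = of_int i" by simp
    moreover have "\<bar>u - v\<bar> < 1" using uv by auto
    ultimately show "u = v" by (simp flip: of_int_abs)
  qed
  show "circle_point ` {0..<1} = sphere 0 1"
  proof (intro equalityI subsetI)
    fix p assume "p \<in> circle_point ` {0..<1}"
    then show "p \<in> sphere 0 1" by (auto simp: circle_point_def norm_vector_2 add.commute)
  next
    fix p :: "real^2" assume "p \<in> sphere 0 1"
    then have "(p$1)\<^sup>2 + (p$2)\<^sup>2 = 1"
      by (simp add: norm_vec_def L2_set_def sum_2 UNIV_2)
    then obtain t where t: "0 \<le> t" "t < 2*pi" "p$1 = cos t" "p$2 = sin t"
      using sincos_total_2pi by metis
    then have "p = circle_point (t / (2*pi))"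
      by (simp add: circle_point_def vec_eq_iff forall_2)
    moreover have "t / (2*pi) \<in> {0..<1}" using t by (simp add: divide_simps)
    ultimately show "p \<in> circle_point ` {0..<1}" by blast
  qed
qed

text \<open>
  Let \<open>x \<le> u < y \<le> x + 1/2\<close>. On the circle \<open>y\<close> lies outside the open ball around \<open>x\<close> with the
  distance of \<open>x\<close> and \<open>u\<close> as radius, so quasisymmetry with both radii equal to this distance bounds the
  distance of the images of \<open>x\<close> and \<open>u\<close> by \<open>\<eta>(1)\<close> times that of the images of \<open>x\<close> and \<open>y\<close>. The points
  \<open>u\<close> and \<open>y\<close> are compared through \<open>x\<close>, whence the factor 2 in the constant.
\<close>

lemma quasicircle_loop:
  assumes qc: "quasicircle (submetric Z X)" and X: "X \<subseteq> mspace Z"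
  obtains \<gamma> B where "bounded_turning_loop Z \<gamma> B" "\<gamma> ` {0..<1} = X" "range \<gamma> = X"
proof -
  obtain g \<eta> where hg: "homeomorphic_map (mtopology_of unit_circle) (mtopology_of (submetric Z X)) g"
    and qs: "\<And>z r1 r2. \<lbrakk>z \<in> mspace unit_circle; 0 < r1; ennreal r1 < mdiam unit_circle (mspace unit_circle);
           0 < r2; ennreal r2 < mdiam unit_circle (mspace unit_circle)\<rbrakk> \<Longrightarrow>
           (SUP w\<in>mcball_of unit_circle z r1. ennreal (mdist (submetric Z X) (g z) (g w)))
             \<le> ennreal (\<eta> (r1 / r2)) *
               (INF w\<in>mspace unit_circle - mball_of unit_circle z r2. ennreal (mdist (submetric Z X) (g z) (g w)))"
    using qc unfolding quasicircle_def quasisymmetric_homeo_def by metis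
  have tops: "topspace (mtopology_of unit_circle) = sphere 0 1"
    "topspace (mtopology_of (submetric Z X)) = X"
    using X by (auto simp: unit_circle_def)
  have g_bij: "bij_betw g (sphere 0 1) X"
    using homeomorphic_imp_surjective_map[OF hg]
      homeomorphic_imp_injective_map[OF hg] tops by (simp add: bij_betw_def)
  have p_in: "circle_point u \<in> sphere 0 1" for u by (simp add: circle_point_def norm_vector_2)
  define \<gamma> where "\<gamma> = g \<circ> circle_point"
  have diam: "ennreal 2 \<le> mdiam unit_circle (mspace unit_circle)"
  proof -
    have "mdist unit_circle (circle_point 0) (circle_point (1/2)) = 2"
      by (simp add: unit_circle_def dist_circle_point)
    then show ?thesis
      using mdist_le_mdiam[of "circle_point 0" "mspace unit_circle" "circle_point (1/2)" unit_circle] p_in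
      by (simp add: unit_circle_def)
  qed
  define B where "B = 2 * max 1 (\<eta> 1)"
  have base: "mdist Z (\<gamma> x) (\<gamma> u) \<le> max 1 (\<eta> 1) * mdist Z (\<gamma> x) (\<gamma> y)"
    if h: "x \<le> u" "u \<le> y" "y \<le> x + 1/2" for x u y
  proof (cases "u = y \<or> circle_point x = circle_point u")
    case True
    have "1 * mdist Z (\<gamma> x) (\<gamma> y) \<le> max 1 (\<eta> 1) * mdist Z (\<gamma> x) (\<gamma> y)"
      by (intro mult_right_mono) auto
    moreover have "mdist Z (\<gamma> x) (\<gamma> x) = 0"
      using g_bij p_in X by (subst mdist_zero) (auto simp: \<gamma>_def bij_betw_def)
    moreover have "0 \<le> max 1 (\<eta> 1) * mdist Z (\<gamma> x) (\<gamma> y)" by simp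
    ultimately show ?thesis using True unfolding \<gamma>_def comp_def by (elim disjE) simp_all
  next
    case False
    define r where "r = dist (circle_point x) (circle_point u)"
    have r: "0 < r" "r < 2" using False h circle_point_dist_less_2 by (auto simp: r_def)
    then have r2: "ennreal r < mdiam unit_circle (mspace unit_circle)"
      by (intro less_le_trans[OF _ diam]) (simp add: ennreal_lessI)
    have "ennreal (mdist Z (\<gamma> x) (\<gamma> u)) \<le>
        (SUP w\<in>mcball_of unit_circle (circle_point x) r. ennreal (mdist (submetric Z X) (g (circle_point x)) (g w)))"
      using p_in by (intro SUP_upper2[of "circle_point u"]) (auto simp: \<gamma>_def unit_circle_def r_def)
    also have "\<dots> \<le> ennreal (\<eta> (r / r)) *
               (INF w\<in>mspace unit_circle - mball_of unit_circle (circle_point x) r. ennreal (mdist (submetric Z X) (g (circle_point x)) (g w)))"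
      using p_in r r2 by (intro qs) (auto simp: unit_circle_def)
    also have "\<dots> \<le> ennreal (\<eta> (r / r)) * ennreal (mdist Z (\<gamma> x) (\<gamma> y))"
      using p_in circle_point_mono[OF h]
      by (intro mult_left_mono INF_lower2[of "circle_point y"]) (auto simp: \<gamma>_def unit_circle_def r_def)
    also have "\<dots> \<le> ennreal (max 1 (\<eta> 1)) * ennreal (mdist Z (\<gamma> x) (\<gamma> y))"
      using r by (intro mult_right_mono ennreal_leI) auto
    also have "\<dots> = ennreal (max 1 (\<eta> 1) * mdist Z (\<gamma> x) (\<gamma> y))"
      by (rule ennreal_mult[symmetric]) auto
    finally show ?thesis by (subst (asm) ennreal_le_iff) auto
  qed
  have in_X: "\<gamma> u \<in> X" for u using g_bij p_in by (auto simp: \<gamma>_def bij_betw_def)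
  have bij: "bij_betw \<gamma> {0..<1} X"
    unfolding \<gamma>_def by (rule bij_betw_trans[OF circle_point_bij g_bij])
  have cont_p: "continuous_map euclideanreal (mtopology_of unit_circle) circle_point"
  proof -
    have "continuous_on UNIV circle_point"
      unfolding circle_point_def continuous_on_componentwise[where f = "\<lambda>u. vector [cos (2 * pi * u), sin (2 * pi * u)]"]
      by (auto simp: Basis_vec_def forall_2 UNIV_2 exhaust_2 inner_axis intro!: continuous_intros)
    then show ?thesis
      using p_in by (auto simp: unit_circle_def mtopology_of_submetric continuous_map_in_subtopology)
  qed
  have "continuous_map euclideanreal (mtopology_of (submetric Z X)) \<gamma>"
    unfolding \<gamma>_def by (rule continuous_map_compose[OF cont_p homeomorphic_imp_continuous_map[OF hg]])
  then have cont: "continuous_map euclideanreal (mtopology_of Z) \<gamma>"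
    by (simp add: mtopology_of_submetric continuous_map_in_subtopology)
  have "bounded_turning_loop Z \<gamma> B"
  proof
    show "\<gamma> u \<in> mspace Z" for u using in_X X by blast
    show "\<gamma> (u + 1) = \<gamma> u" for u
    proof -
      have "2 * pi * (u + 1) = 2 * pi * u + 2 * pi" by (simp add: algebra_simps)
      then show ?thesis by (simp only: \<gamma>_def circle_point_def comp_def cos_periodic sin_periodic)
    qed
    show "1 \<le> B" by (simp add: B_def)
    fix x u v y :: real assume h: "x \<le> u" "u \<le> v" "v \<le> y" "y \<le> x + 1/2"
    have "mdist Z (\<gamma> u) (\<gamma> v) \<le> mdist Z (\<gamma> x) (\<gamma> u) + mdist Z (\<gamma> x) (\<gamma> v)"
      using mdist_triangle[of "\<gamma> u" Z "\<gamma> x" "\<gamma> v"] in_X X by (auto simp: mdist_commute)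
    also have "\<dots> \<le> B * mdist Z (\<gamma> x) (\<gamma> y)"
      using base[of x u y] base[of x v y] h by (simp add: B_def)
    finally show "mdist Z (\<gamma> u) (\<gamma> v) \<le> B * mdist Z (\<gamma> x) (\<gamma> y)" .
  qed (use cont bij in \<open>auto simp: bij_betw_def\<close>)
  moreover have "\<gamma> ` {0..<1} = X" using bij by (simp add: bij_betw_def)
  ultimately show ?thesis using that in_X by blast
qed

section \<open>Holes close to the boundary\<close>

context
  fixes m :: "'b metric" and A :: "'b set"
  assumes A: "A \<noteq> {}" "A \<subseteq> mspace m"
begin

lemma mdist_set_le: "a \<in> A \<Longrightarrow> mdist_set m x A \<le> mdist m x a"
  unfolding mdist_set_def by (intro cINF_lower bdd_belowI2[where m = 0]) auto

lemma mdist_set_greatest: "(\<And>a. a \<in> A \<Longrightarrow> c \<le> mdist m x a) \<Longrightarrow> c \<le> mdist_set m x A"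
  unfolding mdist_set_def using A by (intro cINF_greatest)

lemma mdist_set_nonneg: "0 \<le> mdist_set m x A"
  by (rule mdist_set_greatest) simp

lemma mdist_set_near: "mdist_set m x A < c \<Longrightarrow> \<exists>a\<in>A. mdist m x a < c"
  using mdist_set_greatest[of c x] by force

lemma mdist_set_triangle:
  assumes "x \<in> mspace m" "y \<in> mspace m"
  shows "mdist_set m x A \<le> mdist m x y + mdist_set m y A"
proof -
  have "mdist_set m x A - mdist m x y \<le> mdist_set m y A"
  proof (rule mdist_set_greatest)
    fix a assume "a \<in> A"
    then show "mdist_set m x A - mdist m x y \<le> mdist m y a"
      using mdist_set_le[of a x] mdist_triangle[of x m y a] assms A by fastforce
  qed
  then show ?thesis by simp
qed

lemma continuous_map_mdist_set: "continuous_map (mtopology_of m) euclideanreal (\<lambda>x. mdist_set m x A)"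
proof -
  have "\<bar>mdist_set m x A - mdist_set m y A\<bar> \<le> 1 * mdist m x y" if "x \<in> mspace m" "y \<in> mspace m" for x y
    using mdist_set_triangle[OF that] mdist_set_triangle[OF that(2,1)] mdist_commute[of m x y] by simp
  then have "Lipschitz_continuous_map m euclidean_metric (\<lambda>x. mdist_set m x A)"
    unfolding Lipschitz_continuous_map_def by (intro conjI exI[of _ 1]) (auto simp: dist_real_def)
  then show ?thesis using Lipschitz_continuous_imp_continuous_map by fastforce
qed

end

context bounded_turning_loop
begin

abbreviation D :: "real \<Rightarrow> real \<Rightarrow> real" where "D u v \<equiv> mdist Z (\<gamma> u) (\<gamma> v)"

lemma D_triangle: "D u w \<le> D u v + D v w"
  by (intro mdist_triangle in_space)

lemma D_self [simp]: "D u u = 0"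
  using in_space by simp

lemma B_pos: "0 < B"
  using B_ge_1 by simp

lemma periodic_int: "\<gamma> (u + of_int n) = \<gamma> u"
proof (induction n rule: int_induct[where k = 0])
  case (step1 i)
  then show ?case using periodic[of "u + of_int i"] by (simp add: algebra_simps)
next
  case (step2 i)
  then show ?case using periodic[of "u + of_int (i - 1)"] by (simp add: algebra_simps)
qed simp

lemma window:
  obtains w where "\<gamma> w = \<gamma> v" "a \<le> w" "w < a + 1"
proof
  let ?w = "v + of_int (- \<lfloor>v - a\<rfloor>)"
  show "\<gamma> ?w = \<gamma> v" by (rule periodic_int)
  show "a \<le> ?w" "?w < a + 1" by (simp; linarith)+
qed

lemma continuous_on_D [continuous_intros]:
  assumes "continuous_on S f" "continuous_on S g"
  shows "continuous_on S (\<lambda>t. D (f t) (g t))"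
proof -
  have "continuous_map (top_of_set S) (mtopology_of Z) (\<lambda>t. \<gamma> (h t))" if "continuous_on S h" for h
    using continuous_map_compose[OF _ continuous, of "top_of_set S" h] that by (simp add: comp_def)
  then show ?thesis
    using continuous_map_mdist[of "top_of_set S" Z "\<lambda>t. \<gamma> (f t)" "\<lambda>t. \<gamma> (g t)"] assms by simp
qed

text \<open>
  Every point of the loop lies on one of the two half turns that start at \<open>u\<close>, hence within \<open>B\<close>
  times the length of the chord of a half turn at \<open>u\<close>. So this chord is not much shorter than the one
  at 0.
\<close>

lemma half_turn_far:
  obtains q where "0 < q" "\<And>u. q \<le> D u (u + 1/2)"
proof
  define q where "q = D 0 (1/2) / (2 * B)"
  have "\<gamma> 0 \<noteq> \<gamma> (1/2)" using inj_onD[OF injective, of 0 "1/2"] by auto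
  then have "D 0 (1/2) > 0" using in_space by (simp add: order_less_le)
  then show "0 < q" using B_pos by (simp add: q_def)
  fix u
  have near: "D u w \<le> B * D u (u + 1/2)" for w
  proof -
    obtain w' where w': "\<gamma> w' = \<gamma> w" "u - 1/2 \<le> w'" "w' < u - 1/2 + 1" by (rule window)
    have *: "D (u - 1/2) u = D u (u + 1/2)"
      using periodic[of "u - 1/2"] by (simp add: mdist_commute add.commute)
    show ?thesis
    proof (cases "w' \<le> u")
      case True
      then show ?thesis using turning[of "u - 1/2" w' u u] w' * by (simp add: mdist_commute)
    next
      case False
      then show ?thesis using turning[of u u w' "u + 1/2"] w' by simp
    qed
  qed
  show "q \<le> D u (u + 1/2)"
    using D_triangle[of 0 "1/2" u] near[of 0] near[of "1/2"] B_pos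
    by (simp add: q_def divide_simps mdist_commute mult.commute)
qed

lemma point_at_distance:
  assumes \<rho>: "0 < \<rho>" "\<rho> < D u (u + s)"
  obtains w where "w \<in> closed_segment u (u + s)" "D u w = \<rho>"
proof -
  have "continuous_on {0..1} (\<lambda>t. D u (u + t * s))" by (intro continuous_intros)
  then obtain t where t: "0 \<le> t" "t \<le> 1" "D u (u + t * s) = \<rho>"
    using IVT'[of "\<lambda>t. D u (u + t * s)" 0 \<rho> 1] \<rho> by auto
  have "u + t * s \<in> closed_segment u (u + s)"
    unfolding closed_segment_def using t by (auto intro!: exI[of _ t] simp: algebra_simps)
  then show ?thesis using that t by blast
qed

text \<open>
  The half turns after and before \<open>u\<close> form two arcs \<open>L\<close> and \<open>L'\<close> that meet only in \<open>\<gamma> u\<close> and in the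
  opposite point. On a path from \<open>L\<close> to \<open>L'\<close> in an annulus around \<open>\<gamma> u\<close>, some point \<open>z\<close> has the same
  distance \<open>\<delta>\<close> from \<open>L\<close> and from \<open>L'\<close>. If \<open>\<delta>\<close> were small, points of \<open>L\<close> and \<open>L'\<close> near \<open>z\<close> would be close to
  each other, while each arc between them contains \<open>\<gamma> u\<close> or the opposite point and thus has a
  definite size; bounded turning excludes this.
\<close>

lemma annulus_paths_imp_holes:
  fixes r0 lam :: real
  assumes r0: "0 < r0" and lam: "1 < lam"
    and paths: "\<And>y r R a b. y \<in> range \<gamma> \<Longrightarrow> 0 < 2 * r \<Longrightarrow> 2 * r < R \<Longrightarrow> R < r0 \<Longrightarrow>
           a \<in> mcball_of Z y R - mball_of Z y r \<Longrightarrow>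
           b \<in> mcball_of Z y R - mball_of Z y r \<Longrightarrow>
           \<exists>\<sigma>. pathin (mtopology_of Z) \<sigma> \<and>
               \<sigma> ` {0..1} \<subseteq> mcball_of Z y (lam * R) - mball_of Z y (inverse lam * r) \<and>
               a \<in> \<sigma> ` {0..1} \<and> b \<in> \<sigma> ` {0..1}"
  obtains \<kappa> R where "0 < \<kappa>" "\<kappa> \<le> 1" "0 < R"
    "\<And>y r. y \<in> range \<gamma> \<Longrightarrow> 0 < r \<Longrightarrow> r < R \<Longrightarrow>
      \<exists>z\<in>mspace Z. mdist Z y z \<le> r \<and> \<kappa> * r \<le> mdist_set Z z (range \<gamma>)"
proof -
  obtain q where q: "0 < q" "\<And>u. q \<le> D u (u + 1/2)" using half_turn_far by blast
  define \<kappa> where "\<kappa> = 1 / (3 * lam\<^sup>2 * (2 * B + 1))"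
  define R where "R = min (q / 2) r0"
  have den: "1 < 3 * lam\<^sup>2 * (2 * B + 1)"
  proof -
    have "1 * 1 < (3 * lam\<^sup>2) * (2 * B + 1)"
      using lam B_ge_1 by (intro mult_strict_mono) (auto simp: one_less_power intro: less_trans[of 1 "lam^2"])
    then show ?thesis by simp
  qed
  show ?thesis
  proof (rule that)
    show "0 < \<kappa>" "\<kappa> \<le> 1" using den by (auto simp: \<kappa>_def)
    show "0 < R" using q r0 by (simp add: R_def)
    fix y \<rho>0 assume y: "y \<in> range \<gamma>" and \<rho>0: "0 < \<rho>0" "\<rho>0 < R"
    obtain u where u: "y = \<gamma> u" using y by blast
    define \<rho> where "\<rho> = \<rho>0 / lam"
    have \<rho>: "0 < \<rho>" "\<rho> < \<rho>0" "lam * \<rho> = \<rho>0" using \<rho>0 lam by (auto simp: \<rho>_def field_simps)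
    have \<rho>q: "\<rho> < q" using \<rho> \<rho>0 q by (simp add: R_def)
    have half: "D u (u + (-1/2)) = D u (u + 1/2)" using periodic[of "u - 1/2"] by (simp add: add.commute)
    obtain a where a: "a \<in> closed_segment u (u + 1/2)" "D u a = \<rho>"
      using point_at_distance[OF \<rho>(1) less_le_trans[OF \<rho>q q(2)[of u]]] by blast
    obtain b where b: "b \<in> closed_segment u (u + (-1/2))" "D u b = \<rho>"
      using point_at_distance[OF \<rho>(1) less_le_trans[OF \<rho>q q(2)[of u, folded half]]] by blast
    define L where "L = \<gamma> ` {u..u + 1/2}"
    define L' where "L' = \<gamma> ` {u - 1/2..u}"
    have LL: "L \<noteq> {}" "L \<subseteq> mspace Z" "L' \<noteq> {}" "L' \<subseteq> mspace Z" using in_space by (auto simp: L_def L'_def)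
    have aL: "\<gamma> a \<in> L" and bL: "\<gamma> b \<in> L'"
      using a b by (auto simp: L_def L'_def closed_segment_eq_real_ivl split: if_splits)
    have ab: "\<gamma> a \<in> mcball_of Z y \<rho> - mball_of Z y (\<rho> / 3)" "\<gamma> b \<in> mcball_of Z y \<rho> - mball_of Z y (\<rho> / 3)"
      using \<rho> a(2) b(2) in_space by (simp_all add: u)
    have "\<rho> < r0" using \<rho> \<rho>0 by (simp add: R_def)
    then obtain \<sigma> where path: "pathin (mtopology_of Z) \<sigma>"
      and img: "\<sigma> ` {0..1} \<subseteq> mcball_of Z y (lam * \<rho>) - mball_of Z y (inverse lam * (\<rho> / 3))"
      and ends: "\<gamma> a \<in> \<sigma> ` {0..1}" "\<gamma> b \<in> \<sigma> ` {0..1}"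
      using paths[OF y _ _ _ ab] \<rho>(1) by auto
    have \<sigma>1: "continuous_map (top_of_set {0..1}) (mtopology_of Z) \<sigma>" using path by (simp add: pathin_def)
    have \<sigma>2: "\<sigma> t \<in> mspace Z \<and> mdist Z y (\<sigma> t) \<le> \<rho>0 \<and> \<rho> / (3 * lam) \<le> mdist Z y (\<sigma> t)" if "t \<in> {0..1}" for t
    proof -
      have "\<sigma> t \<in> mcball_of Z y (lam * \<rho>) - mball_of Z y (inverse lam * (\<rho> / 3))" using img that by blast
      moreover have "inverse lam * (\<rho> / 3) = \<rho> / (3 * lam)" using lam by (simp add: divide_simps)
      ultimately show ?thesis using \<rho>(3) by auto
    qed
    note \<sigma> = \<sigma>1 \<sigma>2 ends
    \<comment> \<open>Negative or zero on \<open>L\<close>, positive or zero on \<open>L'\<close>: a zero of \<open>f\<close> is a point equidistant from both.\<close>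
    define f where "f t = mdist_set Z (\<sigma> t) L - mdist_set Z (\<sigma> t) L'" for t
    have cont: "continuous_on {0..1} f"
    proof -
      have "continuous_on {0..1} (\<lambda>t. mdist_set Z (\<sigma> t) A)" if "A \<noteq> {}" "A \<subseteq> mspace Z" for A
        using continuous_map_compose[OF \<sigma>1 continuous_map_mdist_set[OF that]] by (simp add: comp_def)
      then show ?thesis unfolding f_def using LL by (intro continuous_on_diff)
    qed
    obtain ta where ta: "ta \<in> {0..1}" "\<sigma> ta = \<gamma> a" using ends(1) by (metis imageE)
    obtain tb where tb: "tb \<in> {0..1}" "\<sigma> tb = \<gamma> b" using ends(2) by (metis imageE)
    note t = ta(1) tb(1) ta(2) tb(2)
    have "f ta \<le> 0" "0 \<le> f tb"
      using mdist_set_le[OF LL(1,2) aL, of "\<gamma> a"] mdist_set_le[OF LL(3,4) bL, of "\<gamma> b"]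
        mdist_set_nonneg[OF LL(1,2), of "\<gamma> b"] mdist_set_nonneg[OF LL(3,4), of "\<gamma> a"] t by (auto simp: f_def)
    moreover have "connected (f ` {0..1})" by (intro connected_continuous_image cont) simp
    ultimately have "0 \<in> f ` {0..1}"
      using t(1,2) by (intro connectedD_interval[of "f ` {0..1}" "f ta" "f tb" 0] imageI)
    then obtain t0 where t0: "t0 \<in> {0..1}" "f t0 = 0" by (metis imageE)
    define z where "z = \<sigma> t0"
    define \<delta> where "\<delta> = mdist_set Z z L"
    have \<delta>': "\<delta> = mdist_set Z z L'" using t0 by (simp add: \<delta>_def z_def f_def)
    have z: "z \<in> mspace Z" "mdist Z y z \<le> \<rho>0" "\<rho> / (3 * lam) \<le> mdist Z y z" using \<sigma>(2)[OF t0(1)] by (auto simp: z_def)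
    \<comment> \<open>Points \<open>\<gamma> v \<in> L\<close> and \<open>\<gamma> w \<in> L'\<close> near \<open>z\<close> are joined by an arc of at most half the loop, through
        \<open>\<gamma> u\<close> if \<open>v - w \<le> 1/2\<close>, and through the opposite point otherwise.\<close>
    have key: "\<rho> / (3 * lam) / (2 * B + 1) \<le> e" if e: "\<delta> < e" for e
    proof -
      obtain v where v: "u \<le> v" "v \<le> u + 1/2" "mdist Z z (\<gamma> v) < e"
        using mdist_set_near[OF LL(1,2) e[unfolded \<delta>_def]] unfolding L_def by auto
      obtain w where w: "u - 1/2 \<le> w" "w \<le> u" "mdist Z z (\<gamma> w) < e"
        using mdist_set_near[OF LL(3,4) e[unfolded \<delta>']] unfolding L'_def by auto
      have "D v w \<le> mdist Z z (\<gamma> v) + mdist Z z (\<gamma> w)"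
        using mdist_triangle[of "\<gamma> v" Z z "\<gamma> w"] z in_space by (simp add: mdist_commute)
      then have Dvw: "B * D v w \<le> B * (2 * e)" using v w B_pos by (intro mult_left_mono) auto
      have yv: "mdist Z y z \<le> D u v + e" "D u v \<le> mdist Z y z + e"
        using mdist_triangle[of y Z "\<gamma> v" z] mdist_triangle[of y Z z "\<gamma> v"] z in_space v
        by (auto simp: u mdist_commute)
      have "\<rho> / (3 * lam) \<le> (2 * B + 1) * e"
      proof (cases "v - w \<le> 1/2")
        case True
        then have "D u v \<le> B * D v w" using turning[of w u v v] v w by (simp add: mdist_commute)
        then show ?thesis using Dvw yv z by (simp add: algebra_simps)
      next
        case False
        then have "D v (u + 1/2) \<le> B * D v (w + 1)" using turning[of v v "u + 1/2" "w + 1"] v w by simp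
        moreover have "q \<le> D u v + D v (u + 1/2)" using q(2)[of u] D_triangle[of u "u + 1/2" v] by simp
        ultimately have "q - \<rho>0 \<le> (2 * B + 1) * e" using Dvw yv z unfolding periodic by (simp add: algebra_simps)
        moreover have "\<rho> / (3 * lam) \<le> \<rho>" using \<rho> lam by (simp add: field_simps)
        ultimately show ?thesis using \<rho>0 \<rho> by (simp add: R_def)
      qed
      then show ?thesis using B_ge_1 by (subst pos_divide_le_eq) (simp_all add: mult.commute)
    qed
    have "\<kappa> * \<rho>0 = \<rho> / (3 * lam) / (2 * B + 1)" using lam by (simp add: \<kappa>_def \<rho>_def power2_eq_square)
    then have \<delta>_ge: "\<kappa> * \<rho>0 \<le> \<delta>" using key by (metis dense not_less order_less_le_trans)
    have "\<kappa> * \<rho>0 \<le> mdist_set Z z (range \<gamma>)"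
    proof (rule mdist_set_greatest)
      fix x assume "x \<in> range \<gamma>"
      then obtain v where v: "x = \<gamma> v" "u - 1/2 \<le> v" "v < u - 1/2 + 1" using window by (metis imageE)
      then have "x \<in> L \<or> x \<in> L'" by (force simp: L_def L'_def)
      then have "\<delta> \<le> mdist Z z x"
        using mdist_set_le[OF LL(1,2)] mdist_set_le[OF LL(3,4)] unfolding \<delta>_def[symmetric] \<delta>'[symmetric] by (metis \<delta>' \<delta>_def)
      then show "\<kappa> * \<rho>0 \<le> mdist Z z x" using \<delta>_ge by simp
    qed (use in_space in auto)
    then show "\<exists>z\<in>mspace Z. mdist Z y z \<le> \<rho>0 \<and> \<kappa> * \<rho>0 \<le> mdist_set Z z (range \<gamma>)" using z by blast
  qed
qed

end

section \<open>Counting separated points of a porous set\<close>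

lemma mcball_measurable: "mcball_of m x r \<in> sets (hausdorff2_measure m)"
proof -
  have "closedin (mtopology_of m) (mcball_of m x r)"
    unfolding mtopology_of_def mcball_of_def
    by (rule Metric_space.closedin_mcball[OF Metric_space_mspace_mdist])
  then have "openin (mtopology_of m) (mspace m - mcball_of m x r)"
    by (metis openin_diff openin_topspace topspace_mtopology_of)
  moreover have "mcball_of m x r = space (hausdorff2_measure m) - (mspace m - mcball_of m x r)" by auto
  ultimately show ?thesis
    by (metis sets.compl_sets sets_hausdorff2_measure mem_Collect_eq sigma_sets.Basic)
qed

text \<open>
  Radii and lower bounds depend on the index because balls of several scales are packed
  simultaneously.
\<close>

lemma mcball_packing:
  assumes I: "finite I" and disj: "disjoint_family_on (\<lambda>i. mcball_of m (c i) (\<rho> i)) I"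
    and lower: "\<And>i. i \<in> I \<Longrightarrow> 0 \<le> a i \<and> ennreal (a i) \<le> hausdorff2 m (mcball_of m (c i) (\<rho> i))"
    and sub: "\<And>i. i \<in> I \<Longrightarrow> mcball_of m (c i) (\<rho> i) \<subseteq> T"
    and upper: "hausdorff2 m T \<le> ennreal b" "0 \<le> b"
  shows "(\<Sum>i\<in>I. a i) \<le> b"
proof -
  let ?F = "\<lambda>i. mcball_of m (c i) (\<rho> i)"
  have "ennreal (\<Sum>i\<in>I. a i) = (\<Sum>i\<in>I. ennreal (a i))"
    using lower by (intro sum_ennreal[symmetric]) auto
  also have "\<dots> \<le> (\<Sum>i\<in>I. emeasure (hausdorff2_measure m) (?F i))"
    using lower by (intro sum_mono) (auto simp: emeasure_hausdorff2_measure mcball_measurable)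
  also have "\<dots> = emeasure (hausdorff2_measure m) (\<Union>i\<in>I. ?F i)"
    by (rule sum_emeasure) (use I disj mcball_measurable in auto)
  also have "\<dots> = hausdorff2 m (\<Union>i\<in>I. ?F i)"
    by (intro emeasure_hausdorff2_measure sets.finite_UN I mcball_measurable)
  also have "\<dots> \<le> hausdorff2 m T" using sub by (intro hausdorff2_mono) auto
  also have "\<dots> \<le> ennreal b" by (rule upper)
  finally show ?thesis using upper by simp
qed

lemma maximal_separated_subset:
  assumes "finite S" "S \<subseteq> mspace m" "0 < s"
  shows "\<exists>T\<subseteq>S. separated_set m s T \<and> (\<forall>x\<in>S. \<exists>y\<in>T. mdist m y x < s)"
  using assms(1,2)
proof (induction rule: finite_induct)
  case empty
  then show ?case by (auto simp: separated_set_def)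
next
  case (insert x S)
  then obtain T where T: "T \<subseteq> S" "separated_set m s T" "\<forall>x\<in>S. \<exists>y\<in>T. mdist m y x < s" by auto
  show ?case
  proof (cases "\<exists>y\<in>T. mdist m y x < s")
    case True
    then show ?thesis using T by (intro exI[of _ T]) auto
  next
    case False
    moreover have "mdist m x x = 0" using insert.prems by (subst mdist_zero) auto
    then have "mdist m x x < s" using \<open>0 < s\<close> by simp
    ultimately show ?thesis
      using T by (intro exI[of _ "insert x T"]) (auto simp: separated_set_def not_less mdist_commute)
  qed
qed

lemma separated_setD: "\<lbrakk>separated_set m s S; x \<in> S; y \<in> S; x \<noteq> y\<rbrakk> \<Longrightarrow> s \<le> mdist m x y"
  by (auto simp: separated_set_def)

lemma separated_set_subset: "\<lbrakk>separated_set m s S; T \<subseteq> S; t \<le> s\<rbrakk> \<Longrightarrow> separated_set m t T"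
  by (force simp: separated_set_def)

lemma card_le_sum_cover:
  assumes "finite T" "finite S" "\<And>x. x \<in> S \<Longrightarrow> \<exists>y\<in>T. x \<in> N y"
    and "\<And>y. y \<in> T \<Longrightarrow> real (card (S \<inter> N y)) \<le> M"
  shows "real (card S) \<le> real (card T) * M"
proof -
  have "card S \<le> card (\<Union>y\<in>T. S \<inter> N y)" using assms(1-3) by (intro card_mono) auto
  also have "\<dots> \<le> (\<Sum>y\<in>T. card (S \<inter> N y))" by (rule card_UN_le[OF assms(1)])
  finally have "real (card S) \<le> (\<Sum>y\<in>T. real (card (S \<inter> N y)))" by (simp flip: of_nat_sum)
  also have "\<dots> \<le> (\<Sum>y\<in>T. M)" by (intro sum_mono assms(4))
  finally show ?thesis by simp
qed

text \<open>
  The hole at scale \<open>r\<close> next to \<open>y\<close> is the ball of radius \<open>\<kappa> r / 2\<close> around a point that is \<open>\<kappa> r\<close> away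
  from \<open>X\<close>. With this radius the whole hole still has distance \<open>\<kappa> r / 2\<close> from \<open>X\<close>, which separates it
  from the holes of much smaller scales.
\<close>

locale porous_set =
  fixes Z :: "'b metric" and X :: "'b set" and \<kappa> R CU cl :: real
  assumes X: "X \<subseteq> mspace Z"
    and \<kappa>: "0 < \<kappa>" "\<kappa> \<le> 1"
    and const_pos: "0 < CU" "0 < cl"
    and upper: "\<lbrakk>y \<in> X; 0 < r; r < R\<rbrakk> \<Longrightarrow> hausdorff2 Z (mcball_of Z y r) \<le> ennreal (CU * r\<^sup>2)"
    and hole: "\<lbrakk>y \<in> X; 0 < r; r < R\<rbrakk> \<Longrightarrow> \<exists>z\<in>mspace Z. mdist Z y z \<le> r \<and>
        (\<forall>x\<in>X. \<kappa> * r \<le> mdist Z z x) \<and>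
        ennreal (cl * r\<^sup>2) \<le> hausdorff2 Z (mcball_of Z z (\<kappa> * r / 2))"
begin

definition hole_center :: "real \<Rightarrow> 'b \<Rightarrow> 'b" where
  "hole_center r y = (SOME z. z \<in> mspace Z \<and> mdist Z y z \<le> r \<and> (\<forall>x\<in>X. \<kappa> * r \<le> mdist Z z x) \<and>
        ennreal (cl * r\<^sup>2) \<le> hausdorff2 Z (mcball_of Z z (\<kappa> * r / 2)))"

abbreviation hole_ball :: "real \<Rightarrow> 'b \<Rightarrow> 'b set" where
  "hole_ball r y \<equiv> mcball_of Z (hole_center r y) (\<kappa> * r / 2)"

lemma hole_center:
  assumes "y \<in> X" "0 < r" "r < R"
  shows "hole_center r y \<in> mspace Z" "mdist Z y (hole_center r y) \<le> r"
    "x \<in> X \<Longrightarrow> \<kappa> * r \<le> mdist Z (hole_center r y) x"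
    "ennreal (cl * r\<^sup>2) \<le> hausdorff2 Z (hole_ball r y)"
  using someI_ex[of "\<lambda>z. z \<in> mspace Z \<and> mdist Z y z \<le> r \<and> (\<forall>x\<in>X. \<kappa> * r \<le> mdist Z z x) \<and>
        ennreal (cl * r\<^sup>2) \<le> hausdorff2 Z (mcball_of Z z (\<kappa> * r / 2))"] hole[OF assms]
  unfolding hole_center_def by blast+

lemma hole_ball_near:
  assumes "y \<in> X" "0 < r" "r < R" "w \<in> hole_ball r y"
  shows "w \<in> mspace Z" "mdist Z y w \<le> 3/2 * r"
proof -
  show w: "w \<in> mspace Z" using assms(4) by simp
  have "\<kappa> * r \<le> 1 * r" using assms \<kappa> by (intro mult_right_mono) auto
  then show "mdist Z y w \<le> 3/2 * r"
    using mdist_triangle[of y Z "hole_center r y" w] hole_center[OF assms(1-3)] assms(1,4) X w by auto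
qed

lemma hole_ball_far:
  assumes "y \<in> X" "0 < r" "r < R" "w \<in> hole_ball r y" "x \<in> X"
  shows "\<kappa> * r / 2 \<le> mdist Z x w"
  using mdist_triangle[of "hole_center r y" Z w x] hole_center[OF assms(1-3)] assms(4,5) X
  by (force simp: mdist_commute)

text \<open>
  The holes of scale \<open>s / 4\<close> next to the points of \<open>S\<close> are disjoint subsets of the ball of radius
  \<open>5 \<rho>\<close>; compare areas.
\<close>

lemma card_separated_near:
  assumes S: "finite S" "S \<subseteq> X" "separated_set Z s S" and s: "0 < s" "s \<le> \<rho>" "5 * \<rho> < R"
    and y: "y \<in> X" and near: "\<And>x. x \<in> S \<Longrightarrow> mdist Z y x < 4 * \<rho>"
  shows "real (card S) * (cl * s\<^sup>2) \<le> 400 * CU * \<rho>\<^sup>2"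
proof -
  have s4: "0 < s / 4" "s / 4 < R" using s by auto
  have "(\<Sum>x\<in>S. cl * (s / 4)\<^sup>2) \<le> CU * (5 * \<rho>)\<^sup>2"
  proof (rule mcball_packing[where c = "hole_center (s / 4)" and \<rho> = "\<lambda>_. \<kappa> * (s / 4) / 2" and T = "mcball_of Z y (5 * \<rho>)"])
    show "disjoint_family_on (hole_ball (s / 4)) S"
      unfolding disjoint_family_on_def
    proof (intro ballI impI equals0I)
      fix x x' w assume h: "x \<in> S" "x' \<in> S" "x \<noteq> x'" "w \<in> hole_ball (s / 4) x \<inter> hole_ball (s / 4) x'"
      have "s \<le> mdist Z x x'" using separated_setD[OF S(3)] h by blast
      also have "\<dots> \<le> mdist Z x w + mdist Z x' w"
        using mdist_triangle[of x Z w x'] h S X by (auto simp: mdist_commute)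
      also have "\<dots> \<le> 3/2 * (s/4) + 3/2 * (s/4)"
        using h S s4 by (intro add_mono hole_ball_near) auto
      finally show False using s by simp
    qed
    show "hole_ball (s / 4) x \<subseteq> mcball_of Z y (5 * \<rho>)" if "x \<in> S" for x
    proof
      fix w assume w: "w \<in> hole_ball (s / 4) x"
      then have "mdist Z y w \<le> 4 * \<rho> + 3/2 * (s / 4)"
        using hole_ball_near[of x "s/4" w] near[OF that] mdist_triangle[of y Z x w] y that S X s4 by fastforce
      then show "w \<in> mcball_of Z y (5 * \<rho>)" using w y X s by auto
    qed
    show "hausdorff2 Z (mcball_of Z y (5 * \<rho>)) \<le> ennreal (CU * (5 * \<rho>)\<^sup>2)"
      using upper[OF y, of "5 * \<rho>"] s by auto
    show "0 \<le> cl * (s / 4)\<^sup>2 \<and> ennreal (cl * (s / 4)\<^sup>2) \<le> hausdorff2 Z (hole_ball (s / 4) x)" if "x \<in> S" for x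
      using hole_center(4)[of x "s/4"] that S s4 const_pos by auto
  qed (use S const_pos in auto)
  then show ?thesis by (simp add: power2_eq_square)
qed

text \<open>
  At scale \<open>\<rho> k\<close> take a maximal \<open>4 \<rho> k\<close>-separated \<open>T k \<subseteq> S\<close>. By the previous lemma every point of \<open>T k\<close>
  stands for at most a constant times \<open>(\<rho> k / \<rho> K)\<^sup>2\<close> points of \<open>S\<close>. So the holes of scale \<open>\<rho> k\<close> next
  to \<open>T k\<close> have total area at least a constant times \<open>card S \<cdot> (\<rho> K)\<^sup>2\<close>, independently of \<open>k\<close>, and
  there are \<open>K\<close> scales. The holes of all scales are disjoint: the points of a hole of scale \<open>\<rho> k\<close> have
  distance at least \<open>\<kappa> \<rho> k / 2\<close> from \<open>X\<close>, whereas those of a hole of scale at most \<open>\<theta> \<rho> k\<close> are within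
  \<open>3/2 \<cdot> \<theta> \<rho> k\<close> of \<open>X\<close>, and the latter is smaller for \<open>\<theta> = \<kappa> / 4\<close>.
\<close>

lemma card_separated_scales:
  fixes K :: nat
  defines "\<theta> \<equiv> \<kappa> / 4"
  assumes S: "finite S" "S \<subseteq> X" "separated_set Z (\<theta> ^ K * r) S" and r: "0 < r" "5 * r < R"
    and y: "y \<in> X" and near: "\<And>x. x \<in> S \<Longrightarrow> mdist Z y x < r"
  shows "real (card S) * (\<theta> ^ K)\<^sup>2 * real K \<le> 3600 * CU\<^sup>2 / cl\<^sup>2"
proof -
  define \<rho> where "\<rho> k = \<theta> ^ k * r" for k
  have \<theta>: "0 < \<theta>" "\<theta> < 1" using \<kappa> by (auto simp: \<theta>_def)
  have \<rho>_pos: "0 < \<rho> k" for k using \<theta> r by (simp add: \<rho>_def)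
  have \<rho>_mono: "\<rho> l \<le> \<rho> k" if "k \<le> l" for k l
    using that \<theta> r by (simp add: \<rho>_def power_decreasing)
  have \<rho>_r: "\<rho> k \<le> r" for k using \<rho>_mono[of 0 k] by (simp add: \<rho>_def)
  have \<rho>_R: "\<rho> k < R" for k using \<rho>_r[of k] r by simp
  have "\<forall>k. \<exists>T\<subseteq>S. separated_set Z (4 * \<rho> k) T \<and> (\<forall>x\<in>S. \<exists>y\<in>T. mdist Z y x < 4 * \<rho> k)"
    using S X \<rho>_pos by (intro allI maximal_separated_subset) auto
  then obtain T where T: "\<And>k. T k \<subseteq> S" "\<And>k. separated_set Z (4 * \<rho> k) (T k)"
    "\<And>k x. x \<in> S \<Longrightarrow> \<exists>y\<in>T k. mdist Z y x < 4 * \<rho> k" by metis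
  have T_fin: "finite (T k)" for k using T(1) S(1) finite_subset by blast
  have level: "real (card S) * (cl * (\<rho> K)\<^sup>2) \<le> real (card (T k)) * (400 * CU * (\<rho> k)\<^sup>2)" if k: "k < K" for k
  proof -
    have c: "0 < cl * (\<rho> K)\<^sup>2" using const_pos \<rho>_pos[of K] by simp
    have "real (card S) \<le> real (card (T k)) * (400 * CU * (\<rho> k)\<^sup>2 / (cl * (\<rho> K)\<^sup>2))"
    proof (rule card_le_sum_cover[OF T_fin S(1), where N = "\<lambda>y. {x. mdist Z y x < 4 * \<rho> k}"])
      fix y assume "y \<in> T k"
      moreover have "separated_set Z (\<rho> K) (S \<inter> {x. mdist Z y x < 4 * \<rho> k})"
        using S(3) separated_set_subset by (force simp: \<rho>_def)
      ultimately have "real (card (S \<inter> {x. mdist Z y x < 4 * \<rho> k})) * (cl * (\<rho> K)\<^sup>2) \<le> 400 * CU * (\<rho> k)\<^sup>2"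
        using S T(1)[of k] \<rho>_pos[of K] \<rho>_mono[of k K] k \<rho>_r[of k] r
        by (intro card_separated_near[where y = y]) auto
      then show "real (card (S \<inter> {x. mdist Z y x < 4 * \<rho> k})) \<le> 400 * CU * (\<rho> k)\<^sup>2 / (cl * (\<rho> K)\<^sup>2)"
        by (subst pos_le_divide_eq[OF c])
    qed (use T(3) in auto)
    then show ?thesis using c by (simp add: pos_le_divide_eq)
  qed
  have "(\<Sum>(k, x)\<in>Sigma {..<K} T. cl * (\<rho> k)\<^sup>2) \<le> CU * (3 * r)\<^sup>2"
  proof (rule mcball_packing[where c = "\<lambda>(k, x). hole_center (\<rho> k) x" and \<rho> = "\<lambda>(k, x). \<kappa> * \<rho> k / 2"
        and T = "mcball_of Z y (3 * r)"])
    have disj: "hole_ball (\<rho> k) x \<inter> hole_ball (\<rho> l) x' = {}"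
      if h: "k \<le> l" "x \<in> T k" "x' \<in> T l" "(k, x) \<noteq> (l, x')" for k l x x'
    proof (intro equals0I)
      fix w assume "w \<in> hole_ball (\<rho> k) x \<inter> hole_ball (\<rho> l) x'"
      then have w: "w \<in> hole_ball (\<rho> k) x" "w \<in> hole_ball (\<rho> l) x'" by blast+
      have xX: "x \<in> X" "x' \<in> X" using h T(1) S by blast+
      note n = hole_ball_near[OF xX(1) \<rho>_pos \<rho>_R w(1)] hole_ball_near[OF xX(2) \<rho>_pos \<rho>_R w(2)]
      show False
      proof (cases "k = l")
        case True
        then have "4 * \<rho> k \<le> mdist Z x x'" using separated_setD[OF T(2)] h by blast
        also have "\<dots> \<le> mdist Z x w + mdist Z x' w"
          using mdist_triangle[of x Z w x'] n xX X by (auto simp: mdist_commute)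
        finally show False using n True \<rho>_pos[of k] by simp
      next
        case False
        then have "\<rho> l \<le> \<rho> (Suc k)" using h by (intro \<rho>_mono) auto
        also have "\<dots> = \<kappa> / 4 * \<rho> k" by (simp add: \<rho>_def \<theta>_def)
        finally have "3/2 * \<rho> l < \<kappa> * \<rho> k / 2" using \<kappa> \<rho>_pos[of k] mult_pos_pos[of \<kappa> "\<rho> k"] by linarith
        then show False using hole_ball_far[OF xX(1) \<rho>_pos \<rho>_R w(1) xX(2)] n by simp
      qed
    qed
    have "hole_ball (\<rho> k) x \<inter> hole_ball (\<rho> l) x' = {}"
      if h: "x \<in> T k" "x' \<in> T l" "(k, x) \<noteq> (l, x')" for k l x x'
      using disj[of k l x x'] disj[of l k x' x] h by (cases "k \<le> l") auto
    then show "disjoint_family_on (\<lambda>i. mcball_of Z (case i of (k, x) \<Rightarrow> hole_center (\<rho> k) x) (case i of (k, x) \<Rightarrow> \<kappa> * \<rho> k / 2)) (Sigma {..<K} T)"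
      unfolding disjoint_family_on_def by (auto split: prod.splits)
    fix i assume "i \<in> Sigma {..<K} T"
    then obtain k x where i: "i = (k, x)" "x \<in> T k" "x \<in> S" "x \<in> X" using T(1) S by blast
    show "0 \<le> (case i of (k, x) \<Rightarrow> cl * (\<rho> k)\<^sup>2) \<and> ennreal (case i of (k, x) \<Rightarrow> cl * (\<rho> k)\<^sup>2)
        \<le> hausdorff2 Z (mcball_of Z (case i of (k, x) \<Rightarrow> hole_center (\<rho> k) x) (case i of (k, x) \<Rightarrow> \<kappa> * \<rho> k / 2))"
      using hole_center(4)[OF i(4) \<rho>_pos \<rho>_R] const_pos by (simp add: i(1))
    have "w \<in> mcball_of Z y (3 * r)" if w: "w \<in> hole_ball (\<rho> k) x" for w
      using hole_ball_near[OF i(4) \<rho>_pos \<rho>_R w] near[OF i(3)] mdist_triangle[of y Z x w] y i X \<rho>_r[of k] r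
      by (auto simp del: in_mcball_of simp: in_mcball_of subset_iff)
    then show "mcball_of Z (case i of (k, x) \<Rightarrow> hole_center (\<rho> k) x) (case i of (k, x) \<Rightarrow> \<kappa> * \<rho> k / 2) \<subseteq> mcball_of Z y (3 * r)"
      by (auto simp: i(1) simp del: in_mcball_of)
  next
    show "hausdorff2 Z (mcball_of Z y (3 * r)) \<le> ennreal (CU * (3 * r)\<^sup>2)"
      using upper[OF y, of "3 * r"] r by auto
  qed (use T_fin const_pos in auto)
  then have sum: "(\<Sum>k<K. real (card (T k)) * (cl * (\<rho> k)\<^sup>2)) \<le> 9 * CU * r\<^sup>2"
    using T_fin by (simp add: sum.Sigma[symmetric] power_mult_distrib)
  have "real K * (real (card S) * (cl * (\<rho> K)\<^sup>2) * cl / (400 * CU))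
      = (\<Sum>k<K. real (card S) * (cl * (\<rho> K)\<^sup>2) * cl / (400 * CU))" by simp
  also have "\<dots> \<le> (\<Sum>k<K. real (card (T k)) * (cl * (\<rho> k)\<^sup>2))"
  proof (rule sum_mono)
    fix k assume "k \<in> {..<K}"
    then have "real (card S) * (cl * (\<rho> K)\<^sup>2) * cl \<le> real (card (T k)) * (400 * CU * (\<rho> k)\<^sup>2) * cl"
      using level const_pos by (intro mult_right_mono) auto
    then show "real (card S) * (cl * (\<rho> K)\<^sup>2) * cl / (400 * CU) \<le> real (card (T k)) * (cl * (\<rho> k)\<^sup>2)"
      using const_pos by (simp add: divide_simps mult_ac)
  qed
  also note sum
  finally have "(real K * real (card S) * (\<theta> ^ K)\<^sup>2) * (cl\<^sup>2 * r\<^sup>2) \<le> (3600 * CU\<^sup>2) * r\<^sup>2"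
    using const_pos by (simp add: \<rho>_def field_simps power2_eq_square)
  then have "(real K * real (card S) * (\<theta> ^ K)\<^sup>2) * cl\<^sup>2 \<le> 3600 * CU\<^sup>2"
    using r by (simp add: mult.assoc[symmetric])
  then show ?thesis using const_pos by (simp add: divide_simps mult_ac)
qed

text \<open>
  The factor \<open>K\<close> in the previous estimate beats the constants once \<open>K\<close> is large. The gain of any
  factor over \<open>\<epsilon>\<^sup>-\<^sup>2\<close> at a single \<open>\<epsilon>\<close> is all that is needed to lower the exponent.
\<close>

lemma one_scale_gain:
  obtains \<epsilon> where "0 < \<epsilon>" "\<epsilon> < 1"
    "\<And>S y r. \<lbrakk>finite S; S \<subseteq> X; separated_set Z (\<epsilon> * r) S; 0 < r; 5 * r < R; y \<in> X;
        \<And>x. x \<in> S \<Longrightarrow> mdist Z y x < r\<rbrakk> \<Longrightarrow> real (card S) \<le> 1 / (2 * \<epsilon>\<^sup>2)"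
proof -
  define C where "C = 3600 * CU\<^sup>2 / cl\<^sup>2"
  obtain K :: nat where K: "2 * C + 1 < real K" using reals_Archimedean2 by blast
  have C: "0 < C" using const_pos by (simp add: C_def)
  have K0: "0 < K" using K C by (cases K) auto
  show ?thesis
  proof (rule that[of "(\<kappa> / 4) ^ K"])
    show e: "0 < (\<kappa> / 4) ^ K" "(\<kappa> / 4) ^ K < 1"
      using \<kappa> K0 by (auto intro!: power_less_one_iff[THEN iffD2])
    fix S y r
    assume a: "finite S" "S \<subseteq> X" "separated_set Z ((\<kappa> / 4) ^ K * r) S" "0 < r" "5 * r < R" "y \<in> X"
      "\<And>x. x \<in> S \<Longrightarrow> mdist Z y x < r"
    define e where "e = (\<kappa> / 4) ^ K"
    let ?a = "real (card S) * e\<^sup>2"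
    have "?a * (2 * C) \<le> ?a * real K" using K by (intro mult_left_mono) auto
    also have "\<dots> \<le> C" using card_separated_scales[OF a] by (simp add: C_def e_def)
    finally have "?a * 2 \<le> 1" using C by (simp add: mult.assoc[symmetric])
    moreover have "0 < 2 * e\<^sup>2" using e(1)[folded e_def] by simp
    ultimately have "real (card S) \<le> 1 / (2 * e\<^sup>2)" by (simp add: pos_le_divide_eq mult_ac)
    then show "real (card S) \<le> 1 / (2 * ((\<kappa> / 4) ^ K)\<^sup>2)" by (simp add: e_def)
  qed
qed

text \<open>
  Submultiplicativity: the balls of radius \<open>\<epsilon> r\<close> around a maximal \<open>\<epsilon> r\<close>-separated subset of \<open>S\<close>
  cover \<open>S\<close>, and each of them is treated by induction.
\<close>

lemma card_separated_powers:
  assumes \<epsilon>: "0 < \<epsilon>" "\<epsilon> < 1"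
    and gain: "\<And>S y r. \<lbrakk>finite S; S \<subseteq> X; separated_set Z (\<epsilon> * r) S; 0 < r; 5 * r < R; y \<in> X;
        \<And>x. x \<in> S \<Longrightarrow> mdist Z y x < r\<rbrakk> \<Longrightarrow> real (card S) \<le> M"
  shows "\<lbrakk>finite S; S \<subseteq> X; separated_set Z (\<epsilon> ^ Suc j * r) S; 0 < r; 5 * r < R; y \<in> X;
        \<And>x. x \<in> S \<Longrightarrow> mdist Z y x < r\<rbrakk> \<Longrightarrow> real (card S) \<le> M ^ Suc j"
proof (induction j arbitrary: S y r)
  case 0
  then show ?case using gain[of S r y] by simp
next
  case (Suc j)
  obtain T where T: "T \<subseteq> S" "separated_set Z (\<epsilon> * r) T" "\<And>x. x \<in> S \<Longrightarrow> \<exists>y\<in>T. mdist Z y x < \<epsilon> * r"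
    using maximal_separated_subset[of S Z "\<epsilon> * r"] Suc.prems(1,2,4) \<epsilon> X
    by (meson mult_pos_pos order_trans)
  have fin: "finite T" using T Suc.prems finite_subset by blast
  have cardT: "real (card T) \<le> M" using T fin Suc.prems by (intro gain[of T r y]) auto
  have er: "\<epsilon> * r < r" using \<epsilon> Suc.prems by simp
  have "real (card S) \<le> real (card T) * M ^ Suc j"
  proof (rule card_le_sum_cover[OF fin Suc.prems(1), where N = "\<lambda>y. {x. mdist Z y x < \<epsilon> * r}"])
    fix t assume t: "t \<in> T"
    have "separated_set Z (\<epsilon> ^ Suc j * (\<epsilon> * r)) (S \<inter> {x. mdist Z t x < \<epsilon> * r})"
      using Suc.prems(3) by (rule separated_set_subset) auto
    then show "real (card (S \<inter> {x. mdist Z t x < \<epsilon> * r})) \<le> M ^ Suc j"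
      using Suc.prems T t \<epsilon> er less_trans[of "5 * (\<epsilon> * r)" "5 * r" R] by (intro Suc.IH[of _ "\<epsilon> * r" t]) auto
  qed (use T in auto)
  also have "\<dots> \<le> M * M ^ Suc j" using cardT by (intro mult_right_mono) auto
  finally show ?case by simp
qed

text \<open>
  The exponent is defined by \<open>M = \<epsilon>\<^sup>-\<^sup>Q\<close>, but taken to be 1 if this is less than 1. Separations that are not
  powers of \<open>\<epsilon>\<close> cost a factor \<open>\<epsilon>\<^sup>-\<^sup>Q\<close>, and large radii are reduced to small ones by the finite net \<open>P\<close>.
\<close>

lemma card_separated_bound:
  assumes P: "finite P" "P \<subseteq> X" "\<And>x. x \<in> X \<Longrightarrow> \<exists>p\<in>P. mdist Z p x < R / 6" and R: "0 < R"
  obtains C Q where "1 \<le> Q" "Q < 2" "0 < C"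
    "\<And>S y r s. \<lbrakk>finite S; S \<subseteq> X; separated_set Z s S; 0 < s; s \<le> r; y \<in> X;
        \<And>x. x \<in> S \<Longrightarrow> mdist Z y x < r\<rbrakk> \<Longrightarrow> real (card S) \<le> C * (r / s) powr Q"
proof -
  obtain \<epsilon> where \<epsilon>: "0 < \<epsilon>" "\<epsilon> < 1" and gain:
    "\<And>S y r. \<lbrakk>finite S; S \<subseteq> X; separated_set Z (\<epsilon> * r) S; 0 < r; 5 * r < R; y \<in> X;
        \<And>x. x \<in> S \<Longrightarrow> mdist Z y x < r\<rbrakk> \<Longrightarrow> real (card S) \<le> 1 / (2 * \<epsilon>\<^sup>2)"
    using one_scale_gain by blast
  define M where "M = 1 / (2 * \<epsilon>\<^sup>2)"
  have M: "0 < M" using \<epsilon> by (simp add: M_def)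
  define Q where "Q = max 1 (ln M / ln (1 / \<epsilon>))"
  have ln_pos: "0 < ln (1 / \<epsilon>)" using \<epsilon> by (intro ln_gt_zero) (simp add: divide_simps)
  have MQ: "M \<le> (1 / \<epsilon>) powr Q"
  proof -
    have "ln M = ln M / ln (1 / \<epsilon>) * ln (1 / \<epsilon>)" using ln_pos by simp
    also have "\<dots> \<le> Q * ln (1 / \<epsilon>)" unfolding Q_def using ln_pos by (intro mult_right_mono) auto
    finally have "exp (ln M) \<le> exp (Q * ln (1 / \<epsilon>))" by simp
    then show ?thesis using M \<epsilon> by (simp add: powr_def)
  qed
  have Q: "1 \<le> Q" "Q < 2"
  proof -
    show "1 \<le> Q" by (simp add: Q_def)
    have "M < (1 / \<epsilon>)\<^sup>2" using \<epsilon> by (simp add: M_def divide_simps)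
    then have "ln M < 2 * ln (1 / \<epsilon>)" using M \<epsilon> by (metis ln_less_cancel_iff ln_realpow less_trans of_nat_numeral zero_less_divide_1_iff)
    then show "Q < 2" using ln_pos by (simp add: Q_def divide_simps)
  qed
  have small: "real (card S) \<le> (1 / \<epsilon>) powr Q * (r / s) powr Q"
    if S: "finite S" "S \<subseteq> X" "separated_set Z s S" "0 < s" "s \<le> r" "y \<in> X"
        "\<And>x. x \<in> S \<Longrightarrow> mdist Z y x < r" "5 * r < R" for S y r s
  proof -
    have sr: "0 < s / r" "s / r \<le> 1" using S by auto
    \<comment> \<open>Round the ratio \<open>s / r\<close> down to a power of \<open>\<epsilon>\<close>.\<close>
    define n where "n = (LEAST n. \<epsilon> ^ n < s / r)"
    have "\<exists>n. \<epsilon> ^ n < s / r" using real_arch_pow_inv[OF sr(1) \<epsilon>(2)] .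
    then have n: "\<epsilon> ^ n < s / r" unfolding n_def by (rule LeastI_ex)
    then obtain j where j: "n = Suc j" using sr by (cases n) auto
    have j': "s / r \<le> \<epsilon> ^ j" using not_less_Least[of j "\<lambda>n. \<epsilon> ^ n < s / r"] j n_def by force
    have "\<epsilon> ^ Suc j * r \<le> s" using n j S by (simp add: divide_simps)
    then have "separated_set Z (\<epsilon> ^ Suc j * r) S" using separated_set_subset[OF S(3)] by blast
    note sep = this
    have "real (card S) \<le> M ^ Suc j"
    proof (rule card_separated_powers[OF \<epsilon>, where y = y and r = r])
      show "real (card S) \<le> M" if "finite S" "S \<subseteq> X" "separated_set Z (\<epsilon> * r) S" "0 < r" "5 * r < R"
        "y \<in> X" "\<And>x. x \<in> S \<Longrightarrow> mdist Z y x < r" for S y r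
        using gain[OF that] by (simp add: M_def)
    qed (use S sep in auto)
    also have "\<dots> \<le> ((1 / \<epsilon>) powr Q) ^ Suc j" using MQ M by (intro power_mono) auto
    also have "\<dots> = ((1 / \<epsilon>) ^ Suc j) powr Q"
    proof -
      have x: "0 < 1 / \<epsilon>" using \<epsilon> by simp
      show ?thesis
        by (simp only: powr_realpow[OF x, symmetric] powr_realpow[OF powr_gt_zero[THEN iffD2, OF less_imp_neq[OF x, symmetric]], symmetric]
            powr_powr mult.commute)
    qed
    also have "\<dots> \<le> (1 / \<epsilon> * (r / s)) powr Q"
    proof (rule powr_mono2)
      have "(1 / \<epsilon>) ^ j \<le> r / s" using j' \<epsilon> S by (simp add: divide_simps power_one_over mult_ac)
      then show "(1 / \<epsilon>) ^ Suc j \<le> 1 / \<epsilon> * (r / s)"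
        unfolding power_Suc by (rule mult_left_mono) (use \<epsilon> in auto)
    qed (use Q \<epsilon> in auto)
    also have "\<dots> = (1 / \<epsilon>) powr Q * (r / s) powr Q" using \<epsilon> S by (simp only: powr_mult)
    finally show ?thesis .
  qed
  define C where "C = real (card P + 1) * (1 / \<epsilon>) powr Q"
  have "1 * (1 / \<epsilon>) powr Q \<le> C" "real (card P) * (1 / \<epsilon>) powr Q \<le> C"
    unfolding C_def by (intro mult_right_mono; simp)+
  moreover have "0 < (1 / \<epsilon>) powr Q" using \<epsilon> by simp
  ultimately have C: "(1 / \<epsilon>) powr Q \<le> C" "real (card P) * (1 / \<epsilon>) powr Q \<le> C" "0 < C"
    by linarith+
  show ?thesis
  proof (rule that[of Q C])
    fix S y r s
    assume S: "finite S" "S \<subseteq> X" "separated_set Z s S" "0 < s" "s \<le> r" "y \<in> X"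
        "\<And>x. x \<in> S \<Longrightarrow> mdist Z y x < r"
    show "real (card S) \<le> C * (r / s) powr Q"
    proof (cases "5 * r < R")
      case True
      have "(1 / \<epsilon>) powr Q * (r / s) powr Q \<le> C * (r / s) powr Q" using C by (intro mult_right_mono) auto
      then show ?thesis using small[OF S True] by simp
    next
      case False
      define s' where "s' = min s (R / 6)"
      have s': "0 < s'" "s' \<le> s" "s' \<le> R / 6" using S R by (auto simp: s'_def)
      have "R / 6 / s' \<le> r / s" using S False R by (auto simp: s'_def min_def divide_simps)
      then have le: "(R / 6 / s') powr Q \<le> (r / s) powr Q" using Q R s' by (intro powr_mono2) auto
      have "real (card S) \<le> real (card P) * ((1 / \<epsilon>) powr Q * (r / s) powr Q)"
      proof (rule card_le_sum_cover[OF P(1) S(1), where N = "\<lambda>y. {x. mdist Z y x < R / 6}"])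
        fix p assume p: "p \<in> P"
        have "real (card (S \<inter> {x. mdist Z p x < R / 6})) \<le> (1 / \<epsilon>) powr Q * (R / 6 / s') powr Q"
          using S P p s' R separated_set_subset[OF S(3), of "S \<inter> {x. mdist Z p x < R / 6}" s']
          by (intro small[where y = p]) auto
        also have "\<dots> \<le> (1 / \<epsilon>) powr Q * (r / s) powr Q" using le by (intro mult_left_mono) auto
        finally show "real (card (S \<inter> {x. mdist Z p x < R / 6})) \<le> (1 / \<epsilon>) powr Q * (r / s) powr Q" .
      qed (use P S in auto)
      also have "\<dots> \<le> C * (r / s) powr Q"
        using C by (simp add: mult.assoc[symmetric] mult_right_mono)
      finally show ?thesis .
    qed
  qed (use Q C in auto)
qed

end

section \<open>Diamonds over lattice edges\<close>

definition gaussian :: "complex set" where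
  "gaussian = {z. Re z \<in> \<int> \<and> Im z \<in> \<int>}"

lemma gaussian_arith [intro]:
  assumes "a \<in> gaussian" "b \<in> gaussian"
  shows "a + b \<in> gaussian" "a - b \<in> gaussian" "a * b \<in> gaussian"
  using assms by (auto simp: gaussian_def)

lemma gaussian_of_nat [simp]: "of_nat n \<in> gaussian"
  by (simp add: gaussian_def)

lemma gaussian_cases:
  assumes "a \<in> gaussian"
  obtains n k :: int where "a = Complex (of_int n) (of_int k)"
  using assms by (auto simp: gaussian_def elim!: Ints_cases) (metis complex_surj)

definition lattice_edge :: "complex \<Rightarrow> complex \<Rightarrow> bool" where
  "lattice_edge a b \<longleftrightarrow> a \<in> gaussian \<and> b \<in> gaussian \<and> norm (b - a) = 1"

text \<open>
  The rhombus with diagonal from \<open>a\<close> to \<open>b\<close> whose width is half of its length. Its half-angle at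
  \<open>a\<close> and \<open>b\<close> is less than 45 degrees, so that the rhombi over two perpendicular edges with a common
  end point do not overlap.
\<close>

definition diamond :: "complex \<Rightarrow> complex \<Rightarrow> complex set" where
  "diamond a b = (\<lambda>w. a + (b - a) * w) ` {w. 2 * \<bar>Im w\<bar> \<le> Re w \<and> 2 * \<bar>Im w\<bar> \<le> 1 - Re w}"

lemma diamond_affine: "diamond (p + c * a) (p + c * b) = (\<lambda>z. p + c * z) ` diamond a b"
  unfolding diamond_def image_image by (rule image_cong) (auto simp: algebra_simps)

lemma diamond_scale: "diamond (c * a) (c * b) = (\<lambda>z. c * z) ` diamond a b"
  using diamond_affine[of 0 c a b] by simp

lemma diamond_ends: "a \<in> diamond a b" "b \<in> diamond a b"
  unfolding diamond_def by (auto intro: image_eqI[of _ _ 0] image_eqI[of _ _ 1])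

lemma compact_diamond: "compact (diamond a b)"
proof -
  let ?W = "{w :: complex. 2 * \<bar>Im w\<bar> \<le> Re w \<and> 2 * \<bar>Im w\<bar> \<le> 1 - Re w}"
  have "norm w \<le> 2" if "w \<in> ?W" for w
    using cmod_le[of w] that by (auto simp: abs_if split: if_splits)
  then have "bounded ?W" by (auto simp: bounded_iff)
  moreover have "closed ?W"
    by (intro closed_Collect_conj closed_Collect_le continuous_intros)
  ultimately show ?thesis
    unfolding diamond_def compact_eq_bounded_closed[symmetric]
    by (intro compact_continuous_image continuous_intros) (simp add: compact_eq_bounded_closed)
qed

lemma norm_unit_cases:
  assumes "d \<in> gaussian" "norm d = 1"
  shows "d \<in> {1, -1, \<i>, -\<i>}"
proof -
  obtain n k :: int where d: "d = Complex (of_int n) (of_int k)" using assms(1) by (rule gaussian_cases)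
  have "of_int (n\<^sup>2 + k\<^sup>2) = (1 :: real)" using assms(2) by (simp add: d cmod_def)
  then have *: "n\<^sup>2 + k\<^sup>2 = 1" by (simp only: of_int_eq_1_iff)
  have "n\<^sup>2 \<le> 1" "k\<^sup>2 \<le> 1" using * by (smt (verit) zero_le_power2)+
  then have "\<bar>n\<bar> \<le> 1" "\<bar>k\<bar> \<le> 1" by (simp_all add: abs_square_le_1)
  then have "n \<in> {-1, 0, 1}" "k \<in> {-1, 0, 1}" by auto
  then show ?thesis using * by (auto simp: d complex_eq_iff)
qed

text \<open>
  The diamond does not depend on the orientation of the edge; in these coordinates the position
  of two diamonds can be discussed by linear arithmetic.
\<close>

lemma lattice_edge_cases:
  assumes "lattice_edge a b"
  obtains (horizontal) n k :: int where
    "{a, b} = {Complex n k, Complex (n + 1) k}"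
    "\<And>z. z \<in> diamond a b \<Longrightarrow> 2 * \<bar>Im z - k\<bar> \<le> Re z - n \<and> 2 * \<bar>Im z - k\<bar> \<le> real_of_int n + 1 - Re z"
  | (vertical) n k :: int where
    "{a, b} = {Complex n k, Complex n (k + 1)}"
    "\<And>z. z \<in> diamond a b \<Longrightarrow> 2 * \<bar>Re z - n\<bar> \<le> Im z - k \<and> 2 * \<bar>Re z - n\<bar> \<le> real_of_int k + 1 - Im z"
proof -
  obtain n k :: int where a: "a = Complex n k"
    using assms gaussian_cases unfolding lattice_edge_def by metis
  have "b - a \<in> {1, -1, \<i>, -\<i>}"
    using assms unfolding lattice_edge_def by (intro norm_unit_cases) auto
  then consider "b = a + 1" | "b = a - 1" | "b = a + \<i>" | "b = a - \<i>"
    by (auto simp: algebra_simps)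
  then show ?thesis
  proof cases
    case 1
    then have "b - a = 1" by simp
    show ?thesis
    proof (rule horizontal[of "n" "k"])
      fix z assume "z \<in> diamond a b"
      then show "2 * \<bar>Im z - real_of_int (k)\<bar> \<le> Re z - real_of_int (n) \<and> 2 * \<bar>Im z - real_of_int (k)\<bar> \<le> real_of_int n + 1 - Re z"
        unfolding diamond_def \<open>b - a = 1\<close> by (auto simp: a)
    qed (use 1 in \<open>auto simp: a complex_eq_iff\<close>)
  next
    case 2
    then have "b - a = -1" by simp
    show ?thesis
    proof (rule horizontal[of "n - 1" "k"])
      fix z assume "z \<in> diamond a b"
      then show "2 * \<bar>Im z - real_of_int (k)\<bar> \<le> Re z - real_of_int (n - 1) \<and> 2 * \<bar>Im z - real_of_int (k)\<bar> \<le> real_of_int (n - 1) + 1 - Re z"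
        unfolding diamond_def \<open>b - a = -1\<close> by (auto simp: a)
    qed (use 2 in \<open>auto simp: a complex_eq_iff\<close>)
  next
    case 3
    then have "b - a = \<i>" by simp
    show ?thesis
    proof (rule vertical[of "n" "k"])
      fix z assume "z \<in> diamond a b"
      then show "2 * \<bar>Re z - real_of_int (n)\<bar> \<le> Im z - real_of_int (k) \<and> 2 * \<bar>Re z - real_of_int (n)\<bar> \<le> real_of_int k + 1 - Im z"
        unfolding diamond_def \<open>b - a = \<i>\<close> by (auto simp: a)
    qed (use 3 in \<open>auto simp: a complex_eq_iff\<close>)
  next
    case 4
    then have "b - a = -\<i>" by simp
    show ?thesis
    proof (rule vertical[of "n" "k - 1"])
      fix z assume "z \<in> diamond a b"
      then show "2 * \<bar>Re z - real_of_int (n)\<bar> \<le> Im z - real_of_int (k - 1) \<and> 2 * \<bar>Re z - real_of_int (n)\<bar> \<le> real_of_int (k - 1) + 1 - Im z"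
        unfolding diamond_def \<open>b - a = -\<i>\<close> by (auto simp: a)
    qed (use 4 in \<open>auto simp: a complex_eq_iff\<close>)
  qed
qed

lemma of_int_near_eq: "\<bar>real_of_int k - real_of_int k'\<bar> < 1 \<Longrightarrow> k = k'"
  by (simp flip: of_int_diff of_int_abs)

lemma of_int_near_Suc: "\<lbrakk>real_of_int n - 1 < real_of_int n'; real_of_int n' < real_of_int n + 2\<rbrakk> \<Longrightarrow> n' = n \<or> n' = n + 1"
  by linarith

lemmas int_to_real = of_int_le_iff[symmetric, where 'a = real] of_int_add of_int_1 of_int_numeral

lemma thin_bounds:
  fixes x y n k :: real
  assumes "2 * \<bar>y - k\<bar> \<le> x - n \<and> 2 * \<bar>y - k\<bar> \<le> n + 1 - x"
  shows "n \<le> x" "x \<le> n + 1" "k - 1/4 \<le> y" "y \<le> k + 1/4"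
  using assms abs_ge_self[of "y - k"] abs_ge_minus_self[of "y - k"] by auto

lemma thin_cross:
  fixes x y n k n' k' :: real
  assumes "2 * \<bar>y - k\<bar> \<le> x - n \<and> 2 * \<bar>y - k\<bar> \<le> n + 1 - x"
    and "2 * \<bar>x - n'\<bar> \<le> y - k' \<and> 2 * \<bar>x - n'\<bar> \<le> k' + 1 - y"
    and "n' = n \<or> n' = n + 1" "k = k' \<or> k = k' + 1"
  shows "x = n' \<and> y = k"
proof -
  have abs: "y - k \<le> \<bar>y - k\<bar>" "k - y \<le> \<bar>y - k\<bar>" "x - n' \<le> \<bar>x - n'\<bar>" "n' - x \<le> \<bar>x - n'\<bar>"
    by linarith+
  have "x = n'" using assms abs by (elim disjE conjE; linarith)
  moreover have "y = k" using assms abs by (elim disjE conjE; linarith)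
  ultimately show ?thesis ..
qed

text \<open>
  The diamond over a horizontal edge from \<open>(n,k)\<close> to \<open>(n+1,k)\<close> lies in the box
  \<open>[n,n+1] \<times> [k-1/4,k+1/4]\<close>, and similarly for vertical edges. The boxes of two edges without common
  vertex are separated by 1/2 in one of the coordinates.
\<close>

lemma diamond_far:
  assumes e: "lattice_edge a b" and f: "lattice_edge a' b'" and disj: "{a, b} \<inter> {a', b'} = {}"
    and z: "z \<in> diamond a b" "z' \<in> diamond a' b'"
  shows "1/2 \<le> norm (z - z')"
proof -
  have "1/2 \<le> \<bar>Re z - Re z'\<bar> \<or> 1/2 \<le> \<bar>Im z - Im z'\<bar>"
    using e
  proof (cases rule: lattice_edge_cases)
    case (horizontal n k)
    note e' = horizontal
    note b = thin_bounds[OF e'(2)[OF z(1)]]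
    show ?thesis using f
    proof (cases rule: lattice_edge_cases)
      case (horizontal n' k')
      have "k + 1 \<le> k' \<or> k' + 1 \<le> k \<or> n' + 2 \<le> n \<or> n + 2 \<le> n'"
        using disj unfolding e'(1) horizontal(1)
        by (simp add: complex_eq_iff del: of_int_add of_int_1) presburger
      then show ?thesis unfolding int_to_real using b thin_bounds[OF horizontal(2)[OF z(2)]]
        by (elim disjE; linarith)
    next
      case (vertical n' k')
      have "n' + 1 \<le> n \<or> n + 2 \<le> n' \<or> k + 1 \<le> k' \<or> k' + 2 \<le> k"
        using disj unfolding e'(1) vertical(1)
        by (simp add: complex_eq_iff del: of_int_add of_int_1) presburger
      then show ?thesis unfolding int_to_real using b thin_bounds[OF vertical(2)[OF z(2)]]
        by (elim disjE; linarith)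
    qed
  next
    case (vertical n k)
    note e' = vertical
    note b = thin_bounds[OF e'(2)[OF z(1)]]
    show ?thesis using f
    proof (cases rule: lattice_edge_cases)
      case (horizontal n' k')
      have "n + 1 \<le> n' \<or> n' + 2 \<le> n \<or> k' + 1 \<le> k \<or> k + 2 \<le> k'"
        using disj unfolding e'(1) horizontal(1)
        by (simp add: complex_eq_iff del: of_int_add of_int_1) presburger
      then show ?thesis unfolding int_to_real using b thin_bounds[OF horizontal(2)[OF z(2)]]
        by (elim disjE; linarith)
    next
      case (vertical n' k')
      have "n + 1 \<le> n' \<or> n' + 1 \<le> n \<or> k' + 2 \<le> k \<or> k + 2 \<le> k'"
        using disj unfolding e'(1) vertical(1)
        by (simp add: complex_eq_iff del: of_int_add of_int_1) presburger
      then show ?thesis unfolding int_to_real using b thin_bounds[OF vertical(2)[OF z(2)]]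
        by (elim disjE; linarith)
    qed
  qed
  then show ?thesis
    using abs_Re_le_cmod[of "z - z'"] abs_Im_le_cmod[of "z - z'"] by auto
qed

lemma diamond_meet:
  assumes e: "lattice_edge a b" and f: "lattice_edge a' b'" and ne: "{a, b} \<noteq> {a', b'}"
    and z: "z \<in> diamond a b" "z \<in> diamond a' b'"
  shows "z \<in> {a, b} \<inter> {a', b'}"
  using e
proof (cases rule: lattice_edge_cases)
  case (horizontal n k)
  note e' = horizontal and b = thin_bounds[OF horizontal(2)[OF z(1)]]
  show ?thesis using f
  proof (cases rule: lattice_edge_cases)
    case (horizontal n' k')
    note b' = thin_bounds[OF horizontal(2)[OF z(2)]]
    have k: "k = k'" using b b' by (intro of_int_near_eq) linarith
    have "n \<noteq> n'" using ne k unfolding e'(1) horizontal(1) by blast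
    then have "n' + 1 \<le> n \<or> n + 1 \<le> n'" by linarith
    then have "(Re z = n' \<and> real_of_int n' = n + 1) \<or> (Re z = n \<and> real_of_int n = n' + 1)"
      unfolding int_to_real using b b' by (elim disjE) linarith+
    moreover have "Im z = k" if "Re z = n \<or> Re z = real_of_int n + 1"
      using e'(2)[OF z(1)] that by auto
    ultimately have "(Re z = n' \<and> Im z = k \<and> real_of_int n' = n + 1) \<or> (Re z = n \<and> Im z = k \<and> real_of_int n = n' + 1)"
      by auto
    then show ?thesis unfolding e'(1) horizontal(1) by (auto simp: complex_eq_iff k)
  next
    case (vertical n' k')
    note b' = thin_bounds[OF vertical(2)[OF z(2)]]
    have i: "n' = n \<or> n' = n + 1" "k = k' \<or> k = k' + 1"
      using b b' by (intro of_int_near_Suc; linarith)+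
    have "Re z = n' \<and> Im z = k"
      by (rule thin_cross[OF e'(2)[OF z(1)] vertical(2)[OF z(2)]]) (use i in auto)
    then show ?thesis using i unfolding e'(1) vertical(1) by (auto simp: complex_eq_iff)
  qed
next
  case (vertical n k)
  note e' = vertical and b = thin_bounds[OF vertical(2)[OF z(1)]]
  show ?thesis using f
  proof (cases rule: lattice_edge_cases)
    case (horizontal n' k')
    note b' = thin_bounds[OF horizontal(2)[OF z(2)]]
    have i: "n = n' \<or> n = n' + 1" "k' = k \<or> k' = k + 1"
      using b b' by (intro of_int_near_Suc; linarith)+
    have "Re z = n \<and> Im z = k'"
      by (rule thin_cross[OF horizontal(2)[OF z(2)] e'(2)[OF z(1)]]) (use i in auto)
    then show ?thesis using i unfolding e'(1) horizontal(1) by (auto simp: complex_eq_iff)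
  next
    case (vertical n' k')
    note b' = thin_bounds[OF vertical(2)[OF z(2)]]
    have n: "n = n'" using b b' by (intro of_int_near_eq) linarith
    have "k \<noteq> k'" using ne n unfolding e'(1) vertical(1) by blast
    then have "k' + 1 \<le> k \<or> k + 1 \<le> k'" by linarith
    then have "(Im z = k' \<and> real_of_int k' = k + 1) \<or> (Im z = k \<and> real_of_int k = k' + 1)"
      unfolding int_to_real using b b' by (elim disjE) linarith+
    moreover have "Re z = n" if "Im z = k \<or> Im z = real_of_int k + 1"
      using e'(2)[OF z(1)] that by auto
    ultimately have "(Im z = k' \<and> Re z = n \<and> real_of_int k' = k + 1) \<or> (Im z = k \<and> Re z = n \<and> real_of_int k = k' + 1)"
      by auto
    then show ?thesis unfolding e'(1) vertical(1) by (auto simp: complex_eq_iff n)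
  qed
qed

lemma diamond_near:
  assumes "lattice_edge a b" "z \<in> diamond a b"
  shows "\<bar>Re z - Re a\<bar> \<le> 1" "\<bar>Im z - Im a\<bar> \<le> 1" "\<bar>Re z - Re b\<bar> \<le> 1" "\<bar>Im z - Im b\<bar> \<le> 1"
    "min (Re a) (Re b) - 1/4 \<le> Re z" "Re z \<le> max (Re a) (Re b) + 1/4"
    "min (Im a) (Im b) - 1/4 \<le> Im z" "Im z \<le> max (Im a) (Im b) + 1/4"
proof -
  have "\<bar>Re z - Re a\<bar> \<le> 1 \<and> \<bar>Im z - Im a\<bar> \<le> 1 \<and> \<bar>Re z - Re b\<bar> \<le> 1 \<and> \<bar>Im z - Im b\<bar> \<le> 1 \<and>
    min (Re a) (Re b) - 1/4 \<le> Re z \<and> Re z \<le> max (Re a) (Re b) + 1/4 \<and>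
    min (Im a) (Im b) - 1/4 \<le> Im z \<and> Im z \<le> max (Im a) (Im b) + 1/4"
    using assms(1)
  proof (cases rule: lattice_edge_cases)
    case (horizontal n k)
    show ?thesis using thin_bounds[OF horizontal(2)[OF assms(2)]] horizontal(1) by (auto simp: doubleton_eq_iff)
  next
    case (vertical n k)
    show ?thesis using thin_bounds[OF vertical(2)[OF assms(2)]] vertical(1) by (auto simp: doubleton_eq_iff)
  qed
  then show "\<bar>Re z - Re a\<bar> \<le> 1" "\<bar>Im z - Im a\<bar> \<le> 1" "\<bar>Re z - Re b\<bar> \<le> 1" "\<bar>Im z - Im b\<bar> \<le> 1"
    "min (Re a) (Re b) - 1/4 \<le> Re z" "Re z \<le> max (Re a) (Re b) + 1/4"
    "min (Im a) (Im b) - 1/4 \<le> Im z" "Im z \<le> max (Im a) (Im b) + 1/4" by blast+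
qed

lemma diamond_dist_ends:
  assumes "lattice_edge a b" "z \<in> diamond a b"
  shows "norm (z - a) \<le> 2" "norm (z - b) \<le> 2"
  using cmod_le[of "z - a"] cmod_le[of "z - b"] diamond_near(1-4)[OF assms] by auto

section \<open>Comb-shaped lattice paths\<close>

text \<open>
  The path follows the \<open>x\<close>-axis, except that on \<open>q \<le> x \<le> q + 2 t\<close> it runs through \<open>t\<close> teeth of
  height \<open>h\<close>: up in column \<open>q + 2 i\<close>, one step to the right, down, and one step to the right. A tooth takes
  \<open>2 h + 2\<close> steps to advance by 2, so the teeth make the path longer by \<open>2 h t\<close>.
\<close>

definition comb_coords :: "nat \<Rightarrow> nat \<Rightarrow> nat \<Rightarrow> nat \<Rightarrow> nat \<times> nat" where
  "comb_coords q h t n =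
    (if n < q then (n, 0)
     else if n < q + t * (2 * h + 2) then
       let i = (n - q) div (2 * h + 2); j = (n - q) mod (2 * h + 2)
       in if j \<le> h then (q + 2 * i, j) else (q + 2 * i + 1, 2 * h + 1 - j)
     else (n - 2 * h * t, 0))"

definition comb :: "nat \<Rightarrow> nat \<Rightarrow> nat \<Rightarrow> nat \<Rightarrow> complex" where
  "comb q h t n = (case comb_coords q h t n of (x, y) \<Rightarrow> Complex x y)"

lemma comb_coords_cases:
  obtains (before) "n < q" "comb_coords q h t n = (n, 0)"
  | (up) i j where "n = q + i * (2 * h + 2) + j" "i < t" "j \<le> h" "comb_coords q h t n = (q + 2 * i, j)"
  | (down) i j where "n = q + i * (2 * h + 2) + (2 * h + 1 - j)" "i < t" "j \<le> h"
      "comb_coords q h t n = (q + 2 * i + 1, j)"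
  | (after) l where "n = q + t * (2 * h + 2) + l" "comb_coords q h t n = (q + 2 * t + l, 0)"
proof -
  define i where "i = (n - q) div (2 * h + 2)"
  define j where "j = (n - q) mod (2 * h + 2)"
  consider "n < q" | "q \<le> n" "n < q + t * (2 * h + 2)" | "q + t * (2 * h + 2) \<le> n" by linarith
  then show ?thesis
  proof cases
    case 1
    then show ?thesis using before by (simp add: comb_coords_def)
  next
    case 2
    have n: "n = q + i * (2 * h + 2) + j"
      using 2 div_mult_mod_eq[of "n - q" "2 * h + 2"] unfolding i_def j_def by linarith
    have j: "j < 2 * h + 2" unfolding j_def by simp
    have "n - q < t * (2 * h + 2)" using 2 by linarith
    then have i: "i < t" unfolding i_def by (simp only: less_mult_imp_div_less)
    show ?thesis
    proof (cases "j \<le> h")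
      case True
      then show ?thesis using up[of i j] n i 2 unfolding comb_coords_def Let_def i_def[symmetric] j_def[symmetric] by simp
    next
      case False
      then show ?thesis using down[of i "2 * h + 1 - j"] n i j 2
        unfolding comb_coords_def Let_def i_def[symmetric] j_def[symmetric] by simp
    qed
  next
    case 3
    then have "n - 2 * h * t = q + 2 * t + (n - (q + t * (2 * h + 2)))" by (simp add: algebra_simps)
    then show ?thesis using after[of "n - (q + t * (2 * h + 2))"] 3 by (simp add: comb_coords_def)
  qed
qed

lemma div_mod_digit:
  fixes j p :: nat
  assumes "j < p"
  shows "(i * p + j) div p = i" "(i * p + j) mod p = j"
  using assms by simp_all

lemma comb_coords_up:
  assumes "i < t" "j \<le> h"
  shows "comb_coords q h t (q + i * (2 * h + 2) + j) = (q + 2 * i, j)"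
proof -
  have "Suc i * (2 * h + 2) \<le> t * (2 * h + 2)" using assms by (intro mult_right_mono) auto
  then have "i * (2 * h + 2) + j < t * (2 * h + 2)" using assms by simp
  moreover have "(i * (2 * h + 2) + j) div (2 * h + 2) = i" "(i * (2 * h + 2) + j) mod (2 * h + 2) = j"
    using assms by (intro div_mod_digit; simp)+
  ultimately show ?thesis using assms by (simp add: comb_coords_def Let_def del: mult_Suc_right add_2_eq_Suc' add_2_eq_Suc distrib_left_numeral)
qed

lemma comb_coords_down:
  assumes "i < t" "j \<le> h"
  shows "comb_coords q h t (q + i * (2 * h + 2) + (2 * h + 1 - j)) = (q + 2 * i + 1, j)"
proof -
  define j' where "j' = 2 * h + 1 - j"
  have j': "h < j'" "j' < 2 * h + 2" "2 * h + 1 - j' = j" using assms by (auto simp: j'_def)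
  have "Suc i * (2 * h + 2) \<le> t * (2 * h + 2)" using assms by (intro mult_right_mono) auto
  then have "i * (2 * h + 2) + j' < t * (2 * h + 2)" using j' by simp
  moreover have "(i * (2 * h + 2) + j') div (2 * h + 2) = i" "(i * (2 * h + 2) + j') mod (2 * h + 2) = j'"
    using j' by (intro div_mod_digit; simp)+
  ultimately show ?thesis unfolding j'_def[symmetric] using j' by (simp add: comb_coords_def Let_def del: mult_Suc_right add_2_eq_Suc' add_2_eq_Suc distrib_left_numeral)
qed

lemma comb_coords_after: "comb_coords q h t (q + t * (2 * h + 2) + l) = (q + 2 * t + l, 0)"
  by (simp add: comb_coords_def algebra_simps)

text \<open>
  The number of steps can be recovered from the position.
\<close>

lemma inj_comb_coords: "inj (comb_coords q h t)"
proof (rule inj_on_inverseI)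
  define decode :: "nat \<times> nat \<Rightarrow> nat" where "decode = (\<lambda>(x, y).
    if x < q then x
    else if q + 2 * t \<le> x then q + t * (2 * h + 2) + (x - (q + 2 * t))
    else if even (x - q) then q + ((x - q) div 2) * (2 * h + 2) + y
    else q + ((x - q) div 2) * (2 * h + 2) + (2 * h + 1 - y))"
  fix n
  show "decode (comb_coords q h t n) = n"
    by (cases rule: comb_coords_cases[of n q h t]) (auto simp: decode_def)
qed

lemma comb_coords_Suc:
  "(\<exists>x y. comb_coords q h t n = (x, y) \<and>
     (comb_coords q h t (Suc n) \<in> {(x + 1, y), (x, y + 1)} \<or> comb_coords q h t (Suc n) = (x, y - 1) \<and> 0 < y))"
proof (cases rule: comb_coords_cases[of n q h t])
  case before
  have "comb_coords q h t q = (q, 0)"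
    using comb_coords_up[of 0 t 0 h q] comb_coords_after[of q h t 0] by (cases "t = 0") auto
  then have "comb_coords q h t (Suc n) = (n + 1, 0)"
    using before by (cases "Suc n = q") (simp_all add: comb_coords_def[of q h t "Suc n"])
  then show ?thesis using before by simp
next
  case (up i j)
  show ?thesis
  proof (cases "j = h")
    case True
    then have "Suc n = q + i * (2 * h + 2) + (2 * h + 1 - h)" using up by simp
    then show ?thesis using comb_coords_down[of i t h h q] up True by simp
  next
    case False
    then show ?thesis using comb_coords_up[of i t "Suc j" h q] up by simp
  qed
next
  case (down i j)
  show ?thesis
  proof (cases j)
    case 0
    then have n: "Suc n = q + Suc i * (2 * h + 2) + 0" using down by simp
    show ?thesis
    proof (cases "Suc i = t")
      case True
      then have "comb_coords q h t (Suc n) = (q + 2 * t, 0)"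
        using comb_coords_after[of q h t 0] n by (simp only: add_0_right)
      then show ?thesis using down 0 True by auto
    next
      case False
      then have "comb_coords q h t (Suc n) = (q + 2 * Suc i, 0)"
        using comb_coords_up[of "Suc i" t 0 h q] n down by (simp only: add_0_right)
      then show ?thesis using down 0 by auto
    qed
  next
    case (Suc j')
    then have "Suc n = q + i * (2 * h + 2) + (2 * h + 1 - j')" using down by simp
    then show ?thesis using comb_coords_down[of i t j' h q] down Suc by simp
  qed
next
  case (after l)
  then show ?thesis using comb_coords_after[of q h t "Suc l"] by simp
qed

lemma comb_coords_range:
  assumes "q \<le> n" "n \<le> q + t * (2 * h + 2)" "comb_coords q h t n = (x, y)"
  shows "q \<le> x" "x \<le> q + 2 * t" "y \<le> h"
  using assms by (cases rule: comb_coords_cases[of n q h t]; auto)+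

lemma lattice_edge_Complex:
  assumes "(x', y') \<in> {(x + 1, y), (x, y + 1)} \<or> (x', y') = (x, y - 1) \<and> 0 < y"
  shows "lattice_edge (Complex (real x) (real y)) (Complex (real x') (real y'))"
  using assms by (auto simp: lattice_edge_def gaussian_def cmod_def of_nat_diff)

lemma lattice_edge_comb: "lattice_edge (comb q h t n) (comb q h t (Suc n))"
proof -
  obtain x y where xy: "comb_coords q h t n = (x, y)"
    "comb_coords q h t (Suc n) \<in> {(x + 1, y), (x, y + 1)} \<or> comb_coords q h t (Suc n) = (x, y - 1) \<and> 0 < y"
    using comb_coords_Suc by blast
  obtain x' y' where xy': "comb_coords q h t (Suc n) = (x', y')" by fastforce
  show ?thesis unfolding comb_def xy(1) xy' prod.case
    using xy(2) unfolding xy' by (intro lattice_edge_Complex) auto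
qed

lemma inj_comb: "inj (comb q h t)"
proof (rule injI)
  fix n n' assume "comb q h t n = comb q h t n'"
  then have "comb_coords q h t n = comb_coords q h t n'"
    by (auto simp: comb_def split: prod.splits)
  then show "n = n'" using injD[OF inj_comb_coords] by blast
qed

lemma comb_in_gaussian: "comb q h t n \<in> gaussian"
  using lattice_edge_comb by (auto simp: lattice_edge_def)

lemma diamond_real_line:
  assumes "0 < m"
  shows "z \<in> diamond 0 (of_real m) \<longleftrightarrow> 2 * \<bar>Im z\<bar> \<le> Re z \<and> 2 * \<bar>Im z\<bar> \<le> m - Re z"
proof
  assume "z \<in> diamond 0 (of_real m)"
  then obtain w where w: "z = of_real m * w" "2 * \<bar>Im w\<bar> \<le> Re w" "2 * \<bar>Im w\<bar> \<le> 1 - Re w"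
    by (auto simp: diamond_def)
  have "m * (2 * \<bar>Im w\<bar>) \<le> m * Re w" "m * (2 * \<bar>Im w\<bar>) \<le> m * (1 - Re w)"
    using assms w by (intro mult_left_mono; simp)+
  then show "2 * \<bar>Im z\<bar> \<le> Re z \<and> 2 * \<bar>Im z\<bar> \<le> m - Re z"
    using assms by (simp add: w(1) abs_mult algebra_simps)
next
  assume z: "2 * \<bar>Im z\<bar> \<le> Re z \<and> 2 * \<bar>Im z\<bar> \<le> m - Re z"
  have "z / of_real m \<in> {w. 2 * \<bar>Im w\<bar> \<le> Re w \<and> 2 * \<bar>Im w\<bar> \<le> 1 - Re w}"
    using z assms by (simp add: divide_simps)
  then show "z \<in> diamond 0 (of_real m)"
    unfolding diamond_def using assms by (intro image_eqI[of _ _ "z / of_real m"]) auto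
qed

lemma diamond_on_axis:
  assumes "n + 1 \<le> m"
  shows "diamond (of_nat n) (of_nat (Suc n)) \<subseteq> diamond 0 (of_nat m)"
proof
  fix z assume "z \<in> diamond (of_nat n) (of_nat (Suc n))"
  then obtain w where w: "z = of_nat n + w" "2 * \<bar>Im w\<bar> \<le> Re w" "2 * \<bar>Im w\<bar> \<le> 1 - Re w"
    by (auto simp: diamond_def)
  have "real n + 1 \<le> real m" using assms by linarith
  then have "2 * \<bar>Im z\<bar> \<le> Re z \<and> 2 * \<bar>Im z\<bar> \<le> real m - Re z" using w by auto
  then show "z \<in> diamond 0 (of_nat m)" using assms diamond_real_line[of "real m" z] by simp
qed

text \<open>
  The teeth start \<open>2 h + 1\<close> away from the origin and, as there are at most \<open>2 h + 1\<close> of them, end at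
  least that far from \<open>8 h + 4\<close>. So the diamonds over edges of teeth stay \<open>2 h + 3/4\<close> away from both
  ends, where the big diamond has half-height at least \<open>h + 3/8\<close>, while they rise only to \<open>h + 1/4\<close>.
\<close>

lemma diamond_comb:
  assumes t: "t \<le> 2 * h + 1" and n: "n < 8 * h + 4 + 2 * h * t"
  shows "diamond (comb (2 * h + 1) h t n) (comb (2 * h + 1) h t (Suc n)) \<subseteq> diamond 0 (of_nat (8 * h + 4))"
proof -
  define q where "q = 2 * h + 1"
  let ?e = "q + t * (2 * h + 2)"
  consider "n < q" | "q \<le> n" "n < ?e" | "?e \<le> n" by linarith
  then have "diamond (comb q h t n) (comb q h t (Suc n)) \<subseteq> diamond 0 (of_nat (8 * h + 4))"
  proof cases
    case 1
    have "comb_coords q h t n = (n, 0)" using 1 by (simp add: comb_coords_def)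
    moreover have "comb_coords q h t (Suc n) = (Suc n, 0)"
    proof (cases "Suc n = q")
      case True
      then show ?thesis using comb_coords_up[of 0 t 0 h q] comb_coords_after[of q h t 0] by (cases "t = 0") auto
    qed (use 1 in \<open>simp add: comb_coords_def\<close>)
    ultimately show ?thesis using diamond_on_axis[of n "8 * h + 4"] 1 by (simp add: comb_def q_def Complex_eq)
  next
    case 2
    obtain x y where xy: "comb_coords q h t n = (x, y)" by fastforce
    obtain x' y' where xy': "comb_coords q h t (Suc n) = (x', y')" by fastforce
    have r: "q \<le> x" "x \<le> q + 2 * t" "y \<le> h" "q \<le> x'" "x' \<le> q + 2 * t" "y' \<le> h"
      using comb_coords_range[OF _ _ xy] comb_coords_range[OF _ _ xy'] 2 by auto
    have r': "2 * real h + 1 \<le> min (real x) (real x')" "max (real x) (real x') \<le> 6 * real h + 3"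
      "0 \<le> min (real y) (real y')" "max (real y) (real y') \<le> real h"
      using r t by (auto simp: q_def)
    have e: "lattice_edge (Complex (real x) (real y)) (Complex (real x') (real y'))"
      using lattice_edge_comb[of q h t n] by (simp add: comb_def xy xy')
    show ?thesis
    proof
      fix z assume "z \<in> diamond (comb q h t n) (comb q h t (Suc n))"
      then have z: "z \<in> diamond (Complex (real x) (real y)) (Complex (real x') (real y'))" by (simp add: comb_def xy xy')
      have "2 * real h + 3/4 \<le> Re z" "Re z \<le> 6 * real h + 13/4" "- (1/4) \<le> Im z" "Im z \<le> real h + 1/4"
        using diamond_near(5-8)[OF e z] r' unfolding complex.sel by linarith+
      then have "2 * \<bar>Im z\<bar> \<le> Re z \<and> 2 * \<bar>Im z\<bar> \<le> real (8 * h + 4) - Re z" by (auto simp: abs_if)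
      then show "z \<in> diamond 0 (of_nat (8 * h + 4))" using diamond_real_line[of "real (8 * h + 4)" z] by simp
    qed
  next
    case 3
    define l where "l = n - ?e"
    have l: "n = ?e + l" using 3 by (simp add: l_def)
    have "comb_coords q h t n = (q + 2 * t + l, 0)" "comb_coords q h t (Suc n) = (Suc (q + 2 * t + l), 0)"
      using comb_coords_after[of q h t l] comb_coords_after[of q h t "Suc l"] l by simp_all
    moreover have "q + 2 * t + l + 1 \<le> 8 * h + 4" using n l by (simp add: q_def algebra_simps)
    ultimately show ?thesis using diamond_on_axis[of "q + 2 * t + l" "8 * h + 4"] by (simp add: comb_def Complex_eq)
  qed
  then show ?thesis by (simp add: q_def)
qed

lemma comb_ends:
  assumes t: "t \<le> 2 * h + 1"
  shows "comb (2 * h + 1) h t 0 = 0" "comb (2 * h + 1) h t (8 * h + 4 + 2 * h * t) = of_nat (8 * h + 4)"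
proof -
  show "comb (2 * h + 1) h t 0 = 0" by (simp add: comb_def comb_coords_def zero_complex.code)
  define l where "l = (8 * h + 4) - (2 * h + 1) - 2 * t"
  have l: "8 * h + 4 + 2 * h * t = (2 * h + 1) + t * (2 * h + 2) + l" "2 * h + 1 + 2 * t + l = 8 * h + 4"
    using t by (auto simp: l_def algebra_simps)
  have "comb_coords (2 * h + 1) h t (8 * h + 4 + 2 * h * t) = (8 * h + 4, 0)"
    unfolding l(1) comb_coords_after l(2) ..
  then show "comb (2 * h + 1) h t (8 * h + 4 + 2 * h * t) = of_nat (8 * h + 4)"
    by (simp add: comb_def Complex_eq)
qed

section \<open>Cutting a loop into arcs of prescribed size\<close>

lemma subdivision_mono:
  assumes "\<And>i. i < N \<Longrightarrow> w i < (w (Suc i) :: real)" "i \<le> j" "j \<le> N"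
  shows "w i \<le> w j"
  using assms(2,3,1)
proof (induction j rule: dec_induct)
  case (step j)
  then show ?case using less_imp_le[of "w j" "w (Suc j)"] by fastforce
qed simp

context bounded_turning_loop
begin

lemma D_bounded: obtains M where "0 < M" "\<And>u v. D u v \<le> M"
proof -
  have "continuous_on {0..1} (\<lambda>t. D 0 t)" by (intro continuous_intros)
  then obtain M where M: "\<And>t. t \<in> {0..1} \<Longrightarrow> D 0 t \<le> M"
    using continuous_attains_sup[of "{0..1::real}" "\<lambda>t. D 0 t"]
    by (metis atLeastAtMost_iff compact_Icc empty_iff order_refl zero_le_one)
  have "D 0 v \<le> M" for v
  proof -
    obtain w where "\<gamma> w = \<gamma> v" "0 \<le> w" "w < 0 + 1" by (rule window)
    then show ?thesis using M[of w] by auto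
  qed
  then have "D u v \<le> 2 * M + 1" for u v
    using D_triangle[of u v 0] by (smt (verit) mdist_commute)
  moreover have "0 \<le> M" using M[of 0] by simp
  ultimately show ?thesis using that[of "2 * M + 1"] by simp
qed

text \<open>
  Uniform continuity on a compact square, transferred to the line by periodicity.
\<close>

lemma D_uniformly_small:
  assumes "0 < e"
  obtains \<delta> where "0 < \<delta>" "\<And>u v. \<bar>u - v\<bar> < \<delta> \<Longrightarrow> D u v < e"
proof -
  let ?K = "{-1..2::real} \<times> {-1..2::real}"
  have "uniformly_continuous_on ?K (\<lambda>p. D (fst p) (snd p))"
    by (intro compact_uniformly_continuous continuous_intros compact_Times) auto
  then obtain \<delta> where \<delta>: "0 < \<delta>" "\<And>p p'. \<lbrakk>p \<in> ?K; p' \<in> ?K; dist p' p < \<delta>\<rbrakk> \<Longrightarrow> dist (D (fst p') (snd p')) (D (fst p) (snd p)) < e"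
    unfolding uniformly_continuous_on_def using assms by metis
  show ?thesis
  proof
    show "0 < min \<delta> 1" using \<delta> by simp
    fix u v :: real assume uv: "\<bar>u - v\<bar> < min \<delta> 1"
    define n where "n = - \<lfloor>u\<rfloor>"
    have u: "0 \<le> u + n" "u + n < 1" by (auto simp: n_def) linarith
    have v: "-1 \<le> v + n" "v + n \<le> 2" using u uv by linarith+
    have "dist (D (u + n) (v + n)) (D (u + n) (u + n)) < e"
      using \<delta>(2)[of "(u + n, u + n)" "(u + n, v + n)"] u v uv
      by (simp add: dist_Pair_Pair dist_real_def abs_minus_commute)
    then show "D u v < e" by (simp add: periodic_int dist_real_def)
  qed
qed

text \<open>
  The diameter of the arc from \<open>s\<close> to \<open>t\<close>, monotone in the arc and subadditive.
\<close>

definition osc :: "real \<Rightarrow> real \<Rightarrow> real" where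
  "osc s t = (SUP p\<in>{s..t} \<times> {s..t}. D (fst p) (snd p))"

lemma bdd_above_D: "bdd_above ((\<lambda>p. D (fst p) (snd p)) ` P)"
proof -
  obtain M where "0 < M" "\<And>u v. D u v \<le> M" by (rule D_bounded) (rule that)
  then show ?thesis by (intro bdd_aboveI2[where M = M])
qed

lemma D_le_osc: "\<lbrakk>s \<le> x; x \<le> t; s \<le> y; y \<le> t\<rbrakk> \<Longrightarrow> D x y \<le> osc s t"
  unfolding osc_def using cSUP_upper[OF _ bdd_above_D, of "(x, y)" "{s..t} \<times> {s..t}"] by auto

lemma osc_least: "\<lbrakk>s \<le> t; \<And>x y. \<lbrakk>s \<le> x; x \<le> t; s \<le> y; y \<le> t\<rbrakk> \<Longrightarrow> D x y \<le> c\<rbrakk> \<Longrightarrow> osc s t \<le> c"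
  unfolding osc_def by (intro cSUP_least) auto

lemma osc_mono: "\<lbrakk>s' \<le> s; s \<le> t; t \<le> t'\<rbrakk> \<Longrightarrow> osc s t \<le> osc s' t'"
  by (intro osc_least D_le_osc) auto

lemma osc_nonneg: "s \<le> t \<Longrightarrow> 0 \<le> osc s t"
  using D_le_osc[of s s t s] by simp

lemma osc_self: "osc s s = 0"
  by (rule antisym) (auto intro!: osc_least osc_nonneg)

lemma osc_triangle:
  assumes "s \<le> u" "u \<le> t"
  shows "osc s t \<le> osc s u + osc u t"
proof (rule osc_least)
  fix x y assume xy: "s \<le> x" "x \<le> t" "s \<le> y" "y \<le> t"
  have *: "D x y \<le> osc s u + osc u t" if "s \<le> x" "x \<le> u" "u \<le> y" "y \<le> t" for x y
    using D_triangle[of x y u] D_le_osc[of s x u u] D_le_osc[of u u t y] that by simp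
  consider "x \<le> u" "y \<le> u" | "x \<le> u" "u \<le> y" | "u \<le> x" "y \<le> u" | "u \<le> x" "u \<le> y" by linarith
  then show "D x y \<le> osc s u + osc u t"
  proof cases
    case 1 then show ?thesis using D_le_osc[of s x u y] osc_nonneg[of u t] assms xy by simp
  next
    case 2 then show ?thesis using * xy by simp
  next
    case 3 then show ?thesis using *[of y x] xy by (simp add: mdist_commute)
  next
    case 4 then show ?thesis using D_le_osc[of u x t y] osc_nonneg[of s u] assms xy by simp
  qed
qed (use assms in simp)

lemma osc_turning:
  assumes "x \<le> s" "s \<le> t" "t \<le> y" "y \<le> x + 1/2"
  shows "osc s t \<le> B * D x y"
proof (rule osc_least[OF assms(2)])
  fix u v assume uv: "s \<le> u" "u \<le> t" "s \<le> v" "v \<le> t"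
  show "D u v \<le> B * D x y"
    using turning[of x u v y] turning[of x v u y] uv assms by (cases "u \<le> v") (auto simp: mdist_commute)
qed

lemma osc_shift: "osc (s + 1) (t + 1) = osc s t"
proof -
  have "(\<lambda>p. D (fst p) (snd p)) ` ({s + 1..t + 1} \<times> {s + 1..t + 1}) = (\<lambda>p. D (fst p) (snd p)) ` ({s..t} \<times> {s..t})"
  proof (intro equalityI subsetI)
    fix d assume "d \<in> (\<lambda>p. D (fst p) (snd p)) ` ({s + 1..t + 1} \<times> {s + 1..t + 1})"
    then obtain x y where "d = D x y" "x \<in> {s + 1..t + 1}" "y \<in> {s + 1..t + 1}" by auto
    then show "d \<in> (\<lambda>p. D (fst p) (snd p)) ` ({s..t} \<times> {s..t})"
      using periodic[of "x - 1", symmetric] periodic[of "y - 1", symmetric] by (intro image_eqI[of _ _ "(x - 1, y - 1)"]) auto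
  next
    fix d assume "d \<in> (\<lambda>p. D (fst p) (snd p)) ` ({s..t} \<times> {s..t})"
    then obtain x y where "d = D x y" "x \<in> {s..t}" "y \<in> {s..t}" by auto
    then show "d \<in> (\<lambda>p. D (fst p) (snd p)) ` ({s + 1..t + 1} \<times> {s + 1..t + 1})"
      using periodic[of x] periodic[of y] by (intro image_eqI[of _ _ "(x + 1, y + 1)"]) auto
  qed
  then show ?thesis by (simp add: osc_def)
qed

lemma osc_uniformly_small:
  assumes "0 < e"
  obtains \<delta> where "0 < \<delta>" "\<And>s t. \<lbrakk>s \<le> t; t - s < \<delta>\<rbrakk> \<Longrightarrow> osc s t < e"
proof -
  obtain \<delta> where \<delta>: "0 < \<delta>" "\<And>u v. \<bar>u - v\<bar> < \<delta> \<Longrightarrow> D u v < e / 2"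
    using D_uniformly_small[of "e / 2"] assms by auto
  have "osc s t \<le> e / 2" if "s \<le> t" "t - s < \<delta>" for s t
    using that by (intro osc_least less_imp_le[OF \<delta>(2)]) auto
  then show ?thesis using that \<delta>(1) assms by force
qed

lemma continuous_on_osc: "continuous_on {s..t} (osc s)"
  unfolding continuous_on_iff
proof (intro ballI allI impI)
  fix x e :: real assume x: "x \<in> {s..t}" and "0 < e"
  obtain \<delta> where \<delta>: "0 < \<delta>" "\<And>u v. \<lbrakk>u \<le> v; v - u < \<delta>\<rbrakk> \<Longrightarrow> osc u v < e"
    using osc_uniformly_small[OF \<open>0 < e\<close>] by blast
  have *: "\<bar>osc s u - osc s v\<bar> < e" if "s \<le> u" "u \<le> v" "v - u < \<delta>" for u v
    using osc_triangle[of s u v] osc_mono[of s s u v] \<delta>(2)[of u v] that by simp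
  have "dist (osc s y) (osc s x) < e" if "y \<in> {s..t}" "dist y x < \<delta>" for y
    using *[of x y] *[of y x] that x by (cases "x \<le> y") (auto simp: dist_real_def)
  then show "\<exists>d>0. \<forall>x'\<in>{s..t}. dist x' x < d \<longrightarrow> dist (osc s x') (osc s x) < e" using \<delta>(1) by blast
qed

text \<open>
  Cut off arcs of diameter exactly \<open>\<sigma>\<close> as long as the remaining arc has diameter at least \<open>2 \<sigma>\<close>. By
  subadditivity every cut lowers the diameter of the rest by at most \<open>\<sigma>\<close>, and it is only the last
  piece that may have diameter \<open>\<sigma>\<close> up to \<open>2 \<sigma>\<close>, so that there are at least \<open>n\<close> pieces. With \<open>n - 1\<close> pieces
  the planar model would fail: fewer than \<open>n\<close> edges of length \<open>1/n\<close> do not span an edge of length 1. Uniform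
  continuity bounds the parameter lengths of the pieces from below, so the process ends.
\<close>

lemma greedy_subdivision:
  assumes \<sigma>: "0 < \<sigma>" and st: "s \<le> t" and big: "\<sigma> \<le> osc s t" "real n * \<sigma> \<le> osc s t"
  shows "\<exists>N w. n \<le> N \<and> w 0 = s \<and> w N = t \<and>
    (\<forall>i<N. w i < w (Suc i) \<and> \<sigma> \<le> osc (w i) (w (Suc i)) \<and> osc (w i) (w (Suc i)) \<le> 2 * \<sigma>)"
proof -
  obtain \<delta> where \<delta>: "0 < \<delta>" "\<And>u v. \<lbrakk>u \<le> v; v - u < \<delta>\<rbrakk> \<Longrightarrow> osc u v < \<sigma>"
    using osc_uniformly_small[OF \<sigma>] by blast
  have "\<exists>N w. n \<le> N \<and> w 0 = s \<and> w N = t \<and>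
    (\<forall>i<N. w i < w (Suc i) \<and> \<sigma> \<le> osc (w i) (w (Suc i)) \<and> osc (w i) (w (Suc i)) \<le> 2 * \<sigma>)"
    if "t - s < real k * \<delta>" "s \<le> t" "\<sigma> \<le> osc s t" "real n * \<sigma> \<le> osc s t" for k s n
    using that
  proof (induction k arbitrary: s n)
    case (Suc k)
    have "s \<noteq> t" using Suc.prems(3) \<sigma> by (auto simp: osc_self)
    then have lt: "s < t" using Suc.prems by simp
    show ?case
    proof (cases "osc s t < 2 * \<sigma>")
      case True
      then have "real n * \<sigma> < 2 * \<sigma>" using Suc.prems by linarith
      then have "n \<le> 1" using \<sigma> by simp
      then show ?thesis using True lt Suc.prems
        by (intro exI[of _ 1] exI[of _ "\<lambda>i. if i = 0 then s else t"]) auto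
    next
      case False
      obtain u where u: "s \<le> u" "u \<le> t" "osc s u = \<sigma>"
        using IVT'[of "osc s" s \<sigma> t] continuous_on_osc[of s t] Suc.prems \<sigma> osc_self[of s] by auto
      have su: "s < u" using u \<sigma> osc_self[of s] by (cases "s = u") auto
      have len: "\<delta> \<le> u - s" using \<delta>(2)[of s u] u by force
      have rest: "osc s t - \<sigma> \<le> osc u t" using osc_triangle[of s u t] u by simp
      have "\<exists>N w. n - 1 \<le> N \<and> w 0 = u \<and> w N = t \<and>
        (\<forall>i<N. w i < w (Suc i) \<and> \<sigma> \<le> osc (w i) (w (Suc i)) \<and> osc (w i) (w (Suc i)) \<le> 2 * \<sigma>)"
      proof (rule Suc.IH)
        show "t - u < real k * \<delta>" using Suc.prems(1) len by (simp add: algebra_simps)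
        show "\<sigma> \<le> osc u t" using rest False by simp
        then show "real (n - 1) * \<sigma> \<le> osc u t" using rest Suc.prems(4) \<sigma> by (cases n) (auto simp: algebra_simps)
      qed (rule u)
      then obtain N w where w: "n - 1 \<le> N" "w 0 = u" "w N = t"
        "\<And>i. i < N \<Longrightarrow> w i < w (Suc i) \<and> \<sigma> \<le> osc (w i) (w (Suc i)) \<and> osc (w i) (w (Suc i)) \<le> 2 * \<sigma>" by metis
      define w' where "w' i = (case i of 0 \<Rightarrow> s | Suc j \<Rightarrow> w j)" for i
      have "w' i < w' (Suc i) \<and> \<sigma> \<le> osc (w' i) (w' (Suc i)) \<and> osc (w' i) (w' (Suc i)) \<le> 2 * \<sigma>" if "i < Suc N" for i
        using that w(2,4) su u \<sigma> by (cases i) (auto simp: w'_def)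
      then show ?thesis using w by (intro exI[of _ "Suc N"] exI[of _ w']) (auto simp: w'_def)
    qed
  qed simp
  moreover obtain k where "(t - s) / \<delta> < real k" using reals_Archimedean2 by blast
  then have "t - s < real k * \<delta>" using \<delta>(1) by (simp add: divide_simps)
  ultimately show ?thesis using st big by blast
qed

text \<open>
  By bounded turning, the starting points of the pieces are \<open>\<sigma> / B\<close>-separated: between any two of
  them lies a whole piece.
\<close>

lemma subdivision_card:
  assumes count: "\<And>S y r s. \<lbrakk>finite S; S \<subseteq> range \<gamma>; separated_set Z s S; 0 < s; s \<le> r; y \<in> range \<gamma>;
        \<And>x. x \<in> S \<Longrightarrow> mdist Z y x < r\<rbrakk> \<Longrightarrow> real (card S) \<le> c * (r / s) powr Q"
    and w: "w 0 = s" "w N = t" "\<And>i. i < N \<Longrightarrow> w i < w (Suc i) \<and> \<sigma> \<le> osc (w i) (w (Suc i))"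
    and t: "t \<le> s + 1/2" and \<sigma>: "0 < \<sigma>" and r: "osc s t < r" "\<sigma> \<le> r"
  shows "real N \<le> c * (r * B / \<sigma>) powr Q"
proof -
  have mono: "w i \<le> w j" if "i \<le> j" "j \<le> N" for i j
    using subdivision_mono[of N w i j] w that by blast
  have far: "\<sigma> / B \<le> D (w i) (w j)" if "i < j" "j < N" for i j
  proof -
    have "\<sigma> \<le> osc (w i) (w (Suc i))" using w(3) that by simp
    also have "\<dots> \<le> B * D (w i) (w j)"
      using mono[of 0 i] mono[of i "Suc i"] mono[of "Suc i" j] mono[of j N] that w t by (intro osc_turning) auto
    finally show ?thesis using B_pos by (simp add: divide_simps mult.commute)
  qed
  have far': "\<sigma> / B \<le> D (w i) (w j)" if "i \<noteq> j" "i < N" "j < N" for i j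
    using far[of i j] far[of j i] that by (cases "i < j") (auto simp: mdist_commute)
  have pos: "0 < \<sigma> / B" using \<sigma> B_pos by simp
  have inj: "inj_on (\<lambda>i. \<gamma> (w i)) {..<N}"
  proof (rule inj_onI)
    fix i j assume ij: "i \<in> {..<N}" "j \<in> {..<N}" "\<gamma> (w i) = \<gamma> (w j)"
    show "i = j"
    proof (rule ccontr)
      assume "i \<noteq> j"
      then have "\<sigma> / B \<le> D (w i) (w j)" using ij(1,2) by (intro far') auto
      moreover have "D (w i) (w j) = 0" unfolding ij(3) by simp
      ultimately show False using pos by simp
    qed
  qed
  have "real (card ((\<lambda>i. \<gamma> (w i)) ` {..<N})) \<le> c * (r / (\<sigma> / B)) powr Q"
  proof (rule count[where y = "\<gamma> s"])
    show "separated_set Z (\<sigma> / B) ((\<lambda>i. \<gamma> (w i)) ` {..<N})"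
      unfolding separated_set_def using far' by (auto simp: inj_on_eq_iff[OF inj])
    show "0 < \<sigma> / B" by (rule pos)
    have "\<sigma> / B \<le> \<sigma> / 1" using \<sigma> B_ge_1 by (intro divide_left_mono) auto
    then show "\<sigma> / B \<le> r" using r by simp
    fix x assume "x \<in> (\<lambda>i. \<gamma> (w i)) ` {..<N}"
    then obtain i where i: "x = \<gamma> (w i)" "i < N" by auto
    have "D s (w i) \<le> osc s t" using mono[of 0 i] mono[of i N] i w by (intro D_le_osc) auto
    then show "mdist Z (\<gamma> s) x < r" using r i by simp
  qed auto
  then show ?thesis using inj by (simp add: card_image)
qed

text \<open>
  Join the first \<open>k\<close> pairs of consecutive pieces.
\<close>

lemma merge_subdivision:
  assumes w: "w 0 = s" "w N = t"
      "\<And>i. i < N \<Longrightarrow> w i < w (Suc i) \<and> \<sigma> \<le> osc (w i) (w (Suc i)) \<and> osc (w i) (w (Suc i)) \<le> 2 * \<sigma>"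
    and k: "2 * k \<le> N" and \<sigma>: "0 \<le> \<sigma>"
  obtains v where "v 0 = s" "v (N - k) = t"
    "\<And>i. i < N - k \<Longrightarrow> v i < v (Suc i) \<and> \<sigma> \<le> osc (v i) (v (Suc i)) \<and> osc (v i) (v (Suc i)) \<le> 4 * \<sigma>"
proof
  define v where "v i = w (i + min i k)" for i
  show "v 0 = s" using w by (simp add: v_def)
  show "v (N - k) = t" using w k by (simp add: v_def)
  fix i assume i: "i < N - k"
  show "v i < v (Suc i) \<and> \<sigma> \<le> osc (v i) (v (Suc i)) \<and> osc (v i) (v (Suc i)) \<le> 4 * \<sigma>"
  proof (cases "i < k")
    case True
    have v: "v i = w (2 * i)" "v (Suc i) = w (Suc (Suc (2 * i)))" using True by (auto simp: v_def mult_2)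
    have w1: "w (2 * i) < w (Suc (2 * i)) \<and> \<sigma> \<le> osc (w (2 * i)) (w (Suc (2 * i))) \<and> osc (w (2 * i)) (w (Suc (2 * i))) \<le> 2 * \<sigma>"
      using w(3)[of "2 * i"] True k by simp
    have w2: "w (Suc (2 * i)) < w (Suc (Suc (2 * i))) \<and> osc (w (Suc (2 * i))) (w (Suc (Suc (2 * i)))) \<le> 2 * \<sigma>"
      using w(3)[of "Suc (2 * i)"] True k by simp
    show ?thesis
      using w1 w2 osc_triangle[of "w (2 * i)" "w (Suc (2 * i))" "w (Suc (Suc (2 * i)))"]
        osc_mono[of "w (2 * i)" "w (2 * i)" "w (Suc (2 * i))" "w (Suc (Suc (2 * i)))"] unfolding v by linarith
  next
    case False
    then have v: "v i = w (i + k)" "v (Suc i) = w (Suc (i + k))" by (auto simp: v_def)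
    show ?thesis using w(3)[of "i + k"] i \<sigma> unfolding v by linarith
  qed
qed

text \<open>
  Combs with teeth of height \<open>h\<close> have \<open>8 h + 4 + 2 h k\<close> edges. The number of pieces of a greedy
  subdivision is lowered to the next number of this form by merging fewer than \<open>2 h\<close> pairs, which are
  available since there are at least \<open>8 h + 4\<close> pieces. It is at most \<open>4 h\<^sup>2\<close>, so that \<open>k \<le> 2 h\<close>.
\<close>

lemma comb_subdivision:
  assumes count: "\<And>S y r s. \<lbrakk>finite S; S \<subseteq> range \<gamma>; separated_set Z s S; 0 < s; s \<le> r; y \<in> range \<gamma>;
        \<And>x. x \<in> S \<Longrightarrow> mdist Z y x < r\<rbrakk> \<Longrightarrow> real (card S) \<le> c * (r / s) powr Q"
    and A: "1 \<le> A" and h: "1 \<le> h"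
    and room: "c * (2 * A * real (8 * h + 4) * B) powr Q \<le> 4 * (real h)\<^sup>2"
    and \<sigma>: "0 < \<sigma>" and st: "s \<le> t" "t \<le> s + 1/2"
    and osc: "real (8 * h + 4) * \<sigma> \<le> osc s t" "osc s t \<le> A * (real (8 * h + 4) * \<sigma>)"
  obtains k w where "k \<le> 2 * h + 1" "w 0 = s" "w (8 * h + 4 + 2 * h * k) = t"
    "\<And>i. i < 8 * h + 4 + 2 * h * k \<Longrightarrow>
      w i < w (Suc i) \<and> \<sigma> \<le> osc (w i) (w (Suc i)) \<and> osc (w i) (w (Suc i)) \<le> 4 * \<sigma>"
proof -
  define m where "m = 8 * h + 4"
  have m: "1 \<le> m" by (simp add: m_def)
  have "1 * \<sigma> \<le> real m * \<sigma>" using \<sigma> m by (intro mult_right_mono) auto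
  then have "\<sigma> \<le> osc s t" using osc(1) by (simp add: m_def)
  then obtain N w where w: "m \<le> N" "w 0 = s" "w N = t"
    "\<And>i. i < N \<Longrightarrow> w i < w (Suc i) \<and> \<sigma> \<le> osc (w i) (w (Suc i)) \<and> osc (w i) (w (Suc i)) \<le> 2 * \<sigma>"
    using greedy_subdivision[OF \<sigma> st(1), of m] osc(1) unfolding m_def by metis
  define r where "r = 2 * A * real m * \<sigma>"
  have Am: "1 \<le> A * real m" using A m mult_mono[of 1 A 1 "real m"] by simp
  have "0 < A * (real m * \<sigma>)" using A m \<sigma> by simp
  then have "osc s t < r" using osc(2) by (simp add: r_def m_def algebra_simps)
  moreover have "\<sigma> \<le> r" using Am \<sigma> mult_right_mono[of 1 "A * real m" \<sigma>] by (simp add: r_def)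
  ultimately have "real N \<le> c * (r * B / \<sigma>) powr Q"
    using w(4) st(2) \<sigma> by (intro subdivision_card[OF count w(2,3)]) auto
  also have "r * B / \<sigma> = 2 * A * real m * B" using \<sigma> by (simp add: r_def)
  also have "c * (2 * A * real m * B) powr Q \<le> real (4 * h * h)" using room by (simp add: m_def power2_eq_square)
  finally have N: "N \<le> 4 * h * h" by linarith
  define k where "k = (N - m) div (2 * h)"
  \<comment> \<open>The number of pairs that have to be merged.\<close>
  define e where "e = (N - m) mod (2 * h)"
  have "N - m = 2 * h * k + e" unfolding k_def e_def by simp
  then have Nke: "N - e = m + 2 * h * k" "e \<le> N" using w(1) by linarith+
  have "e < 2 * h" unfolding e_def using h by (intro mod_less_divisor) simp
  have "k \<le> (4 * h * h) div (2 * h)" unfolding k_def using N by (intro div_le_mono) auto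
  also have "\<dots> = 2 * h" using h by simp
  finally have k: "k \<le> 2 * h + 1" by simp
  have "2 * e \<le> N" using \<open>e < 2 * h\<close> w(1) by (simp add: m_def)
  then obtain v where "v 0 = s" "v (N - e) = t"
    "\<And>i. i < N - e \<Longrightarrow> v i < v (Suc i) \<and> \<sigma> \<le> osc (v i) (v (Suc i)) \<and> osc (v i) (v (Suc i)) \<le> 4 * \<sigma>"
    using merge_subdivision[OF w(2-4), of e] \<sigma> by auto
  then show ?thesis using that[OF k] Nke(1) unfolding m_def by metis
qed

lemma finite_net:
  assumes "0 < e"
  obtains P where "finite P" "P \<subseteq> range \<gamma>" "\<And>x. x \<in> range \<gamma> \<Longrightarrow> \<exists>p\<in>P. mdist Z p x < e"
proof -
  obtain \<delta> where \<delta>: "0 < \<delta>" "\<And>u v. \<bar>u - v\<bar> < \<delta> \<Longrightarrow> D u v < e" using D_uniformly_small[OF assms] by blast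
  obtain n :: nat where n: "1 / \<delta> < real n" using reals_Archimedean2 by blast
  have n0: "0 < n" using n \<delta>(1) by (cases n) (auto simp: divide_simps split: if_splits)
  show ?thesis
  proof
    let ?P = "(\<lambda>i. \<gamma> (real i / real n)) ` {..n}"
    show "finite ?P" "?P \<subseteq> range \<gamma>" by auto
    fix x assume "x \<in> range \<gamma>"
    then obtain u where u: "x = \<gamma> u" "0 \<le> u" "u < 1" using window[of _ 0] by (metis imageE add_0)
    define i where "i = nat \<lfloor>u * n\<rfloor>"
    have i: "real i \<le> u * n" "u * n < real i + 1" using u by (auto simp: i_def)
    have "u * real n \<le> 1 * real n" using u by (intro mult_right_mono) auto
    then have "i \<le> n" using i by linarith
    moreover have "\<bar>real i / n - u\<bar> < \<delta>"
    proof -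
      have "\<bar>real i / n - u\<bar> \<le> 1 / n" using i n0 by (simp add: abs_if divide_simps)
      also have "\<dots> < \<delta>" using n \<delta>(1) n0 by (simp add: divide_simps mult.commute)
      finally show ?thesis .
    qed
    ultimately show "\<exists>p\<in>?P. mdist Z p x < e" using \<delta>(2) u(1) by blast
  qed
qed

end

section \<open>The planar model of a loop\<close>

text \<open>
  An arc of the loop, from \<open>lo\<close> to \<open>hi\<close>, with the edge of the polygon assigned to it. At level \<open>k\<close>
  the edge is recorded in units of the mesh of that level, so that its end points are Gaussian
  integers.
\<close>

datatype node = Node (lo: real) (hi: real) (src: complex) (tgt: complex)

text \<open>
  The functions \<open>teeth\<close> and \<open>cut\<close> choose, for every arc that may occur, a subdivision that matches a
  comb. The arcs of level \<open>k\<close> will have diameter between \<open>a0 / (8 h + 4)\<^sup>k\<close> and \<open>A\<close> times this; the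
  quarters of the loop are the arcs of level 0.
\<close>

locale refinable_loop = bounded_turning_loop +
  fixes h :: nat and A a0 :: real
    and teeth :: "real \<Rightarrow> real \<Rightarrow> real \<Rightarrow> nat"
    and cut :: "real \<Rightarrow> real \<Rightarrow> real \<Rightarrow> nat \<Rightarrow> real"
  assumes A: "4 \<le> A" and a0: "0 < a0"
    and quarters: "j < 4 \<Longrightarrow> a0 \<le> osc (real j / 4) (real (Suc j) / 4)"
      "j < 4 \<Longrightarrow> osc (real j / 4) (real (Suc j) / 4) \<le> A * a0"
    and cut: "\<lbrakk>0 < \<sigma>; s \<le> t; t \<le> s + 1/2; real (8 * h + 4) * \<sigma> \<le> osc s t;
        osc s t \<le> A * (real (8 * h + 4) * \<sigma>)\<rbrakk> \<Longrightarrow>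
      teeth \<sigma> s t \<le> 2 * h + 1 \<and> cut \<sigma> s t 0 = s \<and> cut \<sigma> s t (8 * h + 4 + 2 * h * teeth \<sigma> s t) = t \<and>
      (\<forall>i < 8 * h + 4 + 2 * h * teeth \<sigma> s t. cut \<sigma> s t i < cut \<sigma> s t (Suc i) \<and>
        \<sigma> \<le> osc (cut \<sigma> s t i) (cut \<sigma> s t (Suc i)) \<and> osc (cut \<sigma> s t i) (cut \<sigma> s t (Suc i)) \<le> 4 * \<sigma>)"
begin

definition ratio :: nat where "ratio = 8 * h + 4"

definition scale :: "nat \<Rightarrow> real" where "scale k = a0 / real ratio ^ k"

definition pieces :: "nat \<Rightarrow> node \<Rightarrow> nat" where
  "pieces k I = ratio + 2 * h * teeth (scale (Suc k)) (lo I) (hi I)"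

definition breakpoint :: "nat \<Rightarrow> node \<Rightarrow> nat \<Rightarrow> real" where
  "breakpoint k I = cut (scale (Suc k)) (lo I) (hi I)"

definition vertex :: "nat \<Rightarrow> node \<Rightarrow> nat \<Rightarrow> complex" where
  "vertex k I i = of_nat ratio * src I +
    (tgt I - src I) * comb (2 * h + 1) h (teeth (scale (Suc k)) (lo I) (hi I)) i"

definition child :: "nat \<Rightarrow> node \<Rightarrow> nat \<Rightarrow> node" where
  "child k I i = Node (breakpoint k I i) (breakpoint k I (Suc i)) (vertex k I i) (vertex k I (Suc i))"

text \<open>
  The polygon of level 0 is the boundary of the unit square.
\<close>

primrec nodes :: "nat \<Rightarrow> node set" where
  "nodes 0 = {Node 0 (1/4) 0 1, Node (1/4) (1/2) 1 (1 + \<i>),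
    Node (1/2) (3/4) (1 + \<i>) \<i>, Node (3/4) 1 \<i> 0}"
| "nodes (Suc k) = (\<Union>I\<in>nodes k. child k I ` {..<pieces k I})"

definition good_node :: "nat \<Rightarrow> node \<Rightarrow> bool" where
  "good_node k I \<longleftrightarrow> 0 \<le> lo I \<and> lo I < hi I \<and> hi I \<le> 1 \<and> hi I \<le> lo I + 1/4 \<and>
    lattice_edge (src I) (tgt I) \<and> scale k \<le> osc (lo I) (hi I) \<and> osc (lo I) (hi I) \<le> A * scale k"

definition apart :: "nat \<Rightarrow> node \<Rightarrow> node \<Rightarrow> bool" where
  "apart k I J \<longleftrightarrow> (\<forall>x\<in>{lo I..hi I}. \<forall>y\<in>{lo J..hi J}. scale k \<le> B * D x y)"

text \<open>
  The invariant of the construction: the polygon is simple, and its edges are incident in the same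
  way as the arcs. The alternative \<open>hi I = lo J + 1\<close> is for the arcs before and after the base point.
\<close>

definition good_pair :: "nat \<Rightarrow> node \<Rightarrow> node \<Rightarrow> bool" where
  "good_pair k I J \<longleftrightarrow> src I \<noteq> src J \<and> tgt I \<noteq> tgt J \<and> \<not> (tgt I = src J \<and> tgt J = src I) \<and>
    (tgt I = src J \<longrightarrow> hi I = lo J \<or> hi I = lo J + 1) \<and>
    (tgt I \<noteq> src J \<and> tgt J \<noteq> src I \<longrightarrow> apart k I J)"

lemma ratio_pos: "0 < ratio" "1 \<le> real ratio"
  by (auto simp: ratio_def)

lemma scale_pos: "0 < scale k"
  using a0 ratio_pos by (simp add: scale_def)

lemma scale_Suc: "real ratio * scale (Suc k) = scale k"
  using ratio_pos by (simp add: scale_def)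

lemma scale_Suc_le: "scale (Suc k) \<le> scale k"
  using scale_Suc[of k] scale_pos[of "Suc k"] ratio_pos mult_right_mono[of 1 "real ratio" "scale (Suc k)"] by simp

lemma apart_sym: "apart k I J \<longleftrightarrow> apart k J I"
  unfolding apart_def by (metis mdist_commute)

context
  fixes k :: nat and I :: node
  assumes I: "good_node k I"
begin

lemma teeth_le: "teeth (scale (Suc k)) (lo I) (hi I) \<le> 2 * h + 1"
  and break_ends: "breakpoint k I 0 = lo I" "breakpoint k I (pieces k I) = hi I"
  and break_piece: "i < pieces k I \<Longrightarrow> breakpoint k I i < breakpoint k I (Suc i)"
    "i < pieces k I \<Longrightarrow> scale (Suc k) \<le> osc (breakpoint k I i) (breakpoint k I (Suc i))"
    "i < pieces k I \<Longrightarrow> osc (breakpoint k I i) (breakpoint k I (Suc i)) \<le> 4 * scale (Suc k)"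
  using cut[OF scale_pos[of "Suc k"], of "lo I" "hi I"] I scale_Suc[of k]
  unfolding good_node_def pieces_def breakpoint_def ratio_def by (auto simp: mult.assoc)

lemma pieces_pos: "0 < pieces k I"
  using ratio_pos by (simp add: pieces_def)

lemma break_mono: "\<lbrakk>i \<le> j; j \<le> pieces k I\<rbrakk> \<Longrightarrow> breakpoint k I i \<le> breakpoint k I j"
  by (rule subdivision_mono[of "pieces k I"]) (use break_piece(1) in auto)

lemma break_range: "i \<le> pieces k I \<Longrightarrow> lo I \<le> breakpoint k I i \<and> breakpoint k I i \<le> hi I"
  using break_mono[of 0 i] break_mono[of i "pieces k I"] break_ends by auto

lemma vertex_ends: "vertex k I 0 = of_nat ratio * src I" "vertex k I (pieces k I) = of_nat ratio * tgt I"
  using comb_ends[OF teeth_le] by (simp_all add: vertex_def pieces_def ratio_def algebra_simps)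

lemma edge_I: "lattice_edge (src I) (tgt I)"
  using I by (simp add: good_node_def)

lemma src_tgt: "src I \<noteq> tgt I"
  using edge_I by (auto simp: lattice_edge_def)

lemma inj_vertex: "inj (vertex k I)"
  using src_tgt inj_comb by (auto simp: vertex_def inj_def)

lemma edge_child: "lattice_edge (vertex k I i) (vertex k I (Suc i))"
proof -
  let ?c = "comb (2 * h + 1) h (teeth (scale (Suc k)) (lo I) (hi I))"
  have g: "src I \<in> gaussian" "tgt I \<in> gaussian" "norm (tgt I - src I) = 1"
    using edge_I by (auto simp: lattice_edge_def)
  have c: "norm (?c (Suc i) - ?c i) = 1" using lattice_edge_comb by (auto simp: lattice_edge_def)
  have "vertex k I (Suc i) - vertex k I i = (tgt I - src I) * (?c (Suc i) - ?c i)"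
    by (simp add: vertex_def algebra_simps)
  then have "norm (vertex k I (Suc i) - vertex k I i) = 1" using g c by (simp add: norm_mult)
  moreover have "vertex k I j \<in> gaussian" for j
    unfolding vertex_def using g by (intro gaussian_arith gaussian_of_nat comb_in_gaussian)
  ultimately show ?thesis by (simp add: lattice_edge_def)
qed

lemma diamond_child:
  assumes "i < pieces k I"
  shows "diamond (vertex k I i) (vertex k I (Suc i)) \<subseteq> (\<lambda>z. of_nat ratio * z) ` diamond (src I) (tgt I)"
proof -
  let ?c = "comb (2 * h + 1) h (teeth (scale (Suc k)) (lo I) (hi I))"
  let ?f = "\<lambda>z. of_nat ratio * src I + (tgt I - src I) * z"
  have "diamond (vertex k I i) (vertex k I (Suc i)) = ?f ` diamond (?c i) (?c (Suc i))"
    unfolding vertex_def by (rule diamond_affine)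
  also have "\<dots> \<subseteq> ?f ` diamond 0 (of_nat ratio)"
    using diamond_comb[OF teeth_le, of i] assms by (intro image_mono) (simp add: pieces_def ratio_def)
  also have "\<dots> = diamond (?f 0) (?f (of_nat ratio))" by (rule diamond_affine[symmetric])
  also have "\<dots> = diamond (of_nat ratio * src I) (of_nat ratio * tgt I)" by (simp add: algebra_simps)
  also have "\<dots> = (\<lambda>z. of_nat ratio * z) ` diamond (src I) (tgt I)" by (rule diamond_scale)
  finally show ?thesis .
qed

lemma vertex_in_diamond:
  assumes "i \<le> pieces k I"
  shows "vertex k I i \<in> (\<lambda>z. of_nat ratio * z) ` diamond (src I) (tgt I)"
proof (cases "i < pieces k I")
  case True
  then show ?thesis using diamond_child diamond_ends(1) by blast
next
  case False
  then have "vertex k I i = of_nat ratio * tgt I" using assms vertex_ends by simp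
  then show ?thesis using diamond_ends(2) by blast
qed

lemma good_child:
  assumes "i < pieces k I"
  shows "good_node (Suc k) (child k I i)"
proof -
  have "4 * scale (Suc k) \<le> A * scale (Suc k)" using A scale_pos by (intro mult_right_mono) (auto intro: less_imp_le)
  then show ?thesis
    using break_range[of i] break_range[of "Suc i"] break_piece[OF assms] edge_child I assms
    unfolding good_node_def child_def node.sel by auto
qed

lemma child_covers:
  assumes "x \<in> {lo I..hi I}"
  shows "\<exists>i < pieces k I. x \<in> {lo (child k I i)..hi (child k I i)}"
proof -
  have "\<exists>i<N. breakpoint k I i \<le> x \<and> x \<le> breakpoint k I (Suc i)" if "0 < N" "breakpoint k I 0 \<le> x" "x \<le> breakpoint k I N" for N
    using that
  proof (induction N)
    case (Suc N)
    show ?case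
    proof (cases "breakpoint k I N \<le> x")
      case True then show ?thesis using Suc.prems by blast
    next
      case False
      then have "N \<noteq> 0" using Suc.prems by (cases N) auto
      then show ?thesis using Suc False by (meson less_SucI linear not_gr_zero)
    qed
  qed simp
  from this[OF pieces_pos] show ?thesis using assms break_ends by (auto simp: child_def)
qed

text \<open>
  Between two pieces of the same arc that are not consecutive there is a further piece; bounded
  turning then keeps them apart.
\<close>

lemma good_siblings:
  assumes i: "i < pieces k I" and j: "j < pieces k I" and ne: "i \<noteq> j"
  shows "good_pair (Suc k) (child k I i) (child k I j)"
proof -
  have ap: "apart (Suc k) (child k I i) (child k I j)" if "Suc i < j" "j < pieces k I" for i j
    unfolding apart_def
  proof (intro ballI)
    fix x y assume x: "x \<in> {lo (child k I i)..hi (child k I i)}" and y: "y \<in> {lo (child k I j)..hi (child k I j)}"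
    have "scale (Suc k) \<le> osc (breakpoint k I (Suc i)) (breakpoint k I (Suc (Suc i)))"
      using break_piece(2) that by simp
    also have "\<dots> \<le> B * D x y"
      using x y that break_piece(1)[of "Suc i"] break_mono[of "Suc (Suc i)" j] break_range[of i] break_range[of "Suc j"] I
      by (intro osc_turning) (auto simp: child_def good_node_def)
    finally show "scale (Suc k) \<le> B * D x y" .
  qed
  have "apart (Suc k) (child k I i) (child k I j)" if "Suc i \<noteq> j" "Suc j \<noteq> i"
    using ap[of i j] ap[of j i] i j ne that apart_sym by (meson linorder_neqE_nat Suc_lessI)
  then show ?thesis
    using ne unfolding good_pair_def child_def node.sel inj_eq[OF inj_vertex] by auto
qed

end

text \<open>
  New vertices lie in the diamonds of the old edges. These meet at most in a common end point, and
  an injective path passes through its end points only at its beginning and at its end.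
\<close>

lemma vertex_meet:
  assumes IJ: "good_node k I" "good_node k J" "good_pair k I J"
    and ij: "i \<le> pieces k I" "j \<le> pieces k J" and eq: "vertex k I i = vertex k J j"
  shows "i = 0 \<and> j = pieces k J \<and> src I = tgt J \<or> i = pieces k I \<and> j = 0 \<and> tgt I = src J"
proof -
  obtain z where z: "z \<in> diamond (src I) (tgt I)" "vertex k I i = of_nat ratio * z"
    using vertex_in_diamond[OF IJ(1) ij(1)] by blast
  obtain z' where z': "z' \<in> diamond (src J) (tgt J)" "vertex k J j = of_nat ratio * z'"
    using vertex_in_diamond[OF IJ(2) ij(2)] by blast
  have "z' = z" using eq z z' ratio_pos by simp
  moreover have "{src I, tgt I} \<noteq> {src J, tgt J}"
    using IJ(3) by (auto simp: good_pair_def doubleton_eq_iff)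
  ultimately have "z \<in> {src I, tgt I} \<inter> {src J, tgt J}"
    using diamond_meet[OF edge_I[OF IJ(1)] edge_I[OF IJ(2)]] z z' by blast
  then consider "z = src I" "src I = tgt J" | "z = tgt I" "tgt I = src J"
    using IJ(3) by (auto simp: good_pair_def)
  then show ?thesis
  proof cases
    case 1
    then have "vertex k I i = vertex k I 0" "vertex k J j = vertex k J (pieces k J)"
      using z eq vertex_ends[OF IJ(1)] vertex_ends[OF IJ(2)] by simp_all
    then show ?thesis using 1 injD[OF inj_vertex] IJ by blast
  next
    case 2
    then have "vertex k I i = vertex k I (pieces k I)" "vertex k J j = vertex k J 0"
      using z eq vertex_ends[OF IJ(1)] vertex_ends[OF IJ(2)] by simp_all
    then show ?thesis using 2 injD[OF inj_vertex] IJ by blast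
  qed
qed

text \<open>
  Unless the two pieces are the ones that touch at the joint, the last piece of the first arc or
  the first piece of the second arc lies between them.
\<close>

lemma apart_across_joint:
  assumes IJ: "good_node k I" "good_node k J" and joint: "hi I = lo J \<or> hi I = lo J + 1"
    and i: "i < pieces k I" and j: "j < pieces k J" and ne: "Suc i \<noteq> pieces k I \<or> j \<noteq> 0"
  shows "apart (Suc k) (child k I i) (child k J j)"
  unfolding apart_def
proof (intro ballI)
  fix x y0 assume x: "x \<in> {lo (child k I i)..hi (child k I i)}" and y0: "y0 \<in> {lo (child k J j)..hi (child k J j)}"
  \<comment> \<open>The joint may be the base point; then the second arc is shifted by one period.\<close>
  obtain e :: real where e: "e = 0 \<or> e = 1" "hi I = lo J + e" using joint by auto
  define y where "y = y0 + e"
  have D: "D x y = D x y0" and osc_e: "osc (s + e) (t + e) = osc s t" for s t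
    using e periodic osc_shift by (auto simp: y_def)
  have x': "breakpoint k I i \<le> x" "x \<le> breakpoint k I (Suc i)" "lo I \<le> x" "x \<le> hi I"
    using x break_range[OF IJ(1), of i] break_range[OF IJ(1), of "Suc i"] i by (auto simp: child_def)
  have y': "breakpoint k J j + e \<le> y" "hi I \<le> y" "y \<le> hi J + e"
    using y0 break_range[OF IJ(2), of j] break_range[OF IJ(2), of "Suc j"] j e by (auto simp: child_def y_def)
  have short: "y \<le> x + 1/2" using x' y' e IJ by (auto simp: good_node_def)
  show "scale (Suc k) \<le> B * D x y0"
  proof (cases "j = 0")
    case True
    define N where "N = pieces k I - 1"
    have N: "Suc N = pieces k I" "Suc i \<le> N" using ne i True by (auto simp: N_def)
    have "scale (Suc k) \<le> osc (breakpoint k I N) (breakpoint k I (Suc N))" using break_piece(2)[OF IJ(1), of N] N by simp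
    also have "\<dots> \<le> B * D x y"
      using x' y' short break_mono[OF IJ(1), of "Suc i" N] break_piece(1)[OF IJ(1), of N] N break_ends[OF IJ(1)]
      by (intro osc_turning) auto
    finally show ?thesis by (simp add: D)
  next
    case False
    have "scale (Suc k) \<le> osc (breakpoint k J 0) (breakpoint k J (Suc 0))"
      using break_piece(2)[OF IJ(2), of 0] pieces_pos[OF IJ(2)] by simp
    also have "\<dots> = osc (breakpoint k J 0 + e) (breakpoint k J (Suc 0) + e)" by (rule osc_e[symmetric])
    also have "\<dots> \<le> B * D x y"
      using x' y' short break_mono[OF IJ(2), of "Suc 0" j] break_piece(1)[OF IJ(2), of 0] False j break_ends[OF IJ(2)] e pieces_pos[OF IJ(2)]
      by (intro osc_turning) auto
    finally show ?thesis by (simp add: D)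
  qed
qed

lemma good_cousins:
  assumes IJ: "good_node k I" "good_node k J" "good_pair k I J" "good_pair k J I"
    and i: "i < pieces k I" and j: "j < pieces k J"
  shows "good_pair (Suc k) (child k I i) (child k J j)"
proof -
  note meet = vertex_meet[OF IJ(1-3)] and meet' = vertex_meet[OF IJ(2,1,4)]
  have 1: "vertex k I i \<noteq> vertex k J j" using meet[of i j] i j by auto
  have 2: "vertex k I (Suc i) \<noteq> vertex k J (Suc j)" using meet[of "Suc i" "Suc j"] i j by auto
  have joint: "Suc i = pieces k I \<and> j = 0 \<and> tgt I = src J" if "vertex k I (Suc i) = vertex k J j"
    using meet[of "Suc i" j] i j that by auto
  have joint': "Suc j = pieces k J \<and> i = 0 \<and> tgt J = src I" if "vertex k J (Suc j) = vertex k I i"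
    using meet'[of "Suc j" i] i j that by auto
  have 3: "\<not> (vertex k I (Suc i) = vertex k J j \<and> vertex k J (Suc j) = vertex k I i)"
    using joint joint' IJ(3) by (auto simp: good_pair_def)
  have 4: "breakpoint k I (Suc i) = breakpoint k J j \<or> breakpoint k I (Suc i) = breakpoint k J j + 1" if "vertex k I (Suc i) = vertex k J j"
    using joint[OF that] IJ(3) break_ends[OF IJ(1)] break_ends[OF IJ(2)] by (auto simp: good_pair_def)
  have 5: "apart (Suc k) (child k I i) (child k J j)"
    if ne: "vertex k I (Suc i) \<noteq> vertex k J j" "vertex k J (Suc j) \<noteq> vertex k I i"
  proof -
    consider "tgt I = src J" | "tgt J = src I" | "tgt I \<noteq> src J" "tgt J \<noteq> src I" by blast
    then show ?thesis
    proof cases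
      case 1
      then have "Suc i \<noteq> pieces k I \<or> j \<noteq> 0" using ne(1) vertex_ends[OF IJ(1)] vertex_ends[OF IJ(2)] by metis
      then show ?thesis using 1 IJ i j by (intro apart_across_joint) (auto simp: good_pair_def)
    next
      case 2
      then have "Suc j \<noteq> pieces k J \<or> i \<noteq> 0" using ne(2) vertex_ends[OF IJ(1)] vertex_ends[OF IJ(2)] by metis
      then show ?thesis using 2 IJ i j by (subst apart_sym, intro apart_across_joint) (auto simp: good_pair_def)
    next
      case 3
      then have "apart k I J" using IJ(3) by (simp add: good_pair_def)
      then show ?thesis
        using break_range[OF IJ(1), of i] break_range[OF IJ(1), of "Suc i"] break_range[OF IJ(2), of j] break_range[OF IJ(2), of "Suc j"]
          i j scale_Suc_le[of k]
        unfolding apart_def by (fastforce simp: child_def intro: order_trans)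
    qed
  qed
  show ?thesis unfolding good_pair_def using 1 2 3 4 5 by (simp add: child_def)
qed

lemma quarter_bounds:
  "a0 \<le> osc 0 (1/4)" "a0 \<le> osc (1/4) (1/2)" "a0 \<le> osc (1/2) (3/4)" "a0 \<le> osc (3/4) 1"
  "osc 0 (1/4) \<le> A * a0" "osc (1/4) (1/2) \<le> A * a0" "osc (1/2) (3/4) \<le> A * a0" "osc (3/4) 1 \<le> A * a0"
  using quarters[of 0] quarters[of 1] quarters[of 2] quarters[of 3] by simp_all

text \<open>
  The shorter way around the loop from \<open>x\<close> to \<open>y\<close> passes through a whole quarter.
\<close>

lemma opposite_quarters:
  shows "\<lbrakk>0 \<le> x; x \<le> 1/4; 1/2 \<le> y; y \<le> 3/4\<rbrakk> \<Longrightarrow> a0 \<le> B * D x y"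
    and "\<lbrakk>1/4 \<le> x; x \<le> 1/2; 3/4 \<le> y; y \<le> 1\<rbrakk> \<Longrightarrow> a0 \<le> B * D x y"
proof -
  have s: "osc 1 (5/4) = osc 0 (1/4)" using osc_shift[of 0 "1/4"] by simp
  have p: "D y (x + 1) = D x y" by (simp add: periodic mdist_commute)
  { assume "0 \<le> x" "x \<le> 1/4" "1/2 \<le> y" "y \<le> 3/4"
    then show "a0 \<le> B * D x y"
      using osc_turning[of x "1/4" "1/2" y] osc_turning[of y "3/4" 1 "x + 1"] quarter_bounds p
      by (cases "y \<le> x + 1/2") auto }
  { assume "1/4 \<le> x" "x \<le> 1/2" "3/4 \<le> y" "y \<le> 1"
    then show "a0 \<le> B * D x y"
      using osc_turning[of x "1/2" "3/4" y] osc_turning[of y 1 "5/4" "x + 1"] quarter_bounds p s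
      by (cases "y \<le> x + 1/2") auto }
qed

lemma good_root:
  shows "I \<in> nodes 0 \<Longrightarrow> good_node 0 I"
    and "\<lbrakk>I \<in> nodes 0; J \<in> nodes 0; I \<noteq> J\<rbrakk> \<Longrightarrow> good_pair 0 I J"
proof -
  assume "I \<in> nodes 0"
  then show "good_node 0 I"
    using quarter_bounds by (auto simp: good_node_def lattice_edge_def gaussian_def scale_def)
next
  assume "I \<in> nodes 0" "J \<in> nodes 0" "I \<noteq> J"
  moreover have 1: "apart 0 (Node 0 (1/4) 0 1) (Node (1/2) (3/4) (1 + \<i>) \<i>)"
    unfolding apart_def by (auto simp: scale_def intro!: opposite_quarters(1))
  moreover have 2: "apart 0 (Node (1/4) (1/2) 1 (1 + \<i>)) (Node (3/4) 1 \<i> 0)"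
    unfolding apart_def by (auto simp: scale_def intro!: opposite_quarters(2))
  moreover note 1[unfolded apart_sym[of 0 "Node 0 (1/4) 0 1"]] 2[unfolded apart_sym[of 0 "Node (1/4) (1/2) 1 (1 + \<i>)"]]
  ultimately show "good_pair 0 I J"
    by (auto simp: good_pair_def complex_eq_iff)
qed

lemma good_nodes:
  shows "I \<in> nodes k \<Longrightarrow> good_node k I"
    and "\<lbrakk>I \<in> nodes k; J \<in> nodes k; I \<noteq> J\<rbrakk> \<Longrightarrow> good_pair k I J"
proof (induction k arbitrary: I J)
  case 0
  { case 1 then show ?case by (rule good_root(1)) }
  { case 2 then show ?case by (rule good_root(2)) }
next
  case (Suc k)
  { case 1 then show ?case using Suc(1) good_child by auto }
  { case 2
    then obtain I0 J0 i j where ij: "I0 \<in> nodes k" "i < pieces k I0" "I = child k I0 i"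
      "J0 \<in> nodes k" "j < pieces k J0" "J = child k J0 j" by auto
    show ?case
    proof (cases "I0 = J0")
      case True
      then show ?thesis using ij 2(3) Suc(1) good_siblings by metis
    next
      case False
      then show ?thesis using ij Suc good_cousins by metis
    qed
  }
qed

text \<open>
  Choose in every arc containing \<open>x\<close> a piece containing \<open>x\<close>. The rescaled diamonds are compact and
  nested, hence have a common point.
\<close>

lemma address:
  assumes "x \<in> {0..1}"
  obtains \<I> p where "\<And>k. \<I> k \<in> nodes k" "\<And>k. x \<in> {lo (\<I> k)..hi (\<I> k)}"
    "\<And>k. of_nat ratio ^ k * p \<in> diamond (src (\<I> k)) (tgt (\<I> k))"
proof -
  define P where "P k I \<longleftrightarrow> I \<in> nodes k \<and> x \<in> {lo I..hi I}" for k I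
  define R where "R k I J \<longleftrightarrow> (\<exists>i<pieces k I. J = child k I i)" for k I J
  have "P 0 (Node 0 (1/4) 0 1) \<or> P 0 (Node (1/4) (1/2) 1 (1 + \<i>)) \<or>
      P 0 (Node (1/2) (3/4) (1 + \<i>) \<i>) \<or> P 0 (Node (3/4) 1 \<i> 0)"
    using assms by (auto simp: P_def)
  then have start: "\<exists>I. P 0 I" by blast
  have step: "\<exists>J. P (Suc k) J \<and> R k I J" if "P k I" for I k
  proof -
    have "good_node k I" "x \<in> {lo I..hi I}" "I \<in> nodes k" using that good_nodes(1) by (auto simp: P_def)
    then obtain i where "i < pieces k I" "x \<in> {lo (child k I i)..hi (child k I i)}" using child_covers by blast
    then show ?thesis using \<open>I \<in> nodes k\<close> by (intro exI[of _ "child k I i"]) (auto simp: P_def R_def)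
  qed
  from dependent_nat_choice[of P R, OF start step]
  obtain \<I> where \<I>: "\<And>k. P k (\<I> k)" "\<And>k. R k (\<I> k) (\<I> (Suc k))"
    by metis
  define S where "S k = (\<lambda>z. z / of_nat ratio ^ k) ` diamond (src (\<I> k)) (tgt (\<I> k))" for k
  have mk: "of_nat ratio ^ k \<noteq> (0 :: complex)" for k using ratio_pos by simp
  have cpt: "compact (S k)" for k
    unfolding S_def by (intro compact_continuous_image continuous_intros compact_diamond) (use mk in auto)
  have sub: "S (Suc k) \<subseteq> S k" for k
  proof
    fix z assume "z \<in> S (Suc k)"
    then obtain w where w: "w \<in> diamond (src (\<I> (Suc k))) (tgt (\<I> (Suc k)))" "z = w / of_nat ratio ^ Suc k" by (auto simp: S_def)
    obtain i where i: "i < pieces k (\<I> k)" "\<I> (Suc k) = child k (\<I> k) i" using \<I>(2)[of k] by (auto simp: R_def)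
    have "good_node k (\<I> k)" using \<I>(1) good_nodes(1) by (simp add: P_def)
    from diamond_child[OF this i(1)] w i obtain v where "v \<in> diamond (src (\<I> k)) (tgt (\<I> k))" "w = of_nat ratio * v"
      by (auto simp: child_def)
    then show "z \<in> S k" using w ratio_pos by (auto simp: S_def intro!: image_eqI[of _ _ v])
  qed
  have "closed (S k)" "bounded (S k)" for k
    using cpt compact_imp_closed compact_imp_bounded by blast+
  moreover have "S k \<noteq> {}" for k
    unfolding S_def using diamond_ends(1) by blast
  moreover have "S l \<subseteq> S k" if "k \<le> l" for k l using lift_Suc_antimono_le[of S, OF sub that] by simp
  ultimately obtain p where p: "\<And>k. p \<in> S k" using bounded_closed_nest[of S] by metis
  have "of_nat ratio ^ k * p \<in> diamond (src (\<I> k)) (tgt (\<I> k))" for k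
    using p[of k] mk[of k] by (auto simp: S_def)
  then show ?thesis using that[of \<I> p] \<I>(1) by (auto simp: P_def)
qed

text \<open>
  Compare both distances at the first level at which the chosen arcs neither coincide nor touch:
  at this level both are bounded below by a multiple of the mesh, and one level before they were
  bounded above. If there is no such level, both distances vanish.
\<close>

lemma planar_embedding:
  obtains H L where "1 \<le> L"
    "\<And>x y. \<lbrakk>x \<in> {0..1}; y \<in> {0..1}\<rbrakk> \<Longrightarrow> D x y / L \<le> norm (H x - H y :: complex) \<and> norm (H x - H y) \<le> L * D x y"
proof -
  have "\<forall>x\<in>{0..1}. \<exists>\<I> p. \<forall>k. \<I> k \<in> nodes k \<and> x \<in> {lo (\<I> k)..hi (\<I> k)} \<and>
      of_nat ratio ^ k * p \<in> diamond (src (\<I> k)) (tgt (\<I> k))"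
    using address by metis
  then obtain \<I> H where HI: "\<And>x k. x \<in> {0..1} \<Longrightarrow> \<I> x k \<in> nodes k \<and> x \<in> {lo (\<I> x k)..hi (\<I> x k)} \<and>
      of_nat ratio ^ k * H x \<in> diamond (src (\<I> x k)) (tgt (\<I> x k))"
    by metis
  define far where "far x y k \<longleftrightarrow> \<I> x k \<noteq> \<I> y k \<and> tgt (\<I> x k) \<noteq> src (\<I> y k) \<and> tgt (\<I> y k) \<noteq> src (\<I> x k)" for x y k
  have near_D: "D x y \<le> 2 * A * scale k" and near_H: "real ratio ^ k * norm (H x - H y) \<le> 4"
    if x: "x \<in> {0..1}" and y: "y \<in> {0..1}" and nf: "\<not> far x y k" for x y k
  proof -
    define I where "I = \<I> x k"
    define J where "J = \<I> y k"
    have I: "I \<in> nodes k" "good_node k I" "x \<in> {lo I..hi I}" "of_nat ratio ^ k * H x \<in> diamond (src I) (tgt I)"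
      using HI[OF x, of k] good_nodes(1) by (auto simp: I_def)
    have J: "J \<in> nodes k" "good_node k J" "y \<in> {lo J..hi J}" "of_nat ratio ^ k * H y \<in> diamond (src J) (tgt J)"
      using HI[OF y, of k] good_nodes(1) by (auto simp: J_def)
    have oI: "D u v \<le> A * scale k" if "u \<in> {lo I..hi I}" "v \<in> {lo I..hi I}" for u v
      using D_le_osc[of "lo I" u "hi I" v] that I(2) by (auto simp: good_node_def)
    have oJ: "D u v \<le> A * scale k" if "u \<in> {lo J..hi J}" "v \<in> {lo J..hi J}" for u v
      using D_le_osc[of "lo J" u "hi J" v] that J(2) by (auto simp: good_node_def)
    have lt: "lo I < hi I" "lo J < hi J" using I J by (auto simp: good_node_def)
    note nI = diamond_dist_ends[OF edge_I[OF I(2)] I(4)] and nJ = diamond_dist_ends[OF edge_I[OF J(2)] J(4)]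
    have tri: "norm (of_nat ratio ^ k * H x - of_nat ratio ^ k * H y) \<le>
      norm (of_nat ratio ^ k * H x - c) + norm (of_nat ratio ^ k * H y - c)" for c
      using norm_triangle_ineq4[of "of_nat ratio ^ k * H x - c" "of_nat ratio ^ k * H y - c"] by simp
    have eq: "norm (of_nat ratio ^ k * H x - of_nat ratio ^ k * H y) = real ratio ^ k * norm (H x - H y)"
      by (simp add: right_diff_distrib[symmetric] norm_mult norm_power)
    have pos: "0 < A * scale k" using A scale_pos[of k] by simp
    consider "I = J" | "I \<noteq> J" "tgt I = src J" | "I \<noteq> J" "tgt J = src I"
      using nf by (auto simp: far_def I_def J_def)
    then have "D x y \<le> 2 * A * scale k \<and> real ratio ^ k * norm (H x - H y) \<le> 4"
    proof cases
      case 1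
      have "D x y \<le> A * scale k" using oI I J 1 by simp
      then show ?thesis using pos tri[of "src I"] nI(1) nJ(1) eq 1 by simp
    next
      case 2
      then have "hi I = lo J \<or> hi I = lo J + 1" using good_nodes(2)[OF I(1) J(1)] by (simp add: good_pair_def)
      then have "\<gamma> (hi I) = \<gamma> (lo J)" using periodic by auto
      then have "D x y \<le> D x (hi I) + D (lo J) y" using D_triangle[of x y "hi I"] by simp
      then have "D x y \<le> 2 * A * scale k" using oI[of x "hi I"] oJ[of "lo J" y] I J lt by simp
      then show ?thesis using tri[of "tgt I"] nI(2) nJ(1) eq 2 by simp
    next
      case 3
      then have "hi J = lo I \<or> hi J = lo I + 1" using good_nodes(2)[OF J(1) I(1)] by (simp add: good_pair_def)
      then have "\<gamma> (hi J) = \<gamma> (lo I)" using periodic by auto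
      then have "D x y \<le> D x (lo I) + D (hi J) y" using D_triangle[of x y "lo I"] by simp
      then have "D x y \<le> 2 * A * scale k" using oI[of x "lo I"] oJ[of "hi J" y] I J lt by simp
      then show ?thesis using tri[of "src I"] nI(1) nJ(2) eq 3 by simp
    qed
    then show "D x y \<le> 2 * A * scale k" "real ratio ^ k * norm (H x - H y) \<le> 4" by auto
  qed
  have far_D: "scale k \<le> B * D x y" and far_H: "1/2 \<le> real ratio ^ k * norm (H x - H y)"
    if x: "x \<in> {0..1}" and y: "y \<in> {0..1}" and f: "far x y k" for x y k
  proof -
    define I where "I = \<I> x k"
    define J where "J = \<I> y k"
    have I: "I \<in> nodes k" "good_node k I" "x \<in> {lo I..hi I}" "of_nat ratio ^ k * H x \<in> diamond (src I) (tgt I)"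
      using HI[OF x, of k] good_nodes(1) by (auto simp: I_def)
    have J: "J \<in> nodes k" "good_node k J" "y \<in> {lo J..hi J}" "of_nat ratio ^ k * H y \<in> diamond (src J) (tgt J)"
      using HI[OF y, of k] good_nodes(1) by (auto simp: J_def)
    have ne: "I \<noteq> J" "tgt I \<noteq> src J" "tgt J \<noteq> src I" using f by (auto simp: far_def I_def J_def)
    then have gp: "good_pair k I J" using good_nodes(2) I J by blast
    then show "scale k \<le> B * D x y" using ne I J by (auto simp: good_pair_def apart_def)
    have "{src I, tgt I} \<inter> {src J, tgt J} = {}" using gp ne by (auto simp: good_pair_def)
    then have "1/2 \<le> norm (of_nat ratio ^ k * H x - of_nat ratio ^ k * H y)"
      using diamond_far[OF edge_I[OF I(2)] edge_I[OF J(2)]] I J by blast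
    then show "1/2 \<le> real ratio ^ k * norm (H x - H y)"
      by (simp add: right_diff_distrib[symmetric] norm_mult norm_power)
  qed
  obtain M where M: "0 < M" "\<And>u v. D u v \<le> M" by (rule D_bounded) (rule that)
  have H0: "norm (H x) \<le> 4" if "x \<in> {0..1}" for x
  proof -
    have "norm (H x - src (\<I> x 0)) \<le> 2"
      using HI[OF that, of 0] good_nodes(1)[of "\<I> x 0" 0] diamond_dist_ends(1)[OF edge_I, of 0] by auto
    moreover have "norm (src (\<I> x 0)) \<le> 2"
      using HI[OF that, of 0] norm_triangle_ineq[of 1 \<i>] by auto
    ultimately show ?thesis using norm_triangle_sub[of "H x" "src (\<I> x 0)"] by simp
  qed
  define L where "L = 1 + 2 * a0 * (M / a0 + 2 * A * real ratio) + (8 + 4 * real ratio) * B / a0"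
  have pos: "0 \<le> 2 * a0 * (M / a0 + 2 * A * real ratio)" "0 \<le> (8 + 4 * real ratio) * B / a0"
    using a0 A M B_pos by (auto intro!: mult_nonneg_nonneg add_nonneg_nonneg divide_nonneg_nonneg)
  then have L: "1 \<le> L" by (simp add: L_def)
  show ?thesis
  proof (rule that[OF L])
    fix x y :: real assume x: "x \<in> {0..1}" and y: "y \<in> {0..1}"
    show "D x y / L \<le> norm (H x - H y) \<and> norm (H x - H y) \<le> L * D x y"
    proof (cases "\<exists>k. far x y k")
      case True
      define k where "k = (LEAST k. far x y k)"
      have f: "far x y k" unfolding k_def using True by (rule LeastI_ex)
      have mk: "0 < real ratio ^ k" using ratio_pos by simp
      \<comment> \<open>The mesh of level \<open>k\<close>.\<close>
      define \<epsilon> where "\<epsilon> = 1 / real ratio ^ k"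
      have \<epsilon>: "0 < \<epsilon>" "scale k = a0 * \<epsilon>" using mk by (auto simp: \<epsilon>_def scale_def)
      have upper: "D x y \<le> a0 * (M / a0 + 2 * A * real ratio) * \<epsilon> \<and> norm (H x - H y) \<le> (8 + 4 * real ratio) * \<epsilon>"
      proof (cases k)
        case 0
        have "norm (H x - H y) \<le> 8" using norm_triangle_ineq4[of "H x" "H y"] H0[OF x] H0[OF y] by simp
        moreover have "D x y \<le> M + a0 * (2 * A * real ratio)" using M(2)[of x y] a0 A by (simp add: add_increasing2)
        ultimately show ?thesis using a0 0 by (simp add: \<epsilon>_def distrib_left)
      next
        case (Suc l)
        have nf: "\<not> far x y l" using not_less_Least[of l "far x y"] Suc by (simp add: k_def)
        have \<epsilon>l: "real ratio * \<epsilon> = 1 / real ratio ^ l" using ratio_pos by (simp add: \<epsilon>_def Suc)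
        have "D x y \<le> 2 * A * (a0 * (real ratio * \<epsilon>))" using near_D[OF x y nf] unfolding \<epsilon>l by (simp add: scale_def)
        moreover have "norm (H x - H y) \<le> 4 * (real ratio * \<epsilon>)"
          using near_H[OF x y nf] ratio_pos unfolding \<epsilon>l by (simp add: pos_le_divide_eq mult.commute)
        moreover have "0 \<le> M * \<epsilon>" "0 \<le> 8 * \<epsilon>" using M \<epsilon> by auto
        ultimately show ?thesis using a0 by (simp add: algebra_simps)
      qed
      have lower: "a0 * \<epsilon> \<le> B * D x y" "\<epsilon> \<le> 2 * norm (H x - H y)"
        using far_D[OF x y f] far_H[OF x y f] \<epsilon>(2) mk by (auto simp: \<epsilon>_def pos_divide_le_eq mult.commute mult.left_commute)
      have "D x y \<le> a0 * (M / a0 + 2 * A * real ratio) * (2 * norm (H x - H y))"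
        using upper lower(2) pos(1) by (intro order_trans[OF _ mult_left_mono[OF lower(2)]]) auto
      also have "\<dots> = 2 * a0 * (M / a0 + 2 * A * real ratio) * norm (H x - H y)" by simp
      also have "\<dots> \<le> L * norm (H x - H y)" using pos by (intro mult_right_mono) (auto simp: L_def)
      finally have 1: "D x y \<le> L * norm (H x - H y)" .
      have "norm (H x - H y) \<le> (8 + 4 * real ratio) * \<epsilon>" using upper by simp
      also have "\<dots> \<le> (8 + 4 * real ratio) * (B * D x y / a0)"
        using lower(1) a0 by (intro mult_left_mono) (auto simp: pos_le_divide_eq mult.commute)
      also have "\<dots> = (8 + 4 * real ratio) * B / a0 * D x y" by simp
      also have "\<dots> \<le> L * D x y" using pos by (intro mult_right_mono) (auto simp: L_def)
      finally have 2: "norm (H x - H y) \<le> L * D x y" .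
      show ?thesis using 1 2 L by (simp add: pos_divide_le_eq mult.commute)
    next
      case False
      have small: "\<exists>k. c / real ratio ^ k < e" if "0 < e" "0 \<le> c" for c e :: real
      proof -
        have m1: "1 < real ratio" by (simp add: ratio_def)
        obtain k where "c / e < real ratio ^ k" using real_arch_pow[OF m1] by blast
        then show ?thesis using that ratio_pos by (auto simp: pos_divide_less_eq mult.commute intro!: exI[of _ k])
      qed
      have "D x y = 0"
      proof (rule ccontr)
        assume "D x y \<noteq> 0"
        then have "0 < D x y" by (simp add: order_less_le)
        moreover have "0 \<le> 2 * A * a0" using A a0 by simp
        ultimately obtain k where "2 * A * a0 / real ratio ^ k < D x y" using small by blast
        then show False using near_D[OF x y, of k] False by (simp add: scale_def)
      qed
      moreover have "norm (H x - H y) = 0"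
      proof (rule ccontr)
        assume "norm (H x - H y) \<noteq> 0"
        then have "0 < norm (H x - H y)" by simp
        then obtain k where "4 / real ratio ^ k < norm (H x - H y)" using small[of _ 4] by fastforce
        then show False using near_H[OF x y, of k] False ratio_pos by (simp add: pos_divide_less_eq mult.commute)
      qed
      ultimately show ?thesis by simp
    qed
  qed
qed

end

section \<open>Dimension and planarity of the boundary\<close>

text \<open>
  Since \<open>8 h + 4 \<le> 12 h\<close>, it suffices that \<open>h\<^sup>2\<^sup>-\<^sup>Q\<close> exceeds a constant.
\<close>

lemma exists_tooth_height:
  fixes c K Q :: real
  assumes "0 < c" "0 < K" "1 \<le> Q" "Q < 2"
  obtains h :: nat where "1 \<le> h" "c * (K * real (8 * h + 4)) powr Q \<le> 4 * (real h)\<^sup>2"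
proof -
  define M where "M = c * (12 * K) powr Q / 4"
  obtain h :: nat where h: "max 1 (M powr (1 / (2 - Q))) < real h" using reals_Archimedean2 by blast
  have M: "0 < M" using assms by (simp add: M_def)
  have "M = (M powr (1 / (2 - Q))) powr (2 - Q)" using M assms by (simp add: powr_powr)
  also have "\<dots> \<le> real h powr (2 - Q)" using h assms by (intro powr_mono2) auto
  finally have Mh: "M \<le> real h powr (2 - Q)" .
  have h0: "0 < real h" using h by simp
  have "c * (K * real (8 * h + 4)) powr Q \<le> c * (12 * K * real h) powr Q"
    using h assms by (intro mult_left_mono powr_mono2) auto
  also have "\<dots> = 4 * M * real h powr Q" using assms h0 by (simp add: M_def powr_mult)
  also have "\<dots> \<le> 4 * real h powr (2 - Q) * real h powr Q" using Mh by (intro mult_right_mono) auto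
  also have "\<dots> = 4 * (real h)\<^sup>2" using h0 by (simp add: mult.assoc flip: powr_add)
  finally show ?thesis using that[of h] h by simp
qed

context bounded_turning_loop
begin

lemma quarter_osc_pos:
  assumes "j < 4"
  shows "0 < osc (real j / 4) (real (Suc j) / 4)"
proof -
  have "\<gamma> (real j / 4) \<noteq> \<gamma> (real (Suc j) / 4)"
  proof (cases "j = 3")
    case True
    then show ?thesis using periodic[of 0] inj_onD[OF injective, of "3/4" 0] by auto
  next
    case False
    then show ?thesis using inj_onD[OF injective, of "real j / 4" "real (Suc j) / 4"] assms by auto
  qed
  then have "0 < D (real j / 4) (real (Suc j) / 4)" using in_space by (simp add: order_less_le)
  also have "\<dots> \<le> osc (real j / 4) (real (Suc j) / 4)" by (intro D_le_osc) (auto simp: divide_right_mono)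
  finally show ?thesis .
qed

text \<open>
  The quarters may have very different diameters; this is absorbed in the constant \<open>A\<close>, and only
  then is the height \<open>h\<close> of the teeth chosen, depending on \<open>A\<close>.
\<close>

lemma planar_if_small_dimension:
  assumes count: "\<And>S y r s. \<lbrakk>finite S; S \<subseteq> range \<gamma>; separated_set Z s S; 0 < s; s \<le> r; y \<in> range \<gamma>;
        \<And>x. x \<in> S \<Longrightarrow> mdist Z y x < r\<rbrakk> \<Longrightarrow> real (card S) \<le> c * (r / s) powr Q"
    and Q: "1 \<le> Q" "Q < 2" and c: "0 < c"
  obtains H L where "1 \<le> L"
    "\<And>x y. \<lbrakk>x \<in> {0..1}; y \<in> {0..1}\<rbrakk> \<Longrightarrow> D x y / L \<le> norm (H x - H y :: complex) \<and> norm (H x - H y) \<le> L * D x y"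
proof -
  define q where "q j = osc (real j / 4) (real (Suc j) / 4)" for j
  define a0 where "a0 = Min (q ` {..<4})"
  define A where "A = max 4 (Max (q ` {..<4}) / a0)"
  have a0: "0 < a0"
    unfolding a0_def q_def using quarter_osc_pos by (subst Min_gr_iff) (auto simp: lessThan_empty_iff)
  have q_bounds: "a0 \<le> q j" "q j \<le> A * a0" if "j < 4" for j
  proof -
    show "a0 \<le> q j" unfolding a0_def using that by (intro Min_le) auto
    have "q j \<le> Max (q ` {..<4})" using that by (intro Max_ge) auto
    also have "\<dots> = Max (q ` {..<4}) / a0 * a0" using a0 by simp
    also have "\<dots> \<le> A * a0" using a0 by (intro mult_right_mono) (auto simp: A_def)
    finally show "q j \<le> A * a0" .
  qed
  have A: "4 \<le> A" by (simp add: A_def)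
  then have AB: "0 < 2 * A * B" using B_pos by simp
  obtain h where h: "1 \<le> h" "c * ((2 * A * B) * real (8 * h + 4)) powr Q \<le> 4 * (real h)\<^sup>2"
    using exists_tooth_height[OF c AB Q] by blast
  then have room: "c * (2 * A * real (8 * h + 4) * B) powr Q \<le> 4 * (real h)\<^sup>2" by (simp only: mult_ac)
  define good where "good \<sigma> s t k w \<longleftrightarrow> k \<le> 2 * h + 1 \<and> w 0 = s \<and> w (8 * h + 4 + 2 * h * k) = t \<and>
      (\<forall>i < 8 * h + 4 + 2 * h * k. w i < w (Suc i) \<and> \<sigma> \<le> osc (w i) (w (Suc i)) \<and> osc (w i) (w (Suc i)) \<le> 4 * \<sigma>)"
    for \<sigma> s t :: real and k :: nat and w :: "nat \<Rightarrow> real"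
  define hyp where "hyp \<sigma> s t \<longleftrightarrow> 0 < \<sigma> \<and> s \<le> t \<and> t \<le> s + 1/2 \<and> real (8 * h + 4) * \<sigma> \<le> osc s t \<and>
        osc s t \<le> A * (real (8 * h + 4) * \<sigma>)" for \<sigma> s t
  have "\<exists>k w. good \<sigma> s t k w" if "hyp \<sigma> s t" for \<sigma> s t
  proof -
    have hh: "1 \<le> A" "0 < \<sigma>" "s \<le> t" "t \<le> s + 1/2" "real (8 * h + 4) * \<sigma> \<le> osc s t"
        "osc s t \<le> A * (real (8 * h + 4) * \<sigma>)" using that A by (auto simp: hyp_def)
    obtain k w where "k \<le> 2 * h + 1" "w 0 = s" "w (8 * h + 4 + 2 * h * k) = t"
      "\<And>i. i < 8 * h + 4 + 2 * h * k \<Longrightarrow>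
        w i < w (Suc i) \<and> \<sigma> \<le> osc (w i) (w (Suc i)) \<and> osc (w i) (w (Suc i)) \<le> 4 * \<sigma>"
      by (rule comb_subdivision[OF count hh(1) h(1) room hh(2-6)]) auto
    then show ?thesis unfolding good_def by blast
  qed
  then have "\<forall>\<sigma> s t. \<exists>k w. hyp \<sigma> s t \<longrightarrow> good \<sigma> s t k w" by blast
  then obtain teeth cut where tc: "\<And>\<sigma> s t. hyp \<sigma> s t \<Longrightarrow> good \<sigma> s t (teeth \<sigma> s t) (cut \<sigma> s t)" by metis
  interpret refinable_loop Z \<gamma> B h A a0 teeth cut
  proof
    show "4 \<le> A" "0 < a0" by fact+
    show "a0 \<le> osc (real j / 4) (real (Suc j) / 4)" "osc (real j / 4) (real (Suc j) / 4) \<le> A * a0" if "j < 4" for j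
      using q_bounds[OF that] by (simp_all only: q_def)
    fix \<sigma> s t :: real
    assume "0 < \<sigma>" "s \<le> t" "t \<le> s + 1/2" "real (8 * h + 4) * \<sigma> \<le> osc s t" "osc s t \<le> A * (real (8 * h + 4) * \<sigma>)"
    then have "hyp \<sigma> s t" by (simp only: hyp_def simp_thms)
    from tc[OF this] show "teeth \<sigma> s t \<le> 2 * h + 1 \<and> cut \<sigma> s t 0 = s \<and> cut \<sigma> s t (8 * h + 4 + 2 * h * teeth \<sigma> s t) = t \<and>
      (\<forall>i < 8 * h + 4 + 2 * h * teeth \<sigma> s t. cut \<sigma> s t i < cut \<sigma> s t (Suc i) \<and>
        \<sigma> \<le> osc (cut \<sigma> s t i) (cut \<sigma> s t (Suc i)) \<and> osc (cut \<sigma> s t i) (cut \<sigma> s t (Suc i)) \<le> 4 * \<sigma>)"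
      unfolding good_def .
  qed
  obtain H L where "1 \<le> L"
    "\<And>x y. \<lbrakk>x \<in> {0..1}; y \<in> {0..1}\<rbrakk> \<Longrightarrow> D x y / L \<le> norm (H x - H y :: complex) \<and> norm (H x - H y) \<le> L * D x y"
    by (rule planar_embedding) (rule that)
  then show ?thesis using that by blast
qed

end

text \<open>
  Infinite sets are excluded because their finite subsets would have unbounded cardinality.
\<close>

lemma assouad_bounded_from_count:
  assumes Q: "0 \<le> Q" and X: "X \<subseteq> mspace Z"
    and count: "\<And>S y r s. \<lbrakk>finite S; S \<subseteq> X; separated_set Z s S; 0 < s; s \<le> r; y \<in> X;
        \<And>x. x \<in> S \<Longrightarrow> mdist Z y x < r\<rbrakk> \<Longrightarrow> real (card S) \<le> c * (r / s) powr Q"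
  shows "assouad_bounded (submetric Z X) Q"
  unfolding assouad_bounded_def
proof (intro exI[of _ c] allI impI)
  fix \<epsilon> z r S
  assume *: "0 < \<epsilon> \<and> \<epsilon> < 1 \<and> z \<in> mspace (submetric Z X) \<and> 0 < r \<and>
      ennreal r < mdiam (submetric Z X) (mspace (submetric Z X))"
    and S: "S \<subseteq> mball_of (submetric Z X) z r" "separated_set (submetric Z X) (\<epsilon> * r) S"
  have bound: "real (card T) \<le> c * \<epsilon> powr (- Q)" if "finite T" "T \<subseteq> S" for T
  proof -
    have "separated_set Z (\<epsilon> * r) T" using S(2) that by (auto simp: separated_set_def)
    moreover have "T \<subseteq> X" "mdist Z z x < r" if "x \<in> T" for x using S(1) \<open>T \<subseteq> S\<close> that by fastforce+
    moreover have "T \<subseteq> X" using S(1) \<open>T \<subseteq> S\<close> by fastforce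
    ultimately have "real (card T) \<le> c * (r / (\<epsilon> * r)) powr Q"
      using * that(1) by (intro count[of T "\<epsilon> * r" r z]) auto
    also have "r / (\<epsilon> * r) = 1 / \<epsilon>" using * by simp
    also have "(1 / \<epsilon>) powr Q = \<epsilon> powr (- Q)" using * by (simp add: powr_divide powr_minus_divide)
    finally show ?thesis .
  qed
  have "finite S"
  proof (rule ccontr)
    assume "infinite S"
    obtain n :: nat where n: "c * \<epsilon> powr (- Q) < real n" using reals_Archimedean2 by blast
    obtain T where "T \<subseteq> S" "finite T" "card T = n" using infinite_arbitrarily_large[OF \<open>infinite S\<close>] by blast
    then show False using bound n by fastforce
  qed
  then show "finite S \<and> real (card S) \<le> c * \<epsilon> powr (- Q)" using bound by blast
qed

definition plane_vector :: "complex \<Rightarrow> real^2" where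
  "plane_vector z = vector [Re z, Im z]"

lemma dist_plane_vector: "dist (plane_vector z) (plane_vector w) = norm (z - w)"
proof -
  have "plane_vector z - plane_vector w = vector [Re (z - w), Im (z - w)]"
    by (simp add: plane_vector_def vec_eq_iff forall_2)
  then show ?thesis by (simp add: dist_norm norm_vector_2 cmod_def)
qed

theorem theorem1p5:
  fixes Y :: "'a metric" and Ybar :: "'b metric" and \<iota> :: "'a \<Rightarrow> 'b"
    and bdY :: "'b set" and r0 C lam :: real
  defines "bdY \<equiv> completion_boundary Y Ybar \<iota>"
  assumes "quasiconformal_Jordan_domain Y Ybar \<iota>"
    and "quasicircle (submetric Ybar bdY)"
    and "\<exists>C\<^sub>U>0. \<forall>y\<in>bdY. \<forall>r. 0 < r \<and> ennreal r < mdiam Ybar bdY \<longrightarrow>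
           hausdorff2 Ybar (mcball_of Ybar y r) \<le> ennreal (C\<^sub>U * r\<^sup>2)"
    and "r0 > 0" and "C > 0" and "lam > 1"
    and a: "\<And>y r R a b. y \<in> bdY \<Longrightarrow> 0 < 2 * r \<Longrightarrow> 2 * r < R \<Longrightarrow> R < r0 \<Longrightarrow>
           a \<in> mcball_of Ybar y R - mball_of Ybar y r \<Longrightarrow>
           b \<in> mcball_of Ybar y R - mball_of Ybar y r \<Longrightarrow>
           \<exists>\<gamma>. pathin (mtopology_of Ybar) \<gamma> \<and>
               \<gamma> ` {0..1} \<subseteq> mcball_of Ybar y (lam * R) - mball_of Ybar y (inverse lam * r) \<and>
               a \<in> \<gamma> ` {0..1} \<and> b \<in> \<gamma> ` {0..1}"
    and b: "\<And>z r. z \<in> \<iota> ` mspace Y \<Longrightarrow> 0 < r \<Longrightarrow> r < mdist_set Ybar z bdY \<Longrightarrow>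
           mdist_set Ybar z bdY \<le> r0 \<Longrightarrow>
           hausdorff2 Ybar (mcball_of Ybar z r) \<ge> ennreal (inverse C * r\<^sup>2)"
  shows "assouad_dim (submetric Ybar bdY) < 2 \<and>
         (\<exists>h :: 'b \<Rightarrow> real^2. bilipschitz_embedding (submetric Ybar bdY) euclidean_metric h)"
proof -
  have bdY: "bdY \<subseteq> mspace Ybar" by (auto simp: bdY_def completion_boundary_def)
  obtain CU where CU: "0 < CU" and mass_upper: "\<And>y r. \<lbrakk>y \<in> bdY; 0 < r; ennreal r < mdiam Ybar bdY\<rbrakk> \<Longrightarrow>
           hausdorff2 Ybar (mcball_of Ybar y r) \<le> ennreal (CU * r\<^sup>2)"
    using assms(4) by blast
  obtain \<gamma> B where loop: "bounded_turning_loop Ybar \<gamma> B" and \<gamma>: "\<gamma> ` {0..<1} = bdY" "range \<gamma> = bdY"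
    using quasicircle_loop[OF assms(3) bdY] by metis
  interpret bounded_turning_loop Ybar \<gamma> B by (rule loop)
  have ne: "bdY \<noteq> {}" using \<gamma>(2) by blast
  obtain \<kappa> R1 where \<kappa>: "0 < \<kappa>" "\<kappa> \<le> 1" and R1: "0 < R1"
    and holes: "\<And>y r. \<lbrakk>y \<in> bdY; 0 < r; r < R1\<rbrakk> \<Longrightarrow>
      \<exists>z\<in>mspace Ybar. mdist Ybar y z \<le> r \<and> \<kappa> * r \<le> mdist_set Ybar z bdY"
  proof (rule annulus_paths_imp_holes[OF \<open>r0 > 0\<close> \<open>lam > 1\<close>, unfolded \<gamma>(2)])
    show "\<exists>\<sigma>. pathin (mtopology_of Ybar) \<sigma> \<and>
        \<sigma> ` {0..1} \<subseteq> mcball_of Ybar y (lam * R) - mball_of Ybar y (inverse lam * r) \<and>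
        x \<in> \<sigma> ` {0..1} \<and> x' \<in> \<sigma> ` {0..1}"
      if "y \<in> bdY" "0 < 2 * r" "2 * r < R" "R < r0" "x \<in> mcball_of Ybar y R - mball_of Ybar y r"
        "x' \<in> mcball_of Ybar y R - mball_of Ybar y r" for y r R x x'
      using that by (rule a)
  qed (rule that)
  obtain q where q: "0 < q" "\<And>u. q \<le> D u (u + 1/2)" by (rule half_turn_far) (rule that)
  \<comment> \<open>Below this radius holes exist, their centres satisfy the distance condition for the lower area
    bound, and radii are smaller than the diameter of the boundary.\<close>
  define R where "R = min R1 (min r0 q)"
  have R: "0 < R" using R1 q \<open>r0 > 0\<close> by (simp add: R_def)
  have diam: "ennreal r < mdiam Ybar bdY" if "0 < r" "r < R" for r
  proof -
    have "ennreal r < ennreal q" using that by (intro ennreal_lessI) (auto simp: R_def)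
    also have "\<dots> \<le> ennreal (D 0 (0 + 1/2))" by (rule ennreal_leI[OF q(2)])
    also have "\<dots> \<le> mdiam Ybar bdY" by (rule mdist_le_mdiam) (use \<gamma>(2) in auto)
    finally show ?thesis .
  qed
  define cl where "cl = inverse C * \<kappa>\<^sup>2 / 4"
  have cl: "0 < cl" using \<open>C > 0\<close> \<kappa> by (simp add: cl_def)
  interpret porous_set Ybar bdY \<kappa> R CU cl
  proof
    show "bdY \<subseteq> mspace Ybar" "0 < \<kappa>" "\<kappa> \<le> 1" "0 < CU" "0 < cl" by fact+
    fix y r assume y: "y \<in> bdY" and r: "0 < r" "r < R"
    show "hausdorff2 Ybar (mcball_of Ybar y r) \<le> ennreal (CU * r\<^sup>2)"
      using mass_upper[OF y r(1) diam[OF r]] .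
    obtain z where z: "z \<in> mspace Ybar" "mdist Ybar y z \<le> r" "\<kappa> * r \<le> mdist_set Ybar z bdY"
      using holes[OF y r(1)] r by (auto simp: R_def)
    have dist: "\<kappa> * r \<le> mdist Ybar z x" if "x \<in> bdY" for x
      using mdist_set_le[OF ne bdY that, of z] z(3) by simp
    have \<kappa>r: "0 < \<kappa> * r" using \<kappa> r by simp
    have "mdist Ybar z z = 0" using z(1) by (subst mdist_zero) auto
    then have "z \<notin> bdY" using dist[of z] \<kappa>r by auto
    then have zY: "z \<in> \<iota> ` mspace Y" using z(1) by (auto simp: bdY_def completion_boundary_def)
    have "mdist_set Ybar z bdY \<le> r0"
      using mdist_set_le[OF ne bdY y, of z] z(2) r by (simp add: mdist_commute R_def)
    moreover have "\<kappa> * r / 2 < mdist_set Ybar z bdY" using z(3) \<kappa>r by linarith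
    ultimately have "ennreal (inverse C * (\<kappa> * r / 2)\<^sup>2) \<le> hausdorff2 Ybar (mcball_of Ybar z (\<kappa> * r / 2))"
      using b[OF zY, of "\<kappa> * r / 2"] \<kappa>r by simp
    also have "inverse C * (\<kappa> * r / 2)\<^sup>2 = cl * r\<^sup>2" by (simp add: cl_def power_divide power_mult_distrib)
    finally show "\<exists>z\<in>mspace Ybar. mdist Ybar y z \<le> r \<and> (\<forall>x\<in>bdY. \<kappa> * r \<le> mdist Ybar z x) \<and>
        ennreal (cl * r\<^sup>2) \<le> hausdorff2 Ybar (mcball_of Ybar z (\<kappa> * r / 2))"
      using z dist by blast
  qed
  have R6: "0 < R / 6" using R by simp
  obtain P where P: "finite P" "P \<subseteq> bdY" "\<And>x. x \<in> bdY \<Longrightarrow> \<exists>p\<in>P. mdist Ybar p x < R / 6"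
    using finite_net[OF R6] unfolding \<gamma>(2) by metis
  obtain c Q where Q: "1 \<le> Q" "Q < 2" "0 < c" and count:
    "\<And>S y r s. \<lbrakk>finite S; S \<subseteq> bdY; separated_set Ybar s S; 0 < s; s \<le> r; y \<in> bdY;
        \<And>x. x \<in> S \<Longrightarrow> mdist Ybar y x < r\<rbrakk> \<Longrightarrow> real (card S) \<le> c * (r / s) powr Q"
    by (rule card_separated_bound[OF P R]) (auto intro: that)
  have "assouad_bounded (submetric Ybar bdY) Q"
    using Q by (intro assouad_bounded_from_count[OF _ bdY count]) auto
  then have "assouad_dim (submetric Ybar bdY) \<le> ennreal Q"
    unfolding assouad_dim_def using Q by (intro INF_lower) auto
  also have "\<dots> < ennreal 2" using Q by (intro ennreal_lessI) auto
  finally have dim: "assouad_dim (submetric Ybar bdY) < 2" by simp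
  obtain H L where L: "1 \<le> L" and H: "\<And>x y. \<lbrakk>x \<in> {0..1}; y \<in> {0..1}\<rbrakk> \<Longrightarrow>
      D x y / L \<le> norm (H x - H y :: complex) \<and> norm (H x - H y) \<le> L * D x y"
    by (rule planar_if_small_dimension[OF count[folded \<gamma>(2)] Q]) (auto intro: that)
  define h where "h p = plane_vector (H (inv_into {0..<1} \<gamma> p))" for p
  have "bilipschitz_embedding (submetric Ybar bdY) euclidean_metric h"
    unfolding bilipschitz_embedding_def
  proof (intro conjI exI[of _ L] ballI)
    fix x y assume "x \<in> mspace (submetric Ybar bdY)" "y \<in> mspace (submetric Ybar bdY)"
    then have xy: "x \<in> \<gamma> ` {0..<1}" "y \<in> \<gamma> ` {0..<1}" using \<gamma>(1) by auto
    define u v where "u = inv_into {0..<1} \<gamma> x" and "v = inv_into {0..<1} \<gamma> y"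
    have uv: "u \<in> {0..1}" "v \<in> {0..1}" "\<gamma> u = x" "\<gamma> v = y"
      using inv_into_into[OF xy(1)] inv_into_into[OF xy(2)] f_inv_into_f[OF xy(1)] f_inv_into_f[OF xy(2)]
      by (auto simp: u_def v_def)
    show "mdist (submetric Ybar bdY) x y / L \<le> mdist euclidean_metric (h x) (h y)"
      "mdist euclidean_metric (h x) (h y) \<le> L * mdist (submetric Ybar bdY) x y"
      using H[OF uv(1,2)] uv(3,4) by (simp_all add: h_def dist_plane_vector flip: u_def v_def)
  qed (use L in auto)
  then show ?thesis using dim by blast
qed

end
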